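(* Let $X^\delta\subset X$ and $Y^\delta\subset Y$ be closed non-trivial subspaces, either both finite dimensional, or $X^\delta=X$ and $Y^\delta=Y$. Let $(f^\delta,g^\delta)\in(Y^\delta)'\times(X^\delta)'$ and let $(\theta^\delta,u^\delta)\in Y^\delta\times X^\delta$ be the solution of $N^\delta(\theta^\delta,u^\delta)=(f^\delta,g^\delta)$. Let $(\theta^{(0)},u^{(0)})\in Y^\delta\times X^\delta$ be given, and let $(\theta^{(k)},u^{(k)})_{k\ge0}$ be the sequence produced by the inexact Uzawa iteration (described in the context) with $L$ inner iterations. For $\widehat\sigma_S\in(\sigma_S,1)$, let $$C_3:=\tfrac1{\widehat\sigma_S}\Big(\tfrac{\widehat\sigma_S-\sigma_S}{\zeta_S^*}+\tfrac1{m_A}\Big),$$ and let $L\in\mathbb N$ be such that $$\sigma_A^L\big(C_3+\tfrac1{m_A}\big)\le\tfrac{\widehat\sigma_S-\sigma_S}{\zeta_S^*}.$$ Then with $C_4:=\max\big\{\tfrac1{C_3}\|\theta^\delta-\theta^{(0)}\|_{Y^\delta},\ \|u^\delta-u^{(0)}\|_{X^\delta}\big\}$ it holds for all $k\ge0$ that $$\tfrac1{C_3}\|\theta^\delta-\theta^{(k)}\|_{Y^\delta}\le\widehat\sigma_S^{\,k}C_4,\qquad\|u^\delta-u^{(k)}\|_{X^\delta}\le\widehat\sigma_S^{\,k}C_4.$$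
   Context: All linear spaces are over $\mathbb R$. $V\hookrightarrow H\simeq H'\hookrightarrow V'$ is a Gelfand triple of Hilbert spaces, $T>0$, $\Xi:=(0,T)$. Set $Y:=L_2(\Xi;V)$ and $X:=L_2(\Xi;V)\cap H^1(\Xi;V')$. It is known that $X\hookrightarrow C(\overline\Xi;H)$, and $\gamma_t\colon X\to H$ denotes the trace $w\mapsto w(t)$. Define $\mathrm{d}_t\colon X\to Y'$ by $(\mathrm{d}_t w)(v):=\int_\Xi (\tfrac{\mathrm{d}w}{\mathrm{d}t}(t))(v(t))\,\mathrm{d}t$. For a.e. $t\in\Xi$, $A(t)\colon V\to V'$ is a possibly nonlinear operator, and $A\colon Y\to Y'$ is defined by $(Aw)(v):=\int_\Xi (A(t)w(t))(v(t))\,\mathrm{d}t$. It is assumed that $A\colon Y\to Y'$ is Lipschitz continuous, $\|Aw-Av\|_{Y'}\le L_A\|w-v\|_Y$, and strongly monotone, $(Aw-Av)(w-v)\ge m_A\|w-v\|_Y^2$, for all $w,v\in Y$, with constants $L_A,m_A>0$. Primes denote duals/adjoints, and functionals in $Y'$ are viewed in $X'$ by restriction. $E_X^\delta\colon X^\delta\to X$ and $E_Y^\delta\colon Y^\delta\to Y$ are the trivial embeddings (so $(E_Y^\delta)'$, $(E_X^\delta)'$ restrict functionals to $Y^\delta$, $X^\delta$). $Y^\delta$ is equipped with $\|\cdot\|_{Y^\delta}:=\|E_Y^\delta\cdot\|_Y$, and $X^\delta$ with the $Y^\delta$-dependent norm $\|z\|_{X^\delta}:=\sqrt{\|z\|_Y^2+\|(E_Y^\delta)'\mathrm{d}_tz\|_{(Y^\delta)'}^2+\|\gamma_Tz\|_H^2}$;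 both are Hilbertian, and the duals carry the dual norms. $R_{Y^\delta}\colon Y^\delta\to(Y^\delta)'$ and $R_{X^\delta}\colon X^\delta\to(X^\delta)'$ are the Riesz isometries for these norms. Set $A_Y^\delta:=(E_Y^\delta)'AE_Y^\delta$, $A_X^\delta:=(E_X^\delta)'AE_X^\delta$, $\mathrm{d}_t^\delta:=(E_Y^\delta)'\mathrm{d}_tE_X^\delta$, $\gamma_t^\delta:=\gamma_tE_X^\delta$, and define $N^\delta\colon Y^\delta\times X^\delta\to(Y^\delta)'\times(X^\delta)'$ by $$N^\delta(\theta,u):=\big(A_Y^\delta\theta+\mathrm{d}_t^\delta u,\ (\mathrm{d}_t^\delta)'\theta-(A_X^\delta u+(\gamma_T^\delta)'\gamma_T^\delta u)\big).$$ This operator is invertible. Constants: $L_S:=\max(1,L_A,\tfrac1{m_A})$, $m_S:=\min(1,m_A,\tfrac{m_A}{L_A^2})$, and $$\zeta_S^*:=\frac{m_S}{L_S^2},\quad\sigma_S:=\sqrt{1-\frac{m_S^2}{L_S^2}},\quad\zeta_A^*:=\frac{m_A}{L_A^2},\quad\sigma_A:=\sqrt{1-\frac{m_A^2}{L_A^2}}.$$ Inexact Uzawa iteration with $L$ inner iterations: given $(\theta^{(0)},u^{(0)})\in Y^\delta\times X^\delta$, for $k=0,1,\dots$ set $\theta_0^{(k+1)}:=\theta^{(k)}$; for $i=0,\dots,L-1$ set $$\theta_{i+1}^{(k+1)}:=\theta_i^{(k+1)}-\zeta_A^*R_{Y^\delta}^{-1}\big[A_Y^\delta\theta_i^{(k+1)}-(f^\delta-\mathrm{d}_t^\delta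 u^{(k)})\big];$$ then set $\theta^{(k+1)}:=\theta_L^{(k+1)}$ and $$u^{(k+1)}:=u^{(k)}-\zeta_S^*R_{X^\delta}^{-1}\big[A_X^\delta u^{(k)}+(\gamma_T^\delta)'\gamma_T^\delta u^{(k)}+g^\delta-(\mathrm{d}_t^\delta)'\theta^{(k+1)}\big].$$ *)

theory Defs
  imports "HOL-Analysis.Analysis" "HOL-Library.Function_Algebras"
begin

text \<open>
  Function spaces over the time interval are sets of functions on the reals. Two functions
  that agree almost everywhere on \<open>(0,T)\<close> represent the same element, so the norms below are
  seminorms on functions and the norms of the usual spaces of equivalence classes.
  Addition, subtraction and zero of functions are pointwise (Function Algebras).
\<close>

abbreviation Xi :: "real \<Rightarrow> real measure" where
  "Xi T \<equiv> lebesgue_on {0<..<T}"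

text \<open>
  Bochner (strong) measurability. It is spelled out because the Hilbert spaces are not assumed
  separable, whereas the library's Bochner integral is restricted to second countable spaces.
  All integrals below have real-valued integrands.
\<close>

definition strongly_measurable :: "'a measure \<Rightarrow> ('a \<Rightarrow> 'b::real_normed_vector) \<Rightarrow> bool" where
  "strongly_measurable M f \<longleftrightarrow>
     (\<exists>s. (\<forall>n::nat. simple_function M (s n)) \<and> (AE t in M. (\<lambda>n. s n t) \<longlonglongrightarrow> f t))"

definition L2 :: "real \<Rightarrow> (real \<Rightarrow> 'b::real_normed_vector) set" where
  "L2 T = {f. strongly_measurable (Xi T) f \<and> integrable (Xi T) (\<lambda>t. (norm (f t))\<^sup>2)}"

definition norm_L2 :: "real \<Rightarrow> (real \<Rightarrow> 'b::real_normed_vector) \<Rightarrow> real" where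
  "norm_L2 T f = sqrt (\<integral>t. (norm (f t))\<^sup>2 \<partial>Xi T)"


subsection \<open>Subspaces, duals and Riesz maps for a seminorm on functions\<close>

text \<open>
  \<open>W\<close> is a closed linear subspace of \<open>S\<close> for the norm \<open>N\<close>. Sequential closedness makes \<open>W\<close>
  contain, with each function, every function of \<open>S\<close> representing the same element.
\<close>

definition closed_linear_subspace ::
  "((real \<Rightarrow> 'b::real_normed_vector) \<Rightarrow> real) \<Rightarrow> (real \<Rightarrow> 'b) set \<Rightarrow> (real \<Rightarrow> 'b) set \<Rightarrow> bool" where
  "closed_linear_subspace N S W \<longleftrightarrow>
     W \<subseteq> S \<and> 0 \<in> W \<and> (\<forall>x\<in>W. \<forall>y\<in>W. x + y \<in> W) \<and> (\<forall>c. \<forall>x\<in>W. (\<lambda>t. c *\<^sub>R x t) \<in> W) \<and>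
     (\<forall>x. \<forall>w\<in>S. (\<forall>n::nat. x n \<in> W) \<longrightarrow> (\<lambda>n. N (x n - w)) \<longlonglongrightarrow> 0 \<longrightarrow> w \<in> W)"

definition nontrivial ::
  "((real \<Rightarrow> 'b::real_normed_vector) \<Rightarrow> real) \<Rightarrow> (real \<Rightarrow> 'b) set \<Rightarrow> bool" where
  "nontrivial N W \<longleftrightarrow> (\<exists>w\<in>W. N w \<noteq> 0)"

definition finite_dimensional ::
  "((real \<Rightarrow> 'b::real_normed_vector) \<Rightarrow> real) \<Rightarrow> (real \<Rightarrow> 'b) set \<Rightarrow> bool" where
  "finite_dimensional N W \<longleftrightarrow>
     (\<exists>B. finite B \<and> B \<subseteq> W \<and> (\<forall>w\<in>W. \<exists>c. N (w - (\<Sum>b\<in>B. (\<lambda>t. c b *\<^sub>R b t))) = 0))"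

text \<open>
  A functional on \<open>W\<close> is a function whose values off \<open>W\<close> are irrelevant; restricting a
  functional to a smaller space, i.e. applying the adjoint of a trivial embedding, therefore
  leaves the function unchanged, and equality of functionals is equality on \<open>W\<close>.
\<close>

definition dual_space ::
  "((real \<Rightarrow> 'b::real_normed_vector) \<Rightarrow> real) \<Rightarrow> (real \<Rightarrow> 'b) set \<Rightarrow> ((real \<Rightarrow> 'b) \<Rightarrow> real) set" where
  "dual_space N W =
     {F. (\<forall>v\<in>W. \<forall>w\<in>W. F (v + w) = F v + F w) \<and> (\<forall>c. \<forall>v\<in>W. F (\<lambda>t. c *\<^sub>R v t) = c * F v) \<and>
         (\<exists>C. \<forall>v\<in>W. \<bar>F v\<bar> \<le> C * N v)}"

definition dual_norm ::
  "((real \<Rightarrow> 'b::real_normed_vector) \<Rightarrow> real) \<Rightarrow> (real \<Rightarrow> 'b) set \<Rightarrow> ((real \<Rightarrow> 'b) \<Rightarrow> real) \<Rightarrow> real" where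
  "dual_norm N W F = Sup {\<bar>F v\<bar> | v. v \<in> W \<and> N v \<le> 1}"

text \<open>
  The Riesz map of a Hilbertian norm: \<open>riesz N z v\<close> is the inner product of \<open>z\<close> and \<open>v\<close>,
  recovered from \<open>N\<close> by polarization.
\<close>

definition riesz ::
  "((real \<Rightarrow> 'b::real_normed_vector) \<Rightarrow> real) \<Rightarrow> (real \<Rightarrow> 'b) \<Rightarrow> (real \<Rightarrow> 'b) \<Rightarrow> real" where
  "riesz N z v = ((N (z + v))\<^sup>2 - (N (z - v))\<^sup>2) / 4"

text \<open>The choice only selects a function representing the element \<open>R\<^sup>-\<^sup>1 F\<close>.\<close>

definition riesz_inv ::
  "((real \<Rightarrow> 'b::real_normed_vector) \<Rightarrow> real) \<Rightarrow> (real \<Rightarrow> 'b) set \<Rightarrow>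
   ((real \<Rightarrow> 'b) \<Rightarrow> real) \<Rightarrow> (real \<Rightarrow> 'b)" where
  "riesz_inv N W F = (SOME r. r \<in> W \<and> (\<forall>v\<in>W. riesz N r v = F v))"


subsection \<open>Gelfand triple, the space X, time derivative and traces\<close>

text \<open>
  The dual of V is the type of bounded functionals on V with the operator norm. An element
  \<open>h\<close> of H acts on V by \<open>v \<mapsto> h \<bullet> j v\<close>.
\<close>

definition gelfand_triple :: "('v::{real_inner,banach} \<Rightarrow>\<^sub>L 'h::{real_inner,banach}) \<Rightarrow> bool" where
  "gelfand_triple j \<longleftrightarrow> inj (blinfun_apply j) \<and> closure (range (blinfun_apply j)) = UNIV"

definition test_function :: "real \<Rightarrow> (real \<Rightarrow> real) \<Rightarrow> bool" where
  "test_function T \<phi> \<longleftrightarrow>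
     (\<forall>n x. ((deriv ^^ n) \<phi>) differentiable (at x)) \<and>
     (\<exists>a b. 0 < a \<and> b < T \<and> (\<forall>x. x \<notin> {a..b} \<longrightarrow> \<phi> x = 0))"

text \<open>
  \<open>\<integral> \<phi>' w = - \<integral> \<phi> g\<close> as an identity in the dual of V, evaluated at each \<open>v\<close> of V
  (evaluation at \<open>v\<close> commutes with the Bochner integral).
\<close>

definition has_weak_derivative ::
  "real \<Rightarrow> ('v::{real_inner,banach} \<Rightarrow>\<^sub>L 'h::{real_inner,banach}) \<Rightarrow>
   (real \<Rightarrow> 'v) \<Rightarrow> (real \<Rightarrow> 'v \<Rightarrow>\<^sub>L real) \<Rightarrow> bool" where
  "has_weak_derivative T j w g \<longleftrightarrow>
     (\<forall>\<phi> v. test_function T \<phi> \<longrightarrow>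
        (\<integral>t. deriv \<phi> t * (j (w t) \<bullet> j v) \<partial>Xi T) = - (\<integral>t. \<phi> t * g t v \<partial>Xi T))"

definition space_X ::
  "real \<Rightarrow> ('v::{real_inner,banach} \<Rightarrow>\<^sub>L 'h::{real_inner,banach}) \<Rightarrow> (real \<Rightarrow> 'v) set" where
  "space_X T j = {w \<in> L2 T. \<exists>g\<in>L2 T. has_weak_derivative T j w g}"

definition weak_derivative ::
  "real \<Rightarrow> ('v::{real_inner,banach} \<Rightarrow>\<^sub>L 'h::{real_inner,banach}) \<Rightarrow>
   (real \<Rightarrow> 'v) \<Rightarrow> (real \<Rightarrow> 'v \<Rightarrow>\<^sub>L real)" where
  "weak_derivative T j w = (SOME g. g \<in> L2 T \<and> has_weak_derivative T j w g)"

definition norm_X ::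
  "real \<Rightarrow> ('v::{real_inner,banach} \<Rightarrow>\<^sub>L 'h::{real_inner,banach}) \<Rightarrow> (real \<Rightarrow> 'v) \<Rightarrow> real" where
  "norm_X T j w = sqrt ((norm_L2 T w)\<^sup>2 + (norm_L2 T (weak_derivative T j w))\<^sup>2)"

definition dt ::
  "real \<Rightarrow> ('v::{real_inner,banach} \<Rightarrow>\<^sub>L 'h::{real_inner,banach}) \<Rightarrow>
   (real \<Rightarrow> 'v) \<Rightarrow> (real \<Rightarrow> 'v) \<Rightarrow> real" where
  "dt T j w v = (\<integral>t. weak_derivative T j w t (v t) \<partial>Xi T)"

text \<open>
  \<open>\<gamma> t w = w(t)\<close>, where \<open>w\<close> in X is identified with its continuous representative with values
  in H.
\<close>

definition is_trace ::
  "real \<Rightarrow> ('v::{real_inner,banach} \<Rightarrow>\<^sub>L 'h::{real_inner,banach}) \<Rightarrow>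
   (real \<Rightarrow> (real \<Rightarrow> 'v) \<Rightarrow> 'h) \<Rightarrow> bool" where
  "is_trace T j \<gamma> \<longleftrightarrow>
     (\<forall>w\<in>space_X T j. continuous_on {0..T} (\<lambda>t. \<gamma> t w) \<and> (AE t in Xi T. \<gamma> t w = j (w t)))"

definition norm_Xd ::
  "real \<Rightarrow> ('v::{real_inner,banach} \<Rightarrow>\<^sub>L 'h::{real_inner,banach}) \<Rightarrow>
   (real \<Rightarrow> (real \<Rightarrow> 'v) \<Rightarrow> 'h) \<Rightarrow> (real \<Rightarrow> 'v) set \<Rightarrow> (real \<Rightarrow> 'v) \<Rightarrow> real" where
  "norm_Xd T j \<gamma> Yd z =
     sqrt ((norm_L2 T z)\<^sup>2 + (dual_norm (norm_L2 T) Yd (dt T j z))\<^sup>2 + (norm (\<gamma> T z))\<^sup>2)"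


subsection \<open>The operators and the iteration\<close>

definition A_op ::
  "real \<Rightarrow> (real \<Rightarrow> 'v::{real_inner,banach} \<Rightarrow> 'v \<Rightarrow>\<^sub>L real) \<Rightarrow>
   (real \<Rightarrow> 'v) \<Rightarrow> (real \<Rightarrow> 'v) \<Rightarrow> real" where
  "A_op T A w v = (\<integral>t. A t (w t) (v t) \<partial>Xi T)"

text \<open>
  The induced operator maps \<open>L2\<close> into its dual. Integrability has to be demanded separately,
  as the integral of a non-integrable function is 0 by convention.
\<close>

definition A_well_defined ::
  "real \<Rightarrow> (real \<Rightarrow> 'v::{real_inner,banach} \<Rightarrow> 'v \<Rightarrow>\<^sub>L real) \<Rightarrow> bool" where
  "A_well_defined T A \<longleftrightarrow>
     (\<forall>w\<in>L2 T. (\<forall>v\<in>L2 T. integrable (Xi T) (\<lambda>t. A t (w t) (v t))) \<and>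
               A_op T A w \<in> dual_space (norm_L2 T) (L2 T))"

definition A_lipschitz ::
  "real \<Rightarrow> (real \<Rightarrow> 'v::{real_inner,banach} \<Rightarrow> 'v \<Rightarrow>\<^sub>L real) \<Rightarrow> real \<Rightarrow> bool" where
  "A_lipschitz T A L_A \<longleftrightarrow>
     (\<forall>w\<in>L2 T. \<forall>v\<in>L2 T.
        dual_norm (norm_L2 T) (L2 T) (A_op T A w - A_op T A v) \<le> L_A * norm_L2 T (w - v))"

definition A_strongly_monotone ::
  "real \<Rightarrow> (real \<Rightarrow> 'v::{real_inner,banach} \<Rightarrow> 'v \<Rightarrow>\<^sub>L real) \<Rightarrow> real \<Rightarrow> bool" where
  "A_strongly_monotone T A m_A \<longleftrightarrow>
     (\<forall>w\<in>L2 T. \<forall>v\<in>L2 T.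
        (A_op T A w - A_op T A v) (w - v) \<ge> m_A * (norm_L2 T (w - v))\<^sup>2)"

definition N_op ::
  "real \<Rightarrow> ('v::{real_inner,banach} \<Rightarrow>\<^sub>L 'h::{real_inner,banach}) \<Rightarrow>
   (real \<Rightarrow> 'v \<Rightarrow> 'v \<Rightarrow>\<^sub>L real) \<Rightarrow> (real \<Rightarrow> (real \<Rightarrow> 'v) \<Rightarrow> 'h) \<Rightarrow>
   (real \<Rightarrow> 'v) \<times> (real \<Rightarrow> 'v) \<Rightarrow> ((real \<Rightarrow> 'v) \<Rightarrow> real) \<times> ((real \<Rightarrow> 'v) \<Rightarrow> real)" where
  "N_op T j A \<gamma> = (\<lambda>(\<theta>, u).
     (\<lambda>v. A_op T A \<theta> v + dt T j u v,
      \<lambda>z. dt T j z \<theta> - (A_op T A u z + \<gamma> T u \<bullet> \<gamma> T z)))"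

definition is_solution ::
  "real \<Rightarrow> ('v::{real_inner,banach} \<Rightarrow>\<^sub>L 'h::{real_inner,banach}) \<Rightarrow>
   (real \<Rightarrow> 'v \<Rightarrow> 'v \<Rightarrow>\<^sub>L real) \<Rightarrow> (real \<Rightarrow> (real \<Rightarrow> 'v) \<Rightarrow> 'h) \<Rightarrow>
   (real \<Rightarrow> 'v) set \<Rightarrow> (real \<Rightarrow> 'v) set \<Rightarrow> ((real \<Rightarrow> 'v) \<Rightarrow> real) \<Rightarrow> ((real \<Rightarrow> 'v) \<Rightarrow> real) \<Rightarrow>
   (real \<Rightarrow> 'v) \<Rightarrow> (real \<Rightarrow> 'v) \<Rightarrow> bool" where
  "is_solution T j A \<gamma> Yd Xd f g \<theta> u \<longleftrightarrow>
     \<theta> \<in> Yd \<and> u \<in> Xd \<and>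
     (\<forall>v\<in>Yd. fst (N_op T j A \<gamma> (\<theta>, u)) v = f v) \<and>
     (\<forall>z\<in>Xd. snd (N_op T j A \<gamma> (\<theta>, u)) z = g z)"

definition inner_step ::
  "real \<Rightarrow> ('v::{real_inner,banach} \<Rightarrow>\<^sub>L 'h::{real_inner,banach}) \<Rightarrow>
   (real \<Rightarrow> 'v \<Rightarrow> 'v \<Rightarrow>\<^sub>L real) \<Rightarrow> (real \<Rightarrow> 'v) set \<Rightarrow> ((real \<Rightarrow> 'v) \<Rightarrow> real) \<Rightarrow> real \<Rightarrow>
   (real \<Rightarrow> 'v) \<Rightarrow> (real \<Rightarrow> 'v) \<Rightarrow> (real \<Rightarrow> 'v)" where
  "inner_step T j A Yd f \<zeta> u \<theta> =
     (let r = riesz_inv (norm_L2 T) Yd (\<lambda>v. A_op T A \<theta> v - (f v - dt T j u v))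
      in (\<lambda>t. \<theta> t - \<zeta> *\<^sub>R r t))"

definition outer_step ::
  "real \<Rightarrow> ('v::{real_inner,banach} \<Rightarrow>\<^sub>L 'h::{real_inner,banach}) \<Rightarrow>
   (real \<Rightarrow> 'v \<Rightarrow> 'v \<Rightarrow>\<^sub>L real) \<Rightarrow> (real \<Rightarrow> (real \<Rightarrow> 'v) \<Rightarrow> 'h) \<Rightarrow>
   (real \<Rightarrow> 'v) set \<Rightarrow> (real \<Rightarrow> 'v) set \<Rightarrow> ((real \<Rightarrow> 'v) \<Rightarrow> real) \<Rightarrow> real \<Rightarrow>
   (real \<Rightarrow> 'v) \<Rightarrow> (real \<Rightarrow> 'v) \<Rightarrow> (real \<Rightarrow> 'v)" where
  "outer_step T j A \<gamma> Yd Xd g \<zeta> \<theta> u =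
     (let r = riesz_inv (norm_Xd T j \<gamma> Yd) Xd
                (\<lambda>z. A_op T A u z + \<gamma> T u \<bullet> \<gamma> T z + g z - dt T j z \<theta>)
      in (\<lambda>t. u t - \<zeta> *\<^sub>R r t))"

primrec inexact_uzawa ::
  "real \<Rightarrow> ('v::{real_inner,banach} \<Rightarrow>\<^sub>L 'h::{real_inner,banach}) \<Rightarrow>
   (real \<Rightarrow> 'v \<Rightarrow> 'v \<Rightarrow>\<^sub>L real) \<Rightarrow> (real \<Rightarrow> (real \<Rightarrow> 'v) \<Rightarrow> 'h) \<Rightarrow>
   (real \<Rightarrow> 'v) set \<Rightarrow> (real \<Rightarrow> 'v) set \<Rightarrow> ((real \<Rightarrow> 'v) \<Rightarrow> real) \<Rightarrow> ((real \<Rightarrow> 'v) \<Rightarrow> real) \<Rightarrow>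
   real \<Rightarrow> real \<Rightarrow> nat \<Rightarrow> (real \<Rightarrow> 'v) \<times> (real \<Rightarrow> 'v) \<Rightarrow> nat \<Rightarrow> (real \<Rightarrow> 'v) \<times> (real \<Rightarrow> 'v)" where
  "inexact_uzawa T j A \<gamma> Yd Xd f g \<zeta>A \<zeta>S L init 0 = init"
| "inexact_uzawa T j A \<gamma> Yd Xd f g \<zeta>A \<zeta>S L init (Suc k) =
     (let (\<theta>, u) = inexact_uzawa T j A \<gamma> Yd Xd f g \<zeta>A \<zeta>S L init k;
          \<theta>' = (inner_step T j A Yd f \<zeta>A u ^^ L) \<theta>
      in (\<theta>', outer_step T j A \<gamma> Yd Xd g \<zeta>S \<theta>' u))"

end

theory Submission
  imports Defs "HOL-Computational_Algebra.Polynomial"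
begin

text \<open>
  Eliminating \<open>\<theta>\<close> from the saddle point problem leaves an equation for \<open>u\<close> alone, with the Schur
  complement \<open>S\<close> as operator: let \<open>\<theta>(u)\<close> solve the first equation, \<open>A \<theta>(u) + d\<^sub>t u = f\<close> on \<open>Y\<^sup>\<delta>\<close>,
  and let \<open>S u = A u + \<gamma>\<^sub>T' \<gamma>\<^sub>T u + g - d\<^sub>t' \<theta>(u)\<close> on \<open>X\<^sup>\<delta>\<close>. Since \<open>A\<close> is Lipschitz continuous and
  strongly monotone, \<open>\<theta>(u) - \<theta>(w)\<close> is comparable to the norm of \<open>d\<^sub>t (u - w)\<close> in the dual of
  \<open>Y\<^sup>\<delta>\<close>. Consequently the three terms of \<open>S\<close> correspond to the three terms of the norm of
  \<open>X\<^sup>\<delta>\<close>, and in that norm \<open>S\<close> is Lipschitz continuous with constant \<open>L_S\<close> and strongly monotone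
  with constant \<open>m_S\<close>.

  For any such operator on a Hilbert space, a step along the Riesz lift of the residual with step
  size \<open>m / L\<^sup>2\<close> reduces the error by the factor \<open>sqrt (1 - m\<^sup>2 / L\<^sup>2)\<close> (lemma \<open>relaxation_step\<close>).
  This applies to the inner iteration, with \<open>A\<close> on \<open>Y\<^sup>\<delta>\<close> (lemma \<open>inner_iteration_error\<close>), and to
  the outer one, with \<open>S\<close> on \<open>X\<^sup>\<delta>\<close> (lemma \<open>relaxed_Schur_contraction\<close>). Stopping the inner
  iteration early perturbs the outer step by at most \<open>\<zeta>\<^sub>S\<close> times the remaining inner error (lemma
  \<open>outer_step_error\<close>), and lemma \<open>two_level_linear_convergence\<close> combines the estimates.

  The iteration is meaningful only if the Riesz lifts exist, and this is where the function spaces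
  enter. \<open>Y\<^sup>\<delta>\<close> is closed in the Bochner space \<open>L\<^sub>2\<close>, which is complete (theorem \<open>L2_complete\<close>). The
  norm of \<open>X\<^sup>\<delta>\<close> depends on \<open>Y\<^sup>\<delta>\<close>; lifts exist by linear algebra if \<open>X\<^sup>\<delta>\<close> is finite dimensional
  (theorem \<open>Riesz_finite_dimensional\<close>), and by completeness of \<open>X\<close> if both spaces are the full
  ones (lemma \<open>space_X_complete\<close>). That the norm of \<open>X\<^sup>\<delta>\<close> is Hilbertian and that \<open>X\<close> is complete
  rests on uniqueness of the weak derivative and on a continuity property of the trace at \<open>T\<close>, both
  consequences of the fundamental theorem of calculus for weak derivatives (lemma
  \<open>weak_derivative_increment\<close>).
\<close>

section \<open>Riesz representation and contractions for semi-inner products\<close>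

text \<open>
  The scalar multiplication is a parameter, because the carrier is either a set of functions, with
  the pointwise operation, or the space \<open>V\<close> itself.
\<close>

definition bounded_functional ::
  "'a::ab_group_add set \<Rightarrow> (real \<Rightarrow> 'a \<Rightarrow> 'a) \<Rightarrow> ('a \<Rightarrow> real) \<Rightarrow> ('a \<Rightarrow> real) \<Rightarrow> bool" where
  "bounded_functional W sc N F \<longleftrightarrow>
     (\<forall>v\<in>W. \<forall>w\<in>W. F (v + w) = F v + F w) \<and> (\<forall>c. \<forall>v\<in>W. F (sc c v) = c * F v) \<and>
     (\<exists>C. \<forall>v\<in>W. \<bar>F v\<bar> \<le> C * N v)"

definition seminorm_complete :: "('a::ab_group_add \<Rightarrow> real) \<Rightarrow> 'a set \<Rightarrow> bool" where
  "seminorm_complete N W \<longleftrightarrow>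
     (\<forall>x. (\<forall>n::nat. x n \<in> W) \<longrightarrow> (\<forall>e>0. \<exists>K. \<forall>m\<ge>K. \<forall>n\<ge>K. N (x m - x n) < e) \<longrightarrow>
          (\<exists>l\<in>W. (\<lambda>n. N (x n - l)) \<longlonglongrightarrow> 0))"

lemma seminorm_completeD:
  assumes "seminorm_complete N W" and "\<And>n::nat. x n \<in> W"
    and "\<And>e. 0 < e \<Longrightarrow> \<exists>K. \<forall>m\<ge>K. \<forall>n\<ge>K. N (x m - x n) < e"
  obtains l where "l \<in> W" and "(\<lambda>n. N (x n - l)) \<longlonglongrightarrow> 0"
  using assms unfolding seminorm_complete_def by blast

text \<open>
  At \<open>t = - a / (q + 1)\<close> the linear term dominates and the expression would be negative.
\<close>

lemma quadratic_nonneg_imp_linear_zero: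
  fixes a q :: real
  assumes "\<And>t. 0 \<le> 2 * t * a + t\<^sup>2 * q" and "0 \<le> q"
  shows "a = 0"
proof (rule ccontr)
  assume "a \<noteq> 0"
  define s where "s = q + 1"
  have s: "0 < s" "q - 2 * s < 0" using \<open>0 \<le> q\<close> by (auto simp: s_def)
  have "0 \<le> 2 * (- a / s) * a + (- a / s)\<^sup>2 * q" by (rule assms(1))
  also have "\<dots> = (a / s)\<^sup>2 * (q - 2 * s)"
    using s(1) by (simp add: field_simps power2_eq_square)
  also have "\<dots> < 0" using \<open>a \<noteq> 0\<close> s by (intro mult_pos_neg) auto
  finally show False by simp
qed

text \<open>
  The form may be degenerate, because two functions that agree almost everywhere are different
  elements at distance zero. Elements are therefore determined only through their products with
  the carrier, and representers and limits are unique only up to null elements.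
\<close>

locale semi_inner_space =
  fixes W :: "'a::ab_group_add set" and sc :: "real \<Rightarrow> 'a \<Rightarrow> 'a"
    and ip :: "'a \<Rightarrow> 'a \<Rightarrow> real" and N :: "'a \<Rightarrow> real"
  assumes zero_mem: "0 \<in> W"
    and add_mem: "\<And>x y. x \<in> W \<Longrightarrow> y \<in> W \<Longrightarrow> x + y \<in> W"
    and sc_mem: "\<And>c x. x \<in> W \<Longrightarrow> sc c x \<in> W"
    and sc_minus_one: "\<And>x. x \<in> W \<Longrightarrow> sc (- 1) x = - x"
    and ip_commute: "\<And>x y. x \<in> W \<Longrightarrow> y \<in> W \<Longrightarrow> ip x y = ip y x"
    and ip_add_left: "\<And>x y z. x \<in> W \<Longrightarrow> y \<in> W \<Longrightarrow> z \<in> W \<Longrightarrow> ip (x + y) z = ip x z + ip y z"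
    and ip_sc_left: "\<And>c x y. x \<in> W \<Longrightarrow> y \<in> W \<Longrightarrow> ip (sc c x) y = c * ip x y"
    and ip_nonneg: "\<And>x. x \<in> W \<Longrightarrow> 0 \<le> ip x x"
    and N_eq: "\<And>x. x \<in> W \<Longrightarrow> N x = sqrt (ip x x)"
begin

lemma minus_mem: "x \<in> W \<Longrightarrow> - x \<in> W"
  using sc_mem[of x "- 1"] sc_minus_one by simp

lemma diff_mem: "x \<in> W \<Longrightarrow> y \<in> W \<Longrightarrow> x - y \<in> W"
  using add_mem[of x "- y"] minus_mem by simp

lemma sum_sc_mem: "B \<subseteq> W \<Longrightarrow> (\<Sum>b\<in>B. sc (c b) b) \<in> W"
  by (induction B rule: infinite_finite_induct) (auto simp: zero_mem add_mem sc_mem)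

lemma N_nonneg: "x \<in> W \<Longrightarrow> 0 \<le> N x"
  by (simp add: N_eq ip_nonneg)

lemma N_square: "x \<in> W \<Longrightarrow> (N x)\<^sup>2 = ip x x"
  by (simp add: N_eq ip_nonneg)

lemma ip_minus_left: "x \<in> W \<Longrightarrow> y \<in> W \<Longrightarrow> ip (- x) y = - ip x y"
  using ip_sc_left[of x y "- 1"] sc_minus_one by simp

lemma ip_diff_left: "x \<in> W \<Longrightarrow> y \<in> W \<Longrightarrow> z \<in> W \<Longrightarrow> ip (x - y) z = ip x z - ip y z"
  using ip_add_left[of x "- y" z] ip_minus_left minus_mem by simp

lemma ip_add_right: "x \<in> W \<Longrightarrow> y \<in> W \<Longrightarrow> z \<in> W \<Longrightarrow> ip z (x + y) = ip z x + ip z y"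
  by (metis ip_add_left ip_commute add_mem)

lemma ip_diff_right: "x \<in> W \<Longrightarrow> y \<in> W \<Longrightarrow> z \<in> W \<Longrightarrow> ip z (x - y) = ip z x - ip z y"
  by (metis ip_diff_left ip_commute diff_mem)

lemma ip_sc_right: "x \<in> W \<Longrightarrow> y \<in> W \<Longrightarrow> ip y (sc c x) = c * ip y x"
  by (metis ip_sc_left ip_commute sc_mem)

lemmas mem = zero_mem add_mem sc_mem minus_mem diff_mem
lemmas ip_linear = ip_add_left ip_diff_left ip_sc_left ip_add_right ip_diff_right ip_sc_right

lemma N_square_add_sc:
  assumes "x \<in> W" "y \<in> W"
  shows "(N (x + sc c y))\<^sup>2 = (N x)\<^sup>2 + 2 * c * ip x y + c\<^sup>2 * (N y)\<^sup>2"
  using assms ip_commute[of x y]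
  by (simp add: N_square mem ip_linear algebra_simps power2_eq_square[of c])

lemma N_square_diff:
  assumes "x \<in> W" "y \<in> W"
  shows "(N (x - y))\<^sup>2 = (N x)\<^sup>2 - 2 * ip x y + (N y)\<^sup>2"
  using assms ip_commute[of x y]
  by (simp add: N_square mem ip_linear algebra_simps)

lemma N_square_add:
  assumes "x \<in> W" "y \<in> W"
  shows "(N (x + y))\<^sup>2 = (N x)\<^sup>2 + 2 * ip x y + (N y)\<^sup>2"
  using assms ip_commute[of x y]
  by (simp add: N_square mem ip_linear algebra_simps)

lemma polarization:
  "x \<in> W \<Longrightarrow> y \<in> W \<Longrightarrow> ((N (x + y))\<^sup>2 - (N (x - y))\<^sup>2) / 4 = ip x y"
  by (simp add: N_square_add N_square_diff)

lemma Cauchy_Schwarz: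
  assumes x: "x \<in> W" and y: "y \<in> W"
  shows "\<bar>ip x y\<bar> \<le> N x * N y"
proof -
  have nonneg: "0 \<le> (N x)\<^sup>2 + 2 * c * ip x y + c\<^sup>2 * (N y)\<^sup>2" for c
    using N_square_add_sc[OF x y, of c] zero_le_power2[of "N (x + sc c y)"] by linarith
  have "(ip x y)\<^sup>2 \<le> (N x)\<^sup>2 * (N y)\<^sup>2"
  proof (cases "N y = 0")
    case True
    \<comment> \<open>the quadratic degenerates to an affine function bounded below, so its slope vanishes\<close>
    have "ip x y = 0"
    proof (rule ccontr)
      assume "ip x y \<noteq> 0"
      then show False
        using nonneg[of "- ((N x)\<^sup>2 + 1) / (2 * ip x y)"] True by (simp add: field_simps)
    qed
    then show ?thesis by simp
  next
    case False
    define n where "n = (N y)\<^sup>2"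
    have "0 < n" using False by (simp add: n_def)
    have "0 \<le> (N x)\<^sup>2 + 2 * (- ip x y / n) * ip x y + (- ip x y / n)\<^sup>2 * n"
      using nonneg[of "- ip x y / n"] by (simp add: n_def)
    also have "\<dots> = (N x)\<^sup>2 - (ip x y)\<^sup>2 / n"
      using \<open>0 < n\<close> by (simp add: field_simps power2_eq_square)
    finally have "(ip x y)\<^sup>2 \<le> (N x)\<^sup>2 * n" using \<open>0 < n\<close> by (simp add: field_simps)
    then show ?thesis by (simp add: n_def)
  qed
  then have "(ip x y)\<^sup>2 \<le> (N x * N y)\<^sup>2" by (simp add: power_mult_distrib)
  then show ?thesis using N_nonneg[OF x] N_nonneg[OF y] by (metis abs_le_square_iff abs_of_nonneg mult_nonneg_nonneg)
qed

lemma N_triangle: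
  assumes x: "x \<in> W" and y: "y \<in> W"
  shows "N (x + y) \<le> N x + N y"
proof (rule power2_le_imp_le)
  show "(N (x + y))\<^sup>2 \<le> (N x + N y)\<^sup>2"
    using N_square_add[OF x y] Cauchy_Schwarz[OF x y] by (simp add: power2_sum)
qed (simp add: N_nonneg x y)

lemma N_sc: "x \<in> W \<Longrightarrow> N (sc c x) = \<bar>c\<bar> * N x"
  by (simp add: N_eq mem ip_linear real_sqrt_mult power2_eq_square flip: mult.assoc)

lemma N_minus_commute: "x \<in> W \<Longrightarrow> y \<in> W \<Longrightarrow> N (x - y) = N (y - x)"
  by (simp add: N_eq mem ip_linear)

lemma N_diff_triangle:
  assumes "x \<in> W" "y \<in> W" "z \<in> W"
  shows "N (x - z) \<le> N (x - y) + N (y - z)"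
  using N_triangle[of "x - y" "y - z"] assms by (simp add: mem)

lemma N_zero: "N 0 = 0"
  using N_eq[OF zero_mem] ip_add_left[OF zero_mem zero_mem zero_mem] by simp

lemma N_le_of_represents:
  assumes r: "r \<in> W" and "0 \<le> c" and bound: "\<And>v. v \<in> W \<Longrightarrow> \<bar>ip r v\<bar> \<le> c * N v"
  shows "N r \<le> c"
proof (cases "N r = 0")
  case False
  have "N r * N r \<le> c * N r" using bound[OF r] N_square[OF r] by (simp add: power2_eq_square)
  with False N_nonneg[OF r] show ?thesis by auto
qed (use \<open>0 \<le> c\<close> in simp)

lemma bounded_functional_ip:
  assumes "r \<in> W" shows "bounded_functional W sc N (ip r)"
  using assms Cauchy_Schwarz unfolding bounded_functional_def by (auto simp: ip_linear)

lemma bounded_functional_diff: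
  assumes F: "bounded_functional W sc N F" and G: "bounded_functional W sc N G"
  shows "bounded_functional W sc N (\<lambda>v. F v - G v)"
proof -
  obtain C D where "\<forall>v\<in>W. \<bar>F v\<bar> \<le> C * N v" "\<forall>v\<in>W. \<bar>G v\<bar> \<le> D * N v"
    using F G unfolding bounded_functional_def by blast
  then have "\<forall>v\<in>W. \<bar>F v - G v\<bar> \<le> (C + D) * N v"
    by (simp add: distrib_right) (smt (verit, best))
  then have "\<exists>C. \<forall>v\<in>W. \<bar>F v - G v\<bar> \<le> C * N v" by blast
  then show ?thesis using F G unfolding bounded_functional_def by (simp add: algebra_simps)
qed

lemma bounded_functional_add:
  assumes F: "bounded_functional W sc N F" and G: "bounded_functional W sc N G"
  shows "bounded_functional W sc N (\<lambda>v. F v + G v)"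
proof -
  obtain C D where "\<forall>v\<in>W. \<bar>F v\<bar> \<le> C * N v" "\<forall>v\<in>W. \<bar>G v\<bar> \<le> D * N v"
    using F G unfolding bounded_functional_def by blast
  then have "\<forall>v\<in>W. \<bar>F v + G v\<bar> \<le> (C + D) * N v"
    by (simp add: distrib_right) (smt (verit, best))
  then have "\<exists>C. \<forall>v\<in>W. \<bar>F v + G v\<bar> \<le> C * N v" by blast
  then show ?thesis using F G unfolding bounded_functional_def by (simp add: algebra_simps)
qed

lemma bounded_functional_null:
  assumes "bounded_functional W sc N F" "x \<in> W" "N x = 0"
  shows "F x = 0"
  using assms unfolding bounded_functional_def by (metis abs_le_zero_iff mult_zero_right)

lemma functional_diff:
  assumes F: "bounded_functional W sc N F" and "x \<in> W" "y \<in> W"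
  shows "F (x - y) = F x - F y"
proof -
  have "F (x - y) + F y = F x"
    using F assms(2,3) mem unfolding bounded_functional_def by (metis diff_add_cancel)
  then show ?thesis by simp
qed

lemma functional_sum_sc:
  assumes F: "bounded_functional W sc N F" and "finite B" and "B \<subseteq> W"
  shows "F (\<Sum>b\<in>B. sc (c b) b) = (\<Sum>b\<in>B. c b * F b)"
  using assms(2,3)
proof (induction B rule: finite_induct)
  case empty
  then show ?case using bounded_functional_null[OF F zero_mem N_zero] by simp
next
  case (insert b B)
  then have "F (sc (c b) b + (\<Sum>b\<in>B. sc (c b) b)) = F (sc (c b) b) + F (\<Sum>b\<in>B. sc (c b) b)"
    using F sum_sc_mem sc_mem unfolding bounded_functional_def by simp
  with insert F show ?case unfolding bounded_functional_def by simp
qed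

text \<open>
  A minimizer of \<open>(N v)\<^sup>2 - 2 * F v\<close> represents \<open>F\<close>. The parallelogram law makes
  minimizing sequences Cauchy, and the limit inherits the vanishing of the first variation.
\<close>

theorem Riesz_complete:
  assumes complete: "seminorm_complete N W" and F: "bounded_functional W sc N F"
  obtains r where "r \<in> W" and "\<And>v. v \<in> W \<Longrightarrow> ip r v = F v"
proof -
  obtain C where C: "\<And>v. v \<in> W \<Longrightarrow> \<bar>F v\<bar> \<le> C * N v"
    using F unfolding bounded_functional_def by blast
  have F_add: "F (v + w) = F v + F w" and F_sc: "F (sc c v) = c * F v"
    if "v \<in> W" "w \<in> W" for v w c
    using F that unfolding bounded_functional_def by auto
  define J where "J v = (N v)\<^sup>2 - 2 * F v" for v
  have J_lower: "- C\<^sup>2 \<le> J v" if "v \<in> W" for v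
  proof -
    have "0 \<le> (N v - C)\<^sup>2" by simp
    then show ?thesis using C[OF that] unfolding J_def by (auto simp: power2_diff abs_le_iff algebra_simps)
  qed
  define i where "i = Inf (J ` W)"
  have bdd: "bdd_below (J ` W)" using J_lower by (auto intro!: bdd_belowI)
  have i_le: "i \<le> J v" if "v \<in> W" for v
    unfolding i_def using bdd that by (simp add: cInf_lower)
  have "\<exists>x\<in>W. J x < i + 1 / real (Suc n)" for n
  proof -
    have "Inf (J ` W) < i + 1 / real (Suc n)" unfolding i_def by simp
    then obtain y where "y \<in> J ` W" "y < i + 1 / real (Suc n)"
      using cInf_lessD[of "J ` W"] zero_mem by blast
    then show ?thesis by blast
  qed
  then obtain x where xW: "\<And>n. x n \<in> W" and xJ: "\<And>n. J (x n) < i + 1 / real (Suc n)"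
    by metis
  \<comment> \<open>the parallelogram law\<close>
  have half: "J (sc (1/2) (v + w)) = (J v + J w) / 2 - (N (v - w))\<^sup>2 / 4" if "v \<in> W" "w \<in> W" for v w
    using that by (simp add: J_def F_add F_sc N_sc mem power_mult_distrib N_square_add N_square_diff field_simps)
  have diff_le: "(N (x m - x n))\<^sup>2 \<le> 2 / real (Suc m) + 2 / real (Suc n)" for m n
  proof -
    have "i \<le> J (sc (1/2) (x m + x n))" by (intro i_le mem xW)
    then show ?thesis using half[OF xW xW, of m n] xJ[of m] xJ[of n] by argo
  qed
  have "\<exists>K. \<forall>m\<ge>K. \<forall>n\<ge>K. N (x m - x n) < e" if "0 < e" for e
  proof -
    obtain K :: nat where K: "4 / e\<^sup>2 < real K" using reals_Archimedean2 by blast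
    have "N (x m - x n) < e" if "K \<le> m" "K \<le> n" for m n
    proof (rule power2_less_imp_less)
      have pos: "0 < real (Suc K)" by simp
      have "2 / real (Suc m) + 2 / real (Suc n) \<le> 2 / real (Suc K) + 2 / real (Suc K)"
        using that by (intro add_mono divide_left_mono) auto
      also have "\<dots> = 4 / real (Suc K)" by simp
      also have "\<dots> < e\<^sup>2"
      proof -
        have "0 < e\<^sup>2" using \<open>0 < e\<close> by simp
        moreover from this have "4 < real K * e\<^sup>2" using K by (simp add: divide_less_eq)
        ultimately have "4 < real (Suc K) * e\<^sup>2" unfolding of_nat_Suc distrib_right by linarith
        then show ?thesis by (simp add: divide_less_eq mult.commute)
      qed
      finally show "(N (x m - x n))\<^sup>2 < e\<^sup>2" using diff_le[of m n] by linarith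
    qed (use \<open>0 < e\<close> in simp)
    then show ?thesis by blast
  qed
  then obtain l where l: "l \<in> W" and lim: "(\<lambda>n. N (x n - l)) \<longlonglongrightarrow> 0"
    using seminorm_completeD[OF complete, of x] xW by blast
  have "ip l v = F v" if v: "v \<in> W" for v
  proof -
    have ip_lim: "(\<lambda>n. ip (x n) v) \<longlonglongrightarrow> ip l v"
    proof (rule LIMSEQ_I)
      fix e :: real assume "0 < e"
      have "(\<lambda>n. N (x n - l) * N v) \<longlonglongrightarrow> 0" using tendsto_mult_left_zero[OF lim] .
      from LIMSEQ_D[OF this \<open>0 < e\<close>] obtain K where K: "\<forall>n\<ge>K. norm (N (x n - l) * N v - 0) < e" by blast
      have "norm (ip (x n) v - ip l v) < e" if "K \<le> n" for n
        using K that Cauchy_Schwarz[of "x n - l" v] xW l v by (fastforce simp: mem ip_linear)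
      then show "\<exists>no. \<forall>n\<ge>no. norm (ip (x n) v - ip l v) < e" by blast
    qed
    \<comment> \<open>the first variation at the minimizing sequence, in the limit\<close>
    have "0 \<le> 2 * t * (ip l v - F v) + t\<^sup>2 * (N v)\<^sup>2" for t
    proof (rule LIMSEQ_le_const)
      show "(\<lambda>n. 1 / real (Suc n) + (2 * t * (ip (x n) v - F v) + t\<^sup>2 * (N v)\<^sup>2)) \<longlonglongrightarrow>
              2 * t * (ip l v - F v) + t\<^sup>2 * (N v)\<^sup>2"
      proof -
        have "(\<lambda>n. 1 / real (Suc n) + (2 * t * (ip (x n) v - F v) + t\<^sup>2 * (N v)\<^sup>2)) \<longlonglongrightarrow>
               0 + (2 * t * (ip l v - F v) + t\<^sup>2 * (N v)\<^sup>2)"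
          using ip_lim LIMSEQ_inverse_real_of_nat
          by (intro tendsto_intros) (auto simp: inverse_eq_divide)
        then show ?thesis by simp
      qed
      have "0 \<le> 1 / real (Suc n) + (2 * t * (ip (x n) v - F v) + t\<^sup>2 * (N v)\<^sup>2)" for n
        using i_le[of "x n + sc t v"] xJ[of n] xW v N_square_add_sc[OF xW v, of n t]
        unfolding J_def by (simp add: mem F_add F_sc algebra_simps)
      then show "\<exists>K. \<forall>n\<ge>K. 0 \<le> 1 / real (Suc n) + (2 * t * (ip (x n) v - F v) + t\<^sup>2 * (N v)\<^sup>2)"
        by blast
    qed
    then have "ip l v - F v = 0" by (rule quadratic_nonneg_imp_linear_zero) simp
    then show ?thesis by simp
  qed
  with l show ?thesis by (rule that)
qed

text \<open>
  Gram-Schmidt without coordinates. The second property of \<open>r\<close> says by duality that \<open>r\<close> lies in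
  the span of \<open>B\<close> (up to null elements), so the induction never handles linear combinations. A new
  vector \<open>b\<close> is split into its projection \<open>p\<close>, which represents \<open>ip b\<close> on \<open>B\<close>, and a remainder
  orthogonal to \<open>B\<close>; the latter corrects the value of the representer at \<open>b\<close>.
\<close>

lemma Riesz_on_finite_set:
  assumes "finite B" and "B \<subseteq> W" and "bounded_functional W sc N F"
  shows "\<exists>r\<in>W. (\<forall>b\<in>B. ip r b = F b) \<and>
           (\<forall>G. bounded_functional W sc N G \<longrightarrow> (\<forall>b\<in>B. G b = 0) \<longrightarrow> G r = 0)"
  using assms
proof (induction B arbitrary: F rule: finite_induct)
  case empty
  then show ?case using zero_mem bounded_functional_null[OF _ zero_mem N_zero] by (intro bexI[of _ 0]) auto
next
  case (insert b B)
  then have b: "b \<in> W" and BW: "B \<subseteq> W" by auto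
  obtain p where p: "p \<in> W" "\<And>c. c \<in> B \<Longrightarrow> ip p c = ip b c"
    and p_span: "\<And>G. bounded_functional W sc N G \<Longrightarrow> (\<And>c. c \<in> B \<Longrightarrow> G c = 0) \<Longrightarrow> G p = 0"
    using insert.IH[OF BW bounded_functional_ip[OF b]] by blast
  obtain r where r: "r \<in> W" "\<And>c. c \<in> B \<Longrightarrow> ip r c = F c"
    and r_span: "\<And>G. bounded_functional W sc N G \<Longrightarrow> (\<And>c. c \<in> B \<Longrightarrow> G c = 0) \<Longrightarrow> G r = 0"
    using insert.IH[OF BW insert.prems(2)] by blast
  define e where "e = b - p"
  have e: "e \<in> W" and e_perp: "\<And>c. c \<in> B \<Longrightarrow> ip e c = 0"
    using b p BW by (auto simp: e_def mem ip_linear subset_iff)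
  have "ip e p = 0" using p_span[OF bounded_functional_ip[OF e]] e_perp by blast
  then have eb: "ip e b = (N e)\<^sup>2"
    using b p e by (simp add: N_square) (simp add: e_def ip_linear mem)
  \<comment> \<open>\<open>F\<close> and \<open>ip r\<close> agree on \<open>B\<close>, hence at \<open>p\<close>, which lies in its span\<close>
  have span_F: "F p = ip r p"
    using p_span[OF bounded_functional_diff[OF insert.prems(2) bounded_functional_ip[OF r(1)]]] r
    by simp
  show ?case
  proof (cases "N e = 0")
    case True
    have "F b = F p"
      using functional_diff[OF insert.prems(2) b p(1)] bounded_functional_null[OF insert.prems(2) e True]
      by (simp add: e_def)
    moreover have "ip r b = ip r p"
      using functional_diff[OF bounded_functional_ip[OF r(1)] b p(1)]
        bounded_functional_null[OF bounded_functional_ip[OF r(1)] e True] by (simp add: e_def)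
    ultimately show ?thesis using r r_span span_F by (intro bexI[of _ r]) auto
  next
    case False
    define s where "s = r + sc ((F b - ip r b) / (N e)\<^sup>2) e"
    have "s \<in> W" using r e by (simp add: s_def mem)
    moreover have "ip s c = F c" if "c \<in> insert b B" for c
      using that r e e_perp eb b BW False by (auto simp: s_def ip_linear mem subset_iff)
    moreover have "G s = 0" if G: "bounded_functional W sc N G" and "\<forall>c\<in>insert b B. G c = 0" for G
    proof -
      have "G e = 0"
        using functional_diff[OF G b p(1)] p_span[OF G] that by (auto simp: e_def)
      moreover have "G r = 0" using r_span[OF G] that by auto
      ultimately show ?thesis using G r e unfolding s_def bounded_functional_def by (simp add: mem)
    qed
    ultimately show ?thesis by blast
  qed
qed

text \<open>
  The difference of \<open>F\<close> and the functional of its representer on \<open>B\<close> vanishes on \<open>B\<close>, hence on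
  linear combinations, and by boundedness on null elements.
\<close>

theorem Riesz_finite_dimensional:
  assumes B: "finite B" "B \<subseteq> W" "\<And>w. w \<in> W \<Longrightarrow> \<exists>c. N (w - (\<Sum>b\<in>B. sc (c b) b)) = 0"
    and F: "bounded_functional W sc N F"
  obtains r where "r \<in> W" and "\<And>v. v \<in> W \<Longrightarrow> ip r v = F v"
proof -
  obtain r where r: "r \<in> W" "\<And>b. b \<in> B \<Longrightarrow> ip r b = F b"
    using Riesz_on_finite_set[OF B(1,2) F] by blast
  define G where "G v = ip r v - F v" for v
  have G: "bounded_functional W sc N G"
    unfolding G_def by (intro bounded_functional_diff bounded_functional_ip r F)
  have "G v = 0" if "v \<in> W" for v
  proof -
    obtain c where c: "N (v - (\<Sum>b\<in>B. sc (c b) b)) = 0" using B(3)[OF \<open>v \<in> W\<close>] by blast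
    have "G v = G (\<Sum>b\<in>B. sc (c b) b)"
      using functional_diff[OF G that sum_sc_mem[OF B(2), of c]]
        bounded_functional_null[OF G diff_mem[OF that sum_sc_mem[OF B(2)]] c] by simp
    also have "\<dots> = 0" using functional_sum_sc[OF G B(1,2), of c] r(2) by (simp add: G_def)
    finally show ?thesis .
  qed
  then show ?thesis using that r(1) by (simp add: G_def)
qed

text \<open>
  A damped step for a Lipschitz and strongly monotone operator: \<open>e\<close> is the error and \<open>r\<close> the Riesz
  lift of the residual. Expanding the square gives the factor \<open>1 - 2 * z * m + z\<^sup>2 * L\<^sup>2\<close>, which is
  minimal at the step size \<open>z = m / L\<^sup>2\<close>. Both the inner and the outer iteration are such steps.
\<close>

lemma relaxation_step:
  assumes e: "e \<in> W" and r: "r \<in> W" and "0 < L" and "0 \<le> m"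
    and mono: "m * (N e)\<^sup>2 \<le> ip r e" and lip: "N r \<le> L * N e"
  shows "(N (e - sc (m / L\<^sup>2) r))\<^sup>2 \<le> (1 - m\<^sup>2 / L\<^sup>2) * (N e)\<^sup>2"
proof -
  define z where "z = m / L\<^sup>2"
  have z: "0 \<le> z" using \<open>0 < L\<close> \<open>0 \<le> m\<close> by (simp add: z_def)
  have "(N (e - sc z r))\<^sup>2 = (N e)\<^sup>2 - 2 * z * ip r e + z\<^sup>2 * (N r)\<^sup>2"
    using e r ip_commute[OF e r] by (simp add: N_square_diff mem ip_linear N_sc power_mult_distrib)
  also have "\<dots> \<le> (N e)\<^sup>2 - 2 * z * (m * (N e)\<^sup>2) + z\<^sup>2 * (L * N e)\<^sup>2"
    using mono lip z N_nonneg[OF r] N_nonneg[OF e] by (intro add_mono diff_mono mult_left_mono power_mono) auto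
  also have "\<dots> = (1 - m\<^sup>2 / L\<^sup>2) * (N e)\<^sup>2"
    using \<open>0 < L\<close> by (simp add: z_def field_simps power2_eq_square)
  finally show ?thesis by (simp add: z_def)
qed

lemma contraction_iterates_Cauchy:
  assumes maps: "\<And>x. x \<in> W \<Longrightarrow> \<Phi> x \<in> W" and q: "0 \<le> q" "q < 1"
    and contr: "\<And>x y. x \<in> W \<Longrightarrow> y \<in> W \<Longrightarrow> N (\<Phi> x - \<Phi> y) \<le> q * N (x - y)"
    and x0: "x0 \<in> W" and "0 < e"
  shows "\<exists>K. \<forall>m\<ge>K. \<forall>n\<ge>K. N ((\<Phi> ^^ m) x0 - (\<Phi> ^^ n) x0) < e"
proof -
  define x where "x n = (\<Phi> ^^ n) x0" for n
  have xW: "x n \<in> W" for n by (induction n) (auto simp: x_def x0 maps)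
  define d where "d = N (x 1 - x 0)"
  have d: "0 \<le> d" using N_nonneg xW mem by (simp add: d_def)
  have step: "N (x (Suc n) - x n) \<le> q ^ n * d" for n
  proof (induction n)
    case (Suc n)
    have "N (x (Suc (Suc n)) - x (Suc n)) \<le> q * N (x (Suc n) - x n)"
      using contr[OF xW xW, of "Suc n" n] by (simp add: x_def)
    also have "\<dots> \<le> q * (q ^ n * d)" using Suc q by (intro mult_left_mono) auto
    finally show ?case by simp
  qed (simp add: d_def)
  \<comment> \<open>the geometric series bounds all further increments\<close>
  have tail: "N (x (n + k) - x n) \<le> q ^ n * d / (1 - q)" for n k
  proof -
    have "N (x (n + k) - x n) \<le> q ^ n * d * (\<Sum>i<k. q ^ i)"
    proof (induction k)
      case 0
      then show ?case using N_zero by simp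
    next
      case (Suc k)
      have "N (x (n + Suc k) - x n) \<le> N (x (Suc (n + k)) - x (n + k)) + N (x (n + k) - x n)"
        using N_diff_triangle[OF xW xW xW] by simp
      also have "\<dots> \<le> q ^ (n + k) * d + q ^ n * d * (\<Sum>i<k. q ^ i)"
        using step Suc by (intro add_mono)
      also have "\<dots> = q ^ n * d * (\<Sum>i<Suc k. q ^ i)" by (simp add: algebra_simps power_add)
      finally show ?case .
    qed
    also have "\<dots> \<le> q ^ n * d * (1 / (1 - q))"
    proof (intro mult_left_mono)
      show "(\<Sum>i<k. q ^ i) \<le> 1 / (1 - q)"
        using q by (simp add: sum_gp_strict divide_right_mono)
    qed (use q d in auto)
    finally show ?thesis by simp
  qed
  have "(\<lambda>n. q ^ n * d / (1 - q)) \<longlonglongrightarrow> 0"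
    using q by (auto intro!: tendsto_eq_intros LIMSEQ_realpow_zero)
  from LIMSEQ_D[OF this \<open>0 < e\<close>] obtain K where K: "\<And>n. n \<ge> K \<Longrightarrow> \<bar>q ^ n * d / (1 - q)\<bar> < e"
    by auto
  have "N (x m - x n) < e" if "K \<le> m" "K \<le> n" for m n
  proof (cases "n \<le> m")
    case True
    then have "n + (m - n) = m" by simp
    then show ?thesis using tail[of n "m - n"] K[OF that(2)] by (metis abs_ge_self order.strict_trans1 order_trans)
  next
    case False
    then have "m + (n - m) = n" by simp
    then show ?thesis using tail[of m "n - m"] K[OF that(1)] N_minus_commute[OF xW xW, of m n]
      by (metis abs_ge_self order.strict_trans1 order_trans)
  qed
  then show ?thesis unfolding x_def by blast
qed

text \<open>
  Banach's fixed point theorem; for a seminorm the fixed point equation holds up to a null element.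
\<close>

theorem contraction_fixed_point:
  assumes complete: "seminorm_complete N W"
    and maps: "\<And>x. x \<in> W \<Longrightarrow> \<Phi> x \<in> W" and q: "0 \<le> q" "q < 1"
    and contr: "\<And>x y. x \<in> W \<Longrightarrow> y \<in> W \<Longrightarrow> N (\<Phi> x - \<Phi> y) \<le> q * N (x - y)"
  obtains x where "x \<in> W" and "N (\<Phi> x - x) = 0"
proof -
  define x where "x n = (\<Phi> ^^ n) 0" for n
  have xW: "x n \<in> W" for n by (induction n) (auto simp: x_def zero_mem maps)
  obtain l where l: "l \<in> W" and lim: "(\<lambda>n. N (x n - l)) \<longlonglongrightarrow> 0"
    using seminorm_completeD[OF complete, of x] xW
      contraction_iterates_Cauchy[of \<Phi> q 0, OF maps q contr zero_mem]
    unfolding x_def by blast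
  have le: "N (\<Phi> l - l) \<le> q * N (x n - l) + N (x (Suc n) - l)" for n
  proof -
    have "N (\<Phi> l - l) \<le> N (\<Phi> l - \<Phi> (x n)) + N (\<Phi> (x n) - l)"
      using N_diff_triangle l xW maps by blast
    then show ?thesis using contr[OF l xW, of n] N_minus_commute[OF l xW, of n] by (simp add: x_def)
  qed
  have "(\<lambda>n. q * N (x n - l) + N (x (Suc n) - l)) \<longlonglongrightarrow> q * 0 + 0"
    by (intro tendsto_intros lim LIMSEQ_Suc[OF lim])
  then have "N (\<Phi> l - l) \<le> 0"
    using le by (intro LIMSEQ_le_const[of _ 0 "N (\<Phi> l - l)"]) auto
  then show ?thesis using that[OF l] N_nonneg[of "\<Phi> l - l"] l maps mem by force
qed

end

section \<open>Bochner square integrable functions\<close>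

text \<open>
  Almost everywhere limits occur in the definition of strong measurability, so completeness of the
  measure is what turns strongly measurable real functions into measurable ones.
\<close>

lemma (in complete_measure) borel_measurable_cong_AE:
  assumes f: "f \<in> borel_measurable M" and eq: "AE x in M. f x = g x"
  shows "g \<in> borel_measurable M"
proof (rule measurableI)
  fix A :: "'b set" assume A: "A \<in> sets borel"
  obtain Z where Z: "Z \<in> null_sets M" "{x \<in> space M. f x \<noteq> g x} \<subseteq> Z"
    using eq unfolding eventually_ae_filter by blast
  have "g -` A \<inter> space M = (f -` A \<inter> space M - Z) \<union> (g -` A \<inter> space M \<inter> Z)"
    using Z(2) by auto
  moreover have "f -` A \<inter> space M - Z \<in> sets M"
    using measurable_sets[OF f A] Z(1) by auto
  moreover have "g -` A \<inter> space M \<inter> Z \<in> sets M"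
    using Z(1) by (intro complete[of _ Z]) auto
  ultimately show "g -` A \<inter> space M \<in> sets M" by (metis sets.Un)
qed simp

lemma (in complete_measure) borel_measurable_AE_limit:
  fixes f :: "nat \<Rightarrow> 'a \<Rightarrow> 'b::{banach, second_countable_topology}"
  assumes f: "\<And>n. f n \<in> borel_measurable M" and lim: "AE x in M. (\<lambda>n. f n x) \<longlonglongrightarrow> g x"
  shows "g \<in> borel_measurable M"
proof (rule borel_measurable_cong_AE)
  show "(\<lambda>x. lim (\<lambda>n. f n x)) \<in> borel_measurable M"
    using f by (rule borel_measurable_lim_metric)
  show "AE x in M. lim (\<lambda>n. f n x) = g x" using lim by (auto simp: limI)
qed

text \<open>
  Applied to approximating simple functions, this covers sums, inner products and the pairing of a
  dual-valued with a vector-valued function alike.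
\<close>

lemma strongly_measurable_compose2:
  assumes f: "strongly_measurable M f" and g: "strongly_measurable M g"
    and cont: "\<And>X Y x y. X \<longlonglongrightarrow> x \<Longrightarrow> Y \<longlonglongrightarrow> y \<Longrightarrow> (\<lambda>n. h (X n) (Y n)) \<longlonglongrightarrow> h x y"
  shows "strongly_measurable M (\<lambda>t. h (f t) (g t))"
proof -
  obtain s where s: "\<And>n::nat. simple_function M (s n)" "AE t in M. (\<lambda>n. s n t) \<longlonglongrightarrow> f t"
    using f unfolding strongly_measurable_def by blast
  obtain r where r: "\<And>n::nat. simple_function M (r n)" "AE t in M. (\<lambda>n. r n t) \<longlonglongrightarrow> g t"
    using g unfolding strongly_measurable_def by blast
  have "simple_function M (\<lambda>t. h (s n t) (r n t))" for n
    using s(1) r(1) by (rule simple_function_compose2)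
  moreover have "AE t in M. (\<lambda>n. h (s n t) (r n t)) \<longlonglongrightarrow> h (f t) (g t)"
    using s(2) r(2) by eventually_elim (rule cont)
  ultimately show ?thesis unfolding strongly_measurable_def
    by (intro exI[of _ "\<lambda>n t. h (s n t) (r n t)"]) auto
qed

lemma strongly_measurable_compose:
  assumes "strongly_measurable M f" and "\<And>X x. X \<longlonglongrightarrow> x \<Longrightarrow> (\<lambda>n. h (X n)) \<longlonglongrightarrow> h x"
  shows "strongly_measurable M (\<lambda>t. h (f t))"
  using strongly_measurable_compose2[OF assms(1,1), of "\<lambda>x y. h x"] assms(2) by blast

lemma strongly_measurable_const: "strongly_measurable M (\<lambda>t. c)"
  unfolding strongly_measurable_def by (intro exI[of _ "\<lambda>n t. c"]) auto

lemma (in complete_measure) strongly_measurable_imp_borel: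
  fixes f :: "'a \<Rightarrow> real"
  assumes "strongly_measurable M f"
  shows "f \<in> borel_measurable M"
proof -
  obtain s where s: "\<And>n::nat. simple_function M (s n)" "AE t in M. (\<lambda>n. s n t) \<longlonglongrightarrow> f t"
    using assms unfolding strongly_measurable_def by blast
  show ?thesis
    by (rule borel_measurable_AE_limit[OF borel_measurable_simple_function[OF s(1)] s(2)])
qed

lemma (in complete_measure) strongly_measurable_norm:
  assumes "strongly_measurable M f"
  shows "(\<lambda>t. norm (f t)) \<in> borel_measurable M"
  by (rule strongly_measurable_imp_borel[OF strongly_measurable_compose[OF assms, of norm]])
    (rule tendsto_norm)

lemma strongly_measurable_borel:
  fixes f :: "'a \<Rightarrow> real"
  assumes "f \<in> borel_measurable M"
  shows "strongly_measurable M f"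
proof -
  obtain s where "\<And>i. simple_function M (s i)" "\<And>x. x \<in> space M \<Longrightarrow> (\<lambda>i. s i x) \<longlonglongrightarrow> f x"
    using borel_measurable_implies_sequence_metric[OF assms, of 0] by metis
  then show ?thesis unfolding strongly_measurable_def by (intro exI[of _ s]) auto
qed

text \<open>
  As in Pettis' theorem: almost all values of the limit lie in the closure of a countable set \<open>D\<close>,
  namely of all values of the simple functions that approximate the \<open>f n\<close>, and the distances of
  the limit to the points of \<open>D\<close> are measurable real functions. Mapping \<open>t\<close> to the first of the
  points of \<open>D\<close> with index at most \<open>k\<close> that is nearest to \<open>g t\<close> gives simple functions converging
  to \<open>g\<close>.
\<close>

lemma (in complete_measure) strongly_measurable_AE_limit:
  fixes f :: "nat \<Rightarrow> 'a \<Rightarrow> 'b::real_normed_vector"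
  assumes f: "\<And>n. strongly_measurable M (f n)" and lim: "AE t in M. (\<lambda>n. f n t) \<longlonglongrightarrow> g t"
  shows "strongly_measurable M g"
proof -
  have "\<exists>s. \<forall>n. (\<forall>m::nat. simple_function M (s n m)) \<and> (AE t in M. (\<lambda>m. s n m t) \<longlonglongrightarrow> f n t)"
    by (rule choice) (use f in \<open>simp add: strongly_measurable_def\<close>)
  then obtain s where s: "\<And>n m. simple_function M (s n m)"
    and s_lim: "\<And>n. AE t in M. (\<lambda>m. s n m t) \<longlonglongrightarrow> f n t" by blast
  define D where "D = insert 0 (\<Union>n m. s n m ` space M)"
  have "countable D"
    unfolding D_def by (intro countable_insert countable_UN) (auto intro: countable_finite simple_functionD(1)[OF s])
  then have range_d: "range (from_nat_into D) = D" by (simp add: D_def range_from_nat_into)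
  define d where "d = from_nat_into D"
  have dist_meas: "(\<lambda>t. norm (g t - d i)) \<in> borel_measurable M" for i
  proof (rule borel_measurable_AE_limit)
    show "(\<lambda>t. norm (f n t - d i)) \<in> borel_measurable M" for n
      by (rule strongly_measurable_imp_borel[OF strongly_measurable_compose[OF f[of n], of "\<lambda>x. norm (x - d i)"]])
        (intro tendsto_intros)
    show "AE t in M. (\<lambda>n. norm (f n t - d i)) \<longlonglongrightarrow> norm (g t - d i)"
      using lim by eventually_elim (intro tendsto_intros)
  qed
  note [measurable] = dist_meas
  define nearest where
    "nearest k t i \<longleftrightarrow> i \<le> k \<and> (\<forall>j\<in>{..k}. norm (g t - d i) \<le> norm (g t - d j))" for k t i
  define p where "p k t = (LEAST i. nearest k t i)" for k t
  have "\<exists>i. nearest k t i" for k t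
  proof -
    obtain i where "i \<in> {..k}" "norm (g t - d i) = Min ((\<lambda>j. norm (g t - d j)) ` {..k})"
      using Min_in[of "(\<lambda>j. norm (g t - d j)) ` {..k}"] by fastforce
    then show ?thesis unfolding nearest_def by (intro exI[of _ i]) auto
  qed
  then have p: "nearest k t (p k t)" for k t
    unfolding p_def by (metis LeastI)
  have p_meas: "p k \<in> measurable M (count_space UNIV)" for k
    unfolding p_def nearest_def by measurable
  have "simple_function M (p k)" for k
    unfolding simple_function_eq_measurable
    using p p_meas by (auto simp: nearest_def intro: finite_subset[of _ "{..k}"])
  then have simple: "simple_function M (\<lambda>t. d (p k t))" for k
    by (rule simple_function_compose1)
  have "AE t in M. \<forall>n. (\<lambda>m. s n m t) \<longlonglongrightarrow> f n t"
    using s_lim by (simp add: AE_all_countable)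
  then have "AE t in M. (\<lambda>k. d (p k t)) \<longlonglongrightarrow> g t"
    using lim AE_space
  proof eventually_elim
    case (elim t)
    show ?case
    proof (rule LIMSEQ_I)
      fix e :: real assume "0 < e"
      then obtain n where n: "norm (f n t - g t) < e / 2"
        using LIMSEQ_D[OF elim(2), of "e / 2"] by fastforce
      obtain m where m: "norm (s n m t - f n t) < e / 2"
        using LIMSEQ_D[OF elim(1)[rule_format, of n], of "e / 2"] \<open>0 < e\<close> by fastforce
      have "s n m t \<in> range d" using elim(3) range_d by (auto simp: D_def d_def)
      then obtain i where i: "s n m t = d i" by blast
      have less: "norm (g t - d i) < e"
        using norm_triangle_sub[of "g t - d i" "g t - f n t"] n m i
        by (simp add: norm_minus_commute)
      have near: "norm (g t - d (p k t)) \<le> norm (g t - d i)" if "i \<le> k" for k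
        using p[of k t] that unfolding nearest_def by auto
      have "norm (d (p k t) - g t) < e" if "i \<le> k" for k
        using le_less_trans[OF near[OF that] less] by (simp only: norm_minus_commute)
      then show "\<exists>no. \<forall>k\<ge>no. norm (d (p k t) - g t) < e" by blast
    qed
  qed
  with simple show ?thesis
    unfolding strongly_measurable_def by (intro exI[of _ "\<lambda>k t. d (p k t)"]) simp
qed

lemma complete_measure_lebesgue_on:
  assumes "S \<in> sets lebesgue" shows "complete_measure (lebesgue_on S)"
proof
  fix A B assume "B \<subseteq> A" "A \<in> null_sets (lebesgue_on S)"
  then have "A \<in> null_sets lebesgue" "B \<subseteq> S"
    using assms by (auto simp: null_sets_restrict_space)
  then have "B \<in> sets lebesgue" using \<open>B \<subseteq> A\<close> completion.complete by blast
  then show "B \<in> sets (lebesgue_on S)" using \<open>B \<subseteq> S\<close> assms by (simp add: sets_restrict_space_iff)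
qed

interpretation Xi: complete_measure "Xi T" for T
  by (rule complete_measure_lebesgue_on) simp

interpretation Xi: finite_measure "Xi T" for T
  by (rule finite_measure_lebesgue_on) simp

lemma L2_measurable: "f \<in> L2 T \<Longrightarrow> strongly_measurable (Xi T) f"
  and L2_integrable_square: "f \<in> L2 T \<Longrightarrow> integrable (Xi T) (\<lambda>t. (norm (f t))\<^sup>2)"
  unfolding L2_def by auto

lemma L2_bounded_by:
  assumes "strongly_measurable (Xi T) f" and "integrable (Xi T) b"
    and "AE t in Xi T. (norm (f t))\<^sup>2 \<le> b t"
  shows "f \<in> L2 T"
proof -
  have [measurable]: "(\<lambda>t. norm (f t)) \<in> borel_measurable (Xi T)"
    using assms(1) by (rule Xi.strongly_measurable_norm)
  have "integrable (Xi T) (\<lambda>t. (norm (f t))\<^sup>2)"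
  proof (rule Bochner_Integration.integrable_bound[OF assms(2)])
    show "(\<lambda>t. (norm (f t))\<^sup>2) \<in> borel_measurable (Xi T)" by measurable
    show "AE t in Xi T. norm ((norm (f t))\<^sup>2) \<le> norm (b t)"
      using assms(3) by eventually_elim auto
  qed
  then show ?thesis using assms(1) by (simp add: L2_def)
qed

lemma square_add_le: "(a + b)\<^sup>2 \<le> 2 * a\<^sup>2 + 2 * b\<^sup>2" for a b :: real
  using zero_le_power2[of "a - b"] by (simp add: power2_sum power2_diff)

lemma L2_zero: "0 \<in> L2 T"
  by (simp add: L2_def strongly_measurable_const zero_fun_def)

lemma L2_scaleR:
  assumes "f \<in> L2 T" shows "(\<lambda>t. c *\<^sub>R f t) \<in> L2 T"
proof -
  have "strongly_measurable (Xi T) (\<lambda>t. c *\<^sub>R f t)"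
    by (rule strongly_measurable_compose[OF L2_measurable[OF assms]]) (intro tendsto_intros)
  then show ?thesis using L2_integrable_square[OF assms] by (simp add: L2_def power_mult_distrib)
qed

lemma L2_add:
  assumes f: "f \<in> L2 T" and g: "g \<in> L2 T" shows "f + g \<in> L2 T"
proof (rule L2_bounded_by)
  show "strongly_measurable (Xi T) (f + g)"
    using strongly_measurable_compose2[OF L2_measurable[OF f] L2_measurable[OF g], of "(+)"]
    by (simp add: tendsto_add plus_fun_def)
  show "integrable (Xi T) (\<lambda>t. 2 * (norm (f t))\<^sup>2 + 2 * (norm (g t))\<^sup>2)"
    using L2_integrable_square[OF f] L2_integrable_square[OF g] by simp
  have "(norm (f t + g t))\<^sup>2 \<le> 2 * (norm (f t))\<^sup>2 + 2 * (norm (g t))\<^sup>2" for t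
    using order_trans[OF power_mono[OF norm_triangle_ineq norm_ge_zero] square_add_le] .
  then show "AE t in Xi T. (norm ((f + g) t))\<^sup>2 \<le> 2 * (norm (f t))\<^sup>2 + 2 * (norm (g t))\<^sup>2"
    by simp
qed

lemma L2_diff:
  assumes "f \<in> L2 T" and "g \<in> L2 T" shows "f - g \<in> L2 T"
  using L2_add[OF assms(1) L2_scaleR[OF assms(2), of "- 1"]]
  by (simp add: plus_fun_def fun_diff_def)

lemma norm_L2_nonneg: "0 \<le> norm_L2 T f"
  by (simp add: norm_L2_def)

lemma norm_L2_square: "(norm_L2 T f)\<^sup>2 = (\<integral>t. (norm (f t))\<^sup>2 \<partial>Xi T)"
  by (simp add: norm_L2_def)

lemma norm_L2_scaleR: "norm_L2 T (\<lambda>t. c *\<^sub>R f t) = \<bar>c\<bar> * norm_L2 T f"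
  by (simp add: norm_L2_def power_mult_distrib real_sqrt_mult)

lemma norm_L2_cong:
  assumes "f \<in> L2 T" "g \<in> L2 T" "AE t in Xi T. f t = g t"
  shows "norm_L2 T f = norm_L2 T g"
  unfolding norm_L2_def using assms(3)
  by (intro arg_cong[of _ _ sqrt] integral_cong_AE borel_measurable_integrable L2_integrable_square assms)
    auto

lemma nn_integral_norm_square:
  assumes "f \<in> L2 T"
  shows "(\<integral>\<^sup>+t. ennreal ((norm (f t))\<^sup>2) \<partial>Xi T) = ennreal ((norm_L2 T f)\<^sup>2)"
  using nn_integral_eq_integral[OF L2_integrable_square[OF assms]] by (simp add: norm_L2_square)

lemma L2_Fatou:
  fixes y :: "nat \<Rightarrow> real \<Rightarrow> 'b::real_normed_vector"
  assumes y: "\<And>k. y k \<in> L2 T" and "0 \<le> c" and bound: "eventually (\<lambda>k. norm_L2 T (y k) \<le> c) sequentially"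
    and lim: "AE t in Xi T. (\<lambda>k. y k t) \<longlonglongrightarrow> z t"
  shows "z \<in> L2 T" and "norm_L2 T z \<le> c"
proof -
  have z_meas: "strongly_measurable (Xi T) z"
    by (rule Xi.strongly_measurable_AE_limit[OF L2_measurable[OF y] lim])
  have [measurable]: "(\<lambda>t. norm (z t)) \<in> borel_measurable (Xi T)"
     "(\<lambda>t. norm (y k t)) \<in> borel_measurable (Xi T)" for k
    using z_meas L2_measurable[OF y] by (auto intro: Xi.strongly_measurable_norm)
  have "(\<integral>\<^sup>+t. ennreal ((norm (z t))\<^sup>2) \<partial>Xi T) =
        (\<integral>\<^sup>+t. liminf (\<lambda>k. ennreal ((norm (y k t))\<^sup>2)) \<partial>Xi T)"
  proof (rule nn_integral_cong_AE)
    show "AE t in Xi T. ennreal ((norm (z t))\<^sup>2) = liminf (\<lambda>k. ennreal ((norm (y k t))\<^sup>2))"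
      using lim
    proof eventually_elim
      case (elim t)
      then have "(\<lambda>k. ennreal ((norm (y k t))\<^sup>2)) \<longlonglongrightarrow> ennreal ((norm (z t))\<^sup>2)"
        by (intro tendsto_intros)
      then show ?case using lim_imp_Liminf[OF trivial_limit_sequentially] by metis
    qed
  qed
  also have "\<dots> \<le> liminf (\<lambda>k. \<integral>\<^sup>+t. ennreal ((norm (y k t))\<^sup>2) \<partial>Xi T)"
    by (rule nn_integral_liminf) measurable
  also have "\<dots> \<le> liminf (\<lambda>k. ennreal (c\<^sup>2))"
  proof (rule Liminf_mono)
    show "\<forall>\<^sub>F k in sequentially. (\<integral>\<^sup>+t. ennreal ((norm (y k t))\<^sup>2) \<partial>Xi T) \<le> ennreal (c\<^sup>2)"
      using bound
    proof eventually_elim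
      case (elim k)
      then show ?case
        by (simp add: nn_integral_norm_square[OF y] ennreal_leI power_mono norm_L2_nonneg)
    qed
  qed
  also have "\<dots> = ennreal (c\<^sup>2)" by (simp add: Liminf_const)
  finally have le: "(\<integral>\<^sup>+t. ennreal ((norm (z t))\<^sup>2) \<partial>Xi T) \<le> ennreal (c\<^sup>2)" .
  then have "integrable (Xi T) (\<lambda>t. (norm (z t))\<^sup>2)"
    by (intro integrableI_bounded) (measurable, simp add: order.strict_trans1)
  then show zL: "z \<in> L2 T" using z_meas by (simp add: L2_def)
  have "(norm_L2 T z)\<^sup>2 \<le> c\<^sup>2" using le by (simp add: nn_integral_norm_square[OF zL])
  then show "norm_L2 T z \<le> c" using \<open>0 \<le> c\<close> by (rule power2_le_imp_le)
qed

text \<open>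
  On a set of finite measure the \<open>L\<^sub>2\<close> norm controls the \<open>L\<^sub>1\<close> norm; linearity of the bound in \<open>c\<close>
  is what makes the increments of a rapidly Cauchy sequence summable.
\<close>

lemma nn_integral_norm_le:
  assumes f: "f \<in> L2 T" and "norm_L2 T f \<le> c" and "0 < c"
  shows "(\<integral>\<^sup>+t. ennreal (norm (f t)) \<partial>Xi T) \<le> ennreal (c * (1 + measure (Xi T) (space (Xi T))))"
proof -
  define \<mu> where "\<mu> = measure (Xi T) (space (Xi T))"
  \<comment> \<open>instead of Hoelder's inequality, Young's inequality balanced with weight \<open>c\<close>\<close>
  have young: "norm (f t) \<le> (norm (f t))\<^sup>2 / c + c" for t
  proof -
    have "2 * norm (f t) * c \<le> (norm (f t))\<^sup>2 + c\<^sup>2" by (rule sum_squares_bound)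
    moreover have "0 \<le> norm (f t) * c" using \<open>0 < c\<close> by simp
    ultimately have "norm (f t) * c \<le> (norm (f t))\<^sup>2 + c * c"
      unfolding power2_eq_square[of c] by linarith
    then show ?thesis using \<open>0 < c\<close> by (simp add: field_simps)
  qed
  have int: "integrable (Xi T) (\<lambda>t. (norm (f t))\<^sup>2 / c + c)"
    using L2_integrable_square[OF f] by simp
  have "(\<integral>\<^sup>+t. ennreal (norm (f t)) \<partial>Xi T) \<le> (\<integral>\<^sup>+t. ennreal ((norm (f t))\<^sup>2 / c + c) \<partial>Xi T)"
    using young by (intro nn_integral_mono ennreal_leI) auto
  also have "\<dots> = ennreal (\<integral>t. (norm (f t))\<^sup>2 / c + c \<partial>Xi T)"
    using \<open>0 < c\<close> by (intro nn_integral_eq_integral[OF int]) auto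
  also have "(\<integral>t. (norm (f t))\<^sup>2 / c + c \<partial>Xi T) = (norm_L2 T f)\<^sup>2 / c + \<mu> * c"
    using L2_integrable_square[OF f] by (simp add: norm_L2_square \<mu>_def)
  also have "(norm_L2 T f)\<^sup>2 / c + \<mu> * c \<le> c\<^sup>2 / c + \<mu> * c"
    using assms norm_L2_nonneg by (intro add_mono divide_right_mono power_mono) auto
  also have "c\<^sup>2 / c + \<mu> * c = c * (1 + \<mu>)" using \<open>0 < c\<close> by (simp add: field_simps power2_eq_square)
  finally show ?thesis by (simp add: \<mu>_def ennreal_leI)
qed

lemma norm_L2_minus_commute: "norm_L2 T (f - g) = norm_L2 T (g - f)"
  by (simp add: norm_L2_def norm_minus_commute)

text \<open>
  The Riesz-Fischer argument: along a subsequence with geometrically decaying increments the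
  increments are summable almost everywhere, so the subsequence converges pointwise, and Fatou's
  lemma upgrades this to convergence of the whole sequence in norm.
\<close>

theorem L2_complete:
  "seminorm_complete (norm_L2 T) (L2 T :: (real \<Rightarrow> 'b::banach) set)"
  unfolding seminorm_complete_def
proof (intro allI impI)
  fix x :: "nat \<Rightarrow> real \<Rightarrow> 'b"
  assume "\<forall>n. x n \<in> L2 T" and Cauchy: "\<forall>e>0. \<exists>K. \<forall>m\<ge>K. \<forall>n\<ge>K. norm_L2 T (x m - x n) < e"
  then have x: "x n \<in> L2 T" for n by blast
  obtain K where K: "\<And>k m n. K k \<le> m \<Longrightarrow> K k \<le> n \<Longrightarrow> norm_L2 T (x m - x n) < (1/2) ^ k"
    using Cauchy[rule_format, of "(1/2) ^ k" for k] by (metis half_gt_zero zero_less_one zero_less_power)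
  \<comment> \<open>indices beyond \<open>K k\<close> that increase with \<open>k\<close> and tend to infinity\<close>
  define r where "r k = (\<Sum>i\<le>k. Suc (K i))" for k
  have rK: "K k \<le> r k" and rSuc: "r k \<le> r (Suc k)" and rk: "k \<le> r k" for k
  proof -
    show "K k \<le> r k" unfolding r_def
      using member_le_sum[of k "{..k}" "\<lambda>i. Suc (K i)"] by simp
    show "r k \<le> r (Suc k)" by (simp add: r_def)
    show "k \<le> r k" by (induction k) (auto simp: r_def)
  qed
  define d where "d k = x (r (Suc k)) - x (r k)" for k
  have dL: "d k \<in> L2 T" for k using x by (simp add: d_def L2_diff)
  have d_le: "norm_L2 T (d k) \<le> (1/2) ^ k" for k
    using K[of k "r (Suc k)" "r k"] rK[of k] rSuc[of k] by (simp add: d_def)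
  have [measurable]: "(\<lambda>t. norm (d k t)) \<in> borel_measurable (Xi T)" for k
    using L2_measurable[OF dL] by (rule Xi.strongly_measurable_norm)
  define \<mu> where "\<mu> = measure (Xi T) (space (Xi T))"
  have "(\<integral>\<^sup>+t. (\<Sum>k. ennreal (norm (d k t))) \<partial>Xi T) = (\<Sum>k. \<integral>\<^sup>+t. ennreal (norm (d k t)) \<partial>Xi T)"
    by (rule nn_integral_suminf) measurable
  also have "\<dots> \<le> (\<Sum>k. ennreal ((1/2) ^ k * (1 + \<mu>)))"
    using nn_integral_norm_le[OF dL d_le] by (intro suminf_le) (auto simp: \<mu>_def)
  also have "\<dots> < \<infinity>"
  proof -
    have "summable (\<lambda>k. (1/2::real) ^ k * (1 + \<mu>))"
      by (intro summable_mult2 summable_geometric) simp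
    then show ?thesis
      by (subst suminf_ennreal2) (auto simp: \<mu>_def)
  qed
  finally have finite: "(\<integral>\<^sup>+t. (\<Sum>k. ennreal (norm (d k t))) \<partial>Xi T) < \<infinity>" .
  have "(\<lambda>t. \<Sum>k. ennreal (norm (d k t))) \<in> borel_measurable (Xi T)" by measurable
  from nn_integral_PInf_AE[OF this] finite
  have "AE t in Xi T. (\<Sum>k. ennreal (norm (d k t))) \<noteq> \<infinity>" by auto
  then have conv: "AE t in Xi T. (\<lambda>k. x (r k) t) \<longlonglongrightarrow> lim (\<lambda>k. x (r k) t)"
  proof eventually_elim
    case (elim t)
    then have "summable (\<lambda>k. norm (d k t))"
      by (intro summable_suminf_not_top) auto
    then have "summable (\<lambda>k. x (r (Suc k)) t - x (r k) t)"
      using summable_norm_cancel by (auto simp: d_def)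
    then have "(\<lambda>n. \<Sum>k<n. x (r (Suc k)) t - x (r k) t) \<longlonglongrightarrow> (\<Sum>k. x (r (Suc k)) t - x (r k) t)"
      by (rule summable_LIMSEQ)
    then have "(\<lambda>n. x (r n) t - x (r 0) t) \<longlonglongrightarrow> (\<Sum>k. x (r (Suc k)) t - x (r k) t)"
      using sum_lessThan_telescope[of "\<lambda>k. x (r k) t"] by simp
    from tendsto_add[OF this tendsto_const[of "x (r 0) t"]] show ?case by (simp add: limI)
  qed
  define f where "f t = lim (\<lambda>k. x (r k) t)" for t
  have close: "x n - f \<in> L2 T \<and> norm_L2 T (x n - f) \<le> (1/2) ^ k" if "K k \<le> n" for n k
  proof -
    have ev: "eventually (\<lambda>i. norm_L2 T (x n - x (r i)) \<le> (1/2) ^ k) sequentially"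
      using eventually_ge_at_top[of "K k"]
    proof eventually_elim
      case (elim i)
      then show ?case using K[of k n "r i"] that rk[of i] by simp
    qed
    have "AE t in Xi T. (\<lambda>i. (x n - x (r i)) t) \<longlonglongrightarrow> (x n - f) t"
      using conv unfolding f_def by eventually_elim (auto intro!: tendsto_intros)
    from L2_Fatou[OF L2_diff[OF x x] _ ev this] show ?thesis by (simp add: fun_diff_def)
  qed
  have "x (K 0) - (x (K 0) - f) \<in> L2 T" using L2_diff[OF x] close[of 0 "K 0"] by blast
  moreover have "x (K 0) - (x (K 0) - f) = f" by (simp add: fun_eq_iff)
  ultimately have fL: "f \<in> L2 T" by (simp only:)
  have "(\<lambda>n. norm_L2 T (x n - f)) \<longlonglongrightarrow> 0"
  proof (rule LIMSEQ_I)
    fix e :: real assume "0 < e"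
    then obtain k where k: "(1/2) ^ k < e" using real_arch_pow_inv[of e "1/2"] by auto
    have "norm (norm_L2 T (x n - f) - 0) < e" if "K k \<le> n" for n
      using close[OF that] k norm_L2_nonneg[of T "x n - f"] by simp
    then show "\<exists>no. \<forall>n\<ge>no. norm (norm_L2 T (x n - f) - 0) < e" by blast
  qed
  with fL show "\<exists>l\<in>L2 T. (\<lambda>n. norm_L2 T (x n - l)) \<longlonglongrightarrow> 0" by blast
qed

definition ip_L2 :: "real \<Rightarrow> (real \<Rightarrow> 'b::real_inner) \<Rightarrow> (real \<Rightarrow> 'b) \<Rightarrow> real" where
  "ip_L2 T f g = (\<integral>t. f t \<bullet> g t \<partial>Xi T)"

lemma integrable_inner:
  fixes f g :: "real \<Rightarrow> 'b::real_inner"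
  assumes f: "f \<in> L2 T" and g: "g \<in> L2 T"
  shows "integrable (Xi T) (\<lambda>t. f t \<bullet> g t)"
proof (rule Bochner_Integration.integrable_bound)
  show "integrable (Xi T) (\<lambda>t. (norm (f t))\<^sup>2 + (norm (g t))\<^sup>2)"
    using L2_integrable_square[OF f] L2_integrable_square[OF g] by simp
  show "(\<lambda>t. f t \<bullet> g t) \<in> borel_measurable (Xi T)"
    by (rule Xi.strongly_measurable_imp_borel[OF
        strongly_measurable_compose2[OF L2_measurable[OF f] L2_measurable[OF g]]]) (intro tendsto_intros)
  have "norm (f t \<bullet> g t) \<le> norm ((norm (f t))\<^sup>2 + (norm (g t))\<^sup>2)" for t
    using Cauchy_Schwarz_ineq2[of "f t" "g t"] sum_squares_bound[of "norm (f t)" "norm (g t)"]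
      mult_nonneg_nonneg[OF norm_ge_zero[of "f t"] norm_ge_zero[of "g t"]]
    by simp
  then show "AE t in Xi T. norm (f t \<bullet> g t) \<le> norm ((norm (f t))\<^sup>2 + (norm (g t))\<^sup>2)" by simp
qed

abbreviation fun_scale :: "real \<Rightarrow> (real \<Rightarrow> 'b::real_vector) \<Rightarrow> real \<Rightarrow> 'b" where
  "fun_scale c x \<equiv> (\<lambda>t. c *\<^sub>R x t)"

lemma semi_inner_space_L2:
  assumes "W \<subseteq> L2 T" and "0 \<in> W" and "\<And>x y. x \<in> W \<Longrightarrow> y \<in> W \<Longrightarrow> x + y \<in> W"
    and "\<And>c x. x \<in> W \<Longrightarrow> (\<lambda>t. c *\<^sub>R x t) \<in> W"
  shows "semi_inner_space W fun_scale (ip_L2 T) (norm_L2 T)"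
proof
  fix x y z :: "real \<Rightarrow> 'a" and c assume "x \<in> W" "y \<in> W" "z \<in> W"
  then have "x \<in> L2 T" "y \<in> L2 T" "z \<in> L2 T" using assms(1) by auto
  then show "ip_L2 T (x + y) z = ip_L2 T x z + ip_L2 T y z"
    by (simp add: ip_L2_def inner_add_left integrable_inner)
qed (use assms in \<open>auto simp: ip_L2_def norm_L2_def inner_commute power2_norm_eq_inner\<close>)

lemma L2_norm_mem:
  assumes "f \<in> L2 T" shows "(\<lambda>t. norm (f t)) \<in> L2 T" and "norm_L2 T (\<lambda>t. norm (f t)) = norm_L2 T f"
proof -
  have "strongly_measurable (Xi T) (\<lambda>t. norm (f t))"
    by (rule strongly_measurable_compose[OF L2_measurable[OF assms]]) (rule tendsto_norm)
  then show "(\<lambda>t. norm (f t)) \<in> L2 T" using L2_integrable_square[OF assms] by (simp add: L2_def)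
qed (simp add: norm_L2_def)

text \<open>
  Cauchy-Schwarz for the scalar functions \<open>norm (f t)\<close> and \<open>norm (g t)\<close>; in this form it applies to
  duality pairings, which are not inner products.
\<close>

lemma L2_dominated_pairing:
  assumes f: "f \<in> L2 T" and g: "g \<in> L2 T" and h: "h \<in> borel_measurable (Xi T)"
    and bound: "\<And>t. \<bar>h t\<bar> \<le> norm (f t) * norm (g t)"
  shows "integrable (Xi T) h" and "\<bar>\<integral>t. h t \<partial>Xi T\<bar> \<le> norm_L2 T f * norm_L2 T g"
proof -
  interpret semi_inner_space "L2 T :: (real \<Rightarrow> real) set" fun_scale "ip_L2 T" "norm_L2 T"
    by (rule semi_inner_space_L2) (use L2_scaleR[where 'a=real] in \<open>auto intro: L2_add L2_zero\<close>)
  have int: "integrable (Xi T) (\<lambda>t. norm (f t) * norm (g t))"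
    using integrable_inner[OF L2_norm_mem(1)[OF f] L2_norm_mem(1)[OF g]] by (simp add: mult.commute)
  then show inth: "integrable (Xi T) h"
    by (rule Bochner_Integration.integrable_bound) (use h bound in auto)
  have "\<bar>\<integral>t. h t \<partial>Xi T\<bar> \<le> (\<integral>t. norm (f t) * norm (g t) \<partial>Xi T)"
    using Bochner_Integration.integral_norm_bound_integral[OF inth int] bound by simp
  also have "\<dots> \<le> \<bar>ip_L2 T (\<lambda>t. norm (f t)) (\<lambda>t. norm (g t))\<bar>"
    by (simp add: ip_L2_def mult.commute)
  also have "\<dots> \<le> norm_L2 T f * norm_L2 T g"
    using Cauchy_Schwarz[OF L2_norm_mem(1)[OF f] L2_norm_mem(1)[OF g]]
    by (simp add: L2_norm_mem[OF f] L2_norm_mem[OF g])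
  finally show "\<bar>\<integral>t. h t \<partial>Xi T\<bar> \<le> norm_L2 T f * norm_L2 T g" .
qed

lemma L2_blinfun_pairing:
  fixes g :: "real \<Rightarrow> 'v::real_normed_vector \<Rightarrow>\<^sub>L real"
  assumes g: "g \<in> L2 T" and v: "v \<in> L2 T"
  shows "integrable (Xi T) (\<lambda>t. g t (v t))" and "\<bar>\<integral>t. g t (v t) \<partial>Xi T\<bar> \<le> norm_L2 T g * norm_L2 T v"
proof -
  have "(\<lambda>t. g t (v t)) \<in> borel_measurable (Xi T)"
    by (rule Xi.strongly_measurable_imp_borel[OF
        strongly_measurable_compose2[OF L2_measurable[OF g] L2_measurable[OF v]]]) (intro tendsto_intros)
  note pairing = L2_dominated_pairing[OF g v this]
  have "\<bar>g t (v t)\<bar> \<le> norm (g t) * norm (v t)" for t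
    using norm_blinfun[of "g t" "v t"] by simp
  then show "integrable (Xi T) (\<lambda>t. g t (v t))"
    and "\<bar>\<integral>t. g t (v t) \<partial>Xi T\<bar> \<le> norm_L2 T g * norm_L2 T v"
    using pairing by blast+
qed

section \<open>Smooth step functions\<close>

definition smooth :: "(real \<Rightarrow> real) \<Rightarrow> bool" where
  "smooth f \<longleftrightarrow> (\<forall>n x. ((deriv ^^ n) f) differentiable (at x))"

text \<open>
  Exhibiting a class of functions closed under differentiation replaces the computation of
  iterated derivatives.
\<close>

lemma smooth_coinduct:
  assumes "f \<in> S" and "\<And>f. f \<in> S \<Longrightarrow> \<exists>g\<in>S. \<forall>x. (f has_real_derivative g x) (at x)"
  shows "smooth f"
proof -
  have step: "deriv f \<in> S \<and> (\<forall>x. f differentiable (at x))" if f: "f \<in> S" for f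
  proof -
    obtain g where g: "g \<in> S" "\<And>x. (f has_real_derivative g x) (at x)" using assms(2)[OF f] by blast
    then have "deriv f = g" by (auto intro!: DERIV_imp_deriv)
    then show ?thesis using g real_differentiable_def by blast
  qed
  have "(deriv ^^ n) f \<in> S" for n by (induction n) (use assms(1) step in auto)
  then show ?thesis unfolding smooth_def using step by blast
qed

lemma smooth_deriv: "smooth f \<Longrightarrow> smooth (deriv f)"
  unfolding smooth_def by (metis funpow_Suc_right comp_apply)

lemma smooth_has_derivative: "smooth f \<Longrightarrow> (f has_real_derivative deriv f x) (at x)"
  unfolding smooth_def by (metis DERIV_deriv_iff_real_differentiable funpow_0)

lemma smooth_antiderivative:
  assumes "\<And>x. (f has_real_derivative g x) (at x)" and "smooth g"
  shows "smooth f"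
proof (rule smooth_coinduct[of f "insert f (Collect smooth)"])
  fix h assume "h \<in> insert f (Collect smooth)"
  then consider "h = f" | "smooth h" by auto
  then show "\<exists>g\<in>insert f (Collect smooth). \<forall>x. (h has_real_derivative g x) (at x)"
  proof cases
    case 1
    then show ?thesis using assms by (intro bexI[of _ g]) auto
  next
    case 2
    then show ?thesis
      using smooth_deriv smooth_has_derivative by (intro bexI[of _ "deriv h"]) auto
  qed
qed simp

lemma smooth_diff:
  assumes "smooth f" "smooth g" shows "smooth (\<lambda>x. f x - g x)"
proof (rule smooth_coinduct[of _ "{\<lambda>x. f x - g x | f g. smooth f \<and> smooth g}"])
  fix h assume "h \<in> {\<lambda>x. f x - g x | f g. smooth f \<and> smooth g}"
  then obtain f g where fg: "smooth f" "smooth g" "h = (\<lambda>x. f x - g x)" by blast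
  then have "\<forall>x. (h has_real_derivative deriv f x - deriv g x) (at x)"
    by (auto intro!: DERIV_diff smooth_has_derivative)
  moreover have "(\<lambda>x. deriv f x - deriv g x) \<in> {\<lambda>x. f x - g x | f g. smooth f \<and> smooth g}"
    using fg smooth_deriv by blast
  ultimately show "\<exists>g\<in>{\<lambda>x. f x - g x | f g. smooth f \<and> smooth g}. \<forall>x. (h has_real_derivative g x) (at x)"
    by (intro bexI[of _ "\<lambda>x. deriv f x - deriv g x"])
qed (use assms in blast)

lemma smooth_affine:
  assumes "smooth f" shows "smooth (\<lambda>x. c * f (m * x + d))"
proof (rule smooth_coinduct[of _ "{\<lambda>x. c * f (m * x + d) | c f. smooth f}"])
  fix h assume "h \<in> {\<lambda>x. c * f (m * x + d) | c f. smooth f}"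
  then obtain c f where f: "smooth f" "h = (\<lambda>x. c * f (m * x + d))" by blast
  have "(h has_real_derivative (c * m) * deriv f (m * x + d)) (at x)" for x
  proof -
    have "((\<lambda>x. m * x + d) has_real_derivative m) (at x)" by (auto intro!: derivative_eq_intros)
    from DERIV_cmult[OF DERIV_chain2[OF smooth_has_derivative[OF f(1)] this], of c]
    show ?thesis by (simp add: f(2) mult_ac)
  qed
  moreover have "(\<lambda>x. (c * m) * deriv f (m * x + d)) \<in> {\<lambda>x. c * f (m * x + d) | c f. smooth f}"
    using f smooth_deriv by blast
  ultimately show "\<exists>g\<in>{\<lambda>x. c * f (m * x + d) | c f. smooth f}. \<forall>x. (h has_real_derivative g x) (at x)"
    by (intro bexI[of _ "\<lambda>x. (c * m) * deriv f (m * x + d)"] allI)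
qed (use assms in blast)

text \<open>
  Products of smooth functions are not closed under differentiation, but by the Leibniz rule sums
  of such products are.
\<close>

inductive_set product_sums :: "(real \<Rightarrow> real) set" where
  prod: "smooth f \<Longrightarrow> smooth g \<Longrightarrow> (\<lambda>x. f x * g x) \<in> product_sums"
| sum: "f \<in> product_sums \<Longrightarrow> g \<in> product_sums \<Longrightarrow> (\<lambda>x. f x + g x) \<in> product_sums"

lemma smooth_mult:
  assumes "smooth f" "smooth g" shows "smooth (\<lambda>x. f x * g x)"
proof (rule smooth_coinduct[of _ product_sums])
  fix h :: "real \<Rightarrow> real" assume "h \<in> product_sums"
  then show "\<exists>g\<in>product_sums. \<forall>x. (h has_real_derivative g x) (at x)"
  proof induction
    case (prod f g)
    have "((\<lambda>x. f x * g x) has_real_derivative deriv f x * g x + f x * deriv g x) (at x)" for x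
      using DERIV_mult[OF smooth_has_derivative[OF prod(1)] smooth_has_derivative[OF prod(2)]]
      by (simp add: mult.commute)
    moreover have "(\<lambda>x. deriv f x * g x + f x * deriv g x) \<in> product_sums"
      using prod smooth_deriv by (intro product_sums.intros)
    ultimately show ?case by (intro bexI[of _ "\<lambda>x. deriv f x * g x + f x * deriv g x"] allI)
  next
    case (sum f g)
    then obtain f' g' where "f' \<in> product_sums" "g' \<in> product_sums"
      "\<And>x. (f has_real_derivative f' x) (at x)" "\<And>x. (g has_real_derivative g' x) (at x)" by blast
    then show ?case
      by (intro bexI[of _ "\<lambda>x. f' x + g' x"]) (auto intro: DERIV_add product_sums.sum)
  qed
qed (use assms in \<open>rule product_sums.prod\<close>)

text \<open>
  With \<open>exp (- (1 / x))\<close> alone the derivatives leave the class; with polynomials in \<open>1 / x\<close> as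
  factors, differentiation becomes an operation on the polynomial.
\<close>

definition flat :: "real poly \<Rightarrow> real \<Rightarrow> real" where
  "flat p x = (if 0 < x then poly p (1 / x) * exp (- (1 / x)) else 0)"

lemma poly_over_exp: "((\<lambda>y. poly p y / exp y) \<longlongrightarrow> (0::real)) at_top"
proof -
  have "((\<lambda>y. \<Sum>i\<le>degree p. coeff p i * (y ^ i / exp y)) \<longlongrightarrow> (\<Sum>i\<le>degree p. coeff p i * 0)) at_top"
    by (intro tendsto_intros tendsto_power_div_exp_0)
  then show ?thesis by (simp add: poly_altdef sum_divide_distrib)
qed

lemma flat_derivative:
  "(flat p has_real_derivative flat (monom 1 2 * (p - pderiv p)) x) (at x)"
proof -
  consider "0 < x" | "x < 0" | "x = 0" by linarith
  then show ?thesis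
  proof cases
    case 1
    have "((\<lambda>x. poly p (1 / x)) has_real_derivative poly (pderiv p) (1 / x) * (- (1 / x\<^sup>2))) (at x)"
      using 1 by (intro DERIV_chain2[OF poly_DERIV]) (auto intro!: derivative_eq_intros simp: power2_eq_square)
    moreover have "((\<lambda>x. exp (- (1 / x))) has_real_derivative exp (- (1 / x)) * (1 / x\<^sup>2)) (at x)"
      using 1 by (auto intro!: derivative_eq_intros simp: power2_eq_square)
    ultimately have "((\<lambda>x. poly p (1 / x) * exp (- (1 / x))) has_real_derivative
       (poly (pderiv p) (1 / x) * (- (1 / x\<^sup>2)) * exp (- (1 / x)) + exp (- (1 / x)) * (1 / x\<^sup>2) * poly p (1 / x))) (at x)"
      by (rule DERIV_mult)
    moreover have "poly (pderiv p) (1 / x) * (- (1 / x\<^sup>2)) * exp (- (1 / x)) + exp (- (1 / x)) * (1 / x\<^sup>2) * poly p (1 / x)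
       = flat (monom 1 2 * (p - pderiv p)) x"
      using 1 by (simp add: flat_def poly_monom field_simps)
    ultimately have "((\<lambda>x. poly p (1 / x) * exp (- (1 / x))) has_real_derivative
        flat (monom 1 2 * (p - pderiv p)) x) (at x)" by metis
    then show ?thesis
      by (rule has_field_derivative_transform_within_open[of _ _ _ "{0<..}"]) (use 1 in \<open>auto simp: flat_def\<close>)
  next
    case 2
    have "((\<lambda>x. 0) has_real_derivative flat (monom 1 2 * (p - pderiv p)) x) (at x)"
      using 2 by (simp add: flat_def)
    then show ?thesis
      by (rule has_field_derivative_transform_within_open[of _ _ _ "{..<0}"]) (use 2 in \<open>auto simp: flat_def\<close>)
  next
    case 3
    \<comment> \<open>at 0 the difference quotient from the right is a polynomial in \<open>1 / h\<close> times \<open>exp (- 1 / h)\<close>\<close>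
    have "((\<lambda>h. flat p h / h) \<longlongrightarrow> 0) (at (0::real))"
    proof (rule filterlim_split_at)
      show "((\<lambda>h. flat p h / h) \<longlongrightarrow> 0) (at_left 0)"
        by (rule tendsto_eventually) (auto simp: flat_def eventually_at_left_field intro!: exI[of _ "-1"])
      have "((\<lambda>h. poly (pCons 0 p) (inverse h) / exp (inverse h)) \<longlongrightarrow> 0) (at_right (0::real))"
        by (rule filterlim_compose[OF poly_over_exp filterlim_inverse_at_top_right])
      moreover have "\<forall>\<^sub>F h in at_right 0. poly (pCons 0 p) (inverse h) / exp (inverse h) = flat p h / h"
        unfolding eventually_at_right_field
        by (intro exI[of _ 1]) (auto simp: flat_def exp_minus field_simps)
      ultimately show "((\<lambda>h. flat p h / h) \<longlongrightarrow> 0) (at_right 0)" by (rule Lim_transform_eventually)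
    qed
    then show ?thesis unfolding DERIV_def using 3 by (simp add: flat_def)
  qed
qed

lemma smooth_flat: "smooth (flat p)"
  by (rule smooth_coinduct[of _ "range flat"]) (use flat_derivative in blast)+

lemma continuous_has_antiderivative:
  fixes f :: "real \<Rightarrow> real"
  assumes "continuous_on UNIV f"
  obtains F where "\<And>x. (F has_real_derivative f x) (at x)"
proof -
  have "((\<lambda>u. LBINT y=(0::real)..u. f y) has_real_derivative f x) (at x)" for x
  proof -
    define c where "c = \<bar>x\<bar> + 1"
    have "((\<lambda>u. LBINT y=(0::real)..u. f y) has_vector_derivative f x) (at x within {- c..c})"
      by (rule interval_integral_FTC2)
        (use assms in \<open>auto simp: c_def intro: continuous_on_subset\<close>)
    moreover have "at x within {- c..c} = at x"
      by (rule at_within_interior) (auto simp: c_def)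
    ultimately show ?thesis
      unfolding has_real_derivative_iff_has_vector_derivative by (simp only:)
  qed
  then show ?thesis by (rule that)
qed

text \<open>
  The normalized antiderivative of the bump \<open>exp (- 1 / x) * exp (- 1 / (1 - x))\<close> on the unit interval.
\<close>

lemma smooth_step_exists:
  obtains s k :: "real \<Rightarrow> real" where "smooth s" and "\<And>x. (s has_real_derivative k x) (at x)"
    and "continuous_on UNIV k" and "\<And>x. 0 \<le> k x" and "\<And>x. x \<le> 0 \<Longrightarrow> s x = 0" and "\<And>x. 1 \<le> x \<Longrightarrow> s x = 1"
    and "\<And>x. x \<notin> {0<..<1} \<Longrightarrow> k x = 0"
proof -
  define \<rho> where "\<rho> x = flat 1 x * flat 1 (1 - x)" for x
  have \<rho>_smooth: "smooth \<rho>"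
    unfolding \<rho>_def using smooth_mult[OF smooth_flat smooth_affine[OF smooth_flat, of 1 1 "- 1" 1]] by simp
  have \<rho>_nonneg: "0 \<le> \<rho> x" and \<rho>_pos: "x \<in> {0<..<1} \<Longrightarrow> 0 < \<rho> x" and \<rho>_zero: "x \<notin> {0<..<1} \<Longrightarrow> \<rho> x = 0" for x
    by (auto simp: \<rho>_def flat_def)
  have \<rho>_cont: "continuous_on UNIV \<rho>"
    using DERIV_isCont[OF smooth_has_derivative[OF \<rho>_smooth]] continuous_at_imp_continuous_on by blast
  obtain P where P: "\<And>x. (P has_real_derivative \<rho> x) (at x)"
    using continuous_has_antiderivative[OF \<rho>_cont] by blast
  have flat_outside: "P x = P y" if less: "x < y" and outside: "y \<le> 0 \<or> 1 \<le> x" for x y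
  proof -
    obtain z where "x < z" "z < y" "P y - P x = (y - x) * \<rho> z"
      using MVT2[OF less, of P \<rho>] P by auto
    then show ?thesis using \<rho>_zero[of z] outside by auto
  qed
  define I where "I = P 1 - P 0"
  obtain z where "0 < z" "z < 1" "P 1 - P 0 = (1 - 0) * \<rho> z"
    using MVT2[of 0 1 P \<rho>] P by auto
  then have I: "0 < I" using \<rho>_pos[of z] by (simp add: I_def)
  define s where "s x = (P x - P 0) / I" for x
  have deriv_s: "(s has_real_derivative \<rho> x / I) (at x)" for x
    unfolding s_def using P[of x] I by (auto intro!: derivative_eq_intros)
  have "smooth (\<lambda>x. \<rho> x / I)" using smooth_affine[OF \<rho>_smooth, of "1 / I" 1 0] by simp
  then have "smooth s" using smooth_antiderivative[OF deriv_s] by blast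
  moreover have "s x = 0" if "x \<le> 0" for x
    using flat_outside[of x 0] that by (cases "x = 0") (auto simp: s_def)
  moreover have "s x = 1" if "1 \<le> x" for x
    using flat_outside[of 1 x] that I by (cases "x = 1") (auto simp: s_def I_def)
  ultimately show ?thesis
    using deriv_s \<rho>_nonneg \<rho>_zero I continuous_on_divide[OF \<rho>_cont continuous_on_const[of UNIV I]]
    by (intro that[of s "\<lambda>x. \<rho> x / I"]) (auto simp: less_imp_neq[symmetric])
qed

section \<open>Weak derivatives of real functions\<close>

lemma continuous_integrable_Xi:
  fixes h :: "real \<Rightarrow> real"
  assumes "continuous_on {0..T} h"
  shows "integrable (Xi T) h"
proof -
  obtain B where B: "\<forall>y\<in>h ` {0..T}. norm y \<le> B"
    using compact_imp_bounded[OF compact_continuous_image[OF assms compact_Icc]]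
    unfolding bounded_iff by blast
  show ?thesis
  proof (rule Xi.integrable_const_bound)
    show "AE t in Xi T. norm (h t) \<le> B"
      using B by (intro AE_I2) auto
    show "h \<in> borel_measurable (Xi T)"
      by (rule continuous_imp_measurable_on_sets_lebesgue)
        (auto intro: continuous_on_subset[OF assms])
  qed
qed

lemma integral_Xi_derivative:
  assumes "\<And>t. (F has_real_derivative h t) (at t)" and "continuous_on UNIV h" and "0 < T"
  shows "(\<integral>t. h t \<partial>Xi T) = F T - F 0"
proof -
  have "integrable (Xi T) h"
    using assms(2) by (intro continuous_integrable_Xi) (auto intro: continuous_on_subset)
  then have "(\<integral>t. h t \<partial>Xi T) = integral {0<..<T} h"
    by (intro lebesgue_integral_eq_integral) auto
  also have "\<dots> = integral {0..T} h" by (rule integral_open_interval_real[symmetric])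
  also have "\<dots> = F T - F 0"
    using assms(1,3)
    by (intro integral_unique fundamental_theorem_of_calculus)
      (auto simp: has_real_derivative_iff_has_vector_derivative[symmetric] intro: DERIV_subset)
  finally show ?thesis .
qed

text \<open>
  The \<open>\<kappa> n\<close> are the derivatives of the step function rescaled to the interval from \<open>c\<close> to
  \<open>c + 1 / (n + 1)\<close>. They are nonnegative with integral 1 and concentrate at \<open>c\<close>.
\<close>

lemma approximate_identity_limit:
  assumes "0 < T" and deriv: "\<And>x. (s has_real_derivative k x) (at x)"
    and k_cont: "continuous_on UNIV k" and k_nonneg: "\<And>x. 0 \<le> k x"
    and s0: "\<And>x. x \<le> 0 \<Longrightarrow> s x = 0" and s1: "\<And>x. 1 \<le> x \<Longrightarrow> s x = 1"
    and k0: "\<And>x. x \<notin> {0<..<1} \<Longrightarrow> k x = 0"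
    and G: "continuous_on {0..T} G" and c: "0 < c" "c < T"
  defines "\<kappa> \<equiv> \<lambda>n t. real (Suc n) * k (real (Suc n) * t + - (real (Suc n) * c))"
  shows "integrable (Xi T) (\<lambda>t. \<kappa> n t * G t)" and "(\<lambda>n. \<integral>t. \<kappa> n t * G t \<partial>Xi T) \<longlonglongrightarrow> G c"
proof -
  have \<kappa>_cont: "continuous_on A (\<kappa> n)" for n A
    unfolding \<kappa>_def by (intro continuous_intros continuous_on_compose2[OF k_cont]) auto
  then show int: "integrable (Xi T) (\<lambda>t. \<kappa> n t * G t)" for n
    using G by (intro continuous_integrable_Xi continuous_on_mult)
  have \<kappa>_int: "integrable (Xi T) (\<kappa> n)" for n
    using \<kappa>_cont by (rule continuous_integrable_Xi)
  have \<kappa>_nonneg: "0 \<le> \<kappa> n t" for n t using k_nonneg by (simp add: \<kappa>_def)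
  have \<kappa>_zero: "\<kappa> n t = 0" if "t \<notin> {c<..<c + 1 / real (Suc n)}" for n t
  proof -
    have "real (Suc n) * t + - (real (Suc n) * c) \<notin> {0<..<1}"
    proof
      assume "real (Suc n) * t + - (real (Suc n) * c) \<in> {0<..<1}"
      then have "0 < real (Suc n) * (t - c)" "real (Suc n) * (t - c) < 1"
        by (auto simp: algebra_simps)
      then have "t - c < 1 / real (Suc n)" by (simp add: less_divide_eq mult.commute)
      moreover have "0 < t - c" using \<open>0 < real (Suc n) * (t - c)\<close> zero_less_mult_pos by fastforce
      ultimately show False using that by simp
    qed
    then show ?thesis using k0 by (simp add: \<kappa>_def)
  qed
  have mass: "(\<integral>t. \<kappa> n t \<partial>Xi T) = 1" if n: "c + 1 / real (Suc n) \<le> T" for n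
  proof -
    have "((\<lambda>t. s (real (Suc n) * t + - (real (Suc n) * c))) has_real_derivative \<kappa> n t) (at t)" for t
    proof -
      have "((\<lambda>t. real (Suc n) * t + - (real (Suc n) * c)) has_real_derivative real (Suc n)) (at t)"
        by (auto intro!: derivative_eq_intros)
      from DERIV_chain2[OF deriv this] show ?thesis by (simp add: \<kappa>_def mult.commute)
    qed
    from integral_Xi_derivative[OF this \<kappa>_cont \<open>0 < T\<close>]
    have "(\<integral>t. \<kappa> n t \<partial>Xi T) = s (real (Suc n) * (T - c)) - s (- (real (Suc n) * c))"
      by (simp add: algebra_simps)
    moreover have "1 \<le> real (Suc n) * (T - c)"
    proof -
      have "1 / real (Suc n) \<le> T - c" using n by simp
      then show ?thesis by (simp add: divide_le_eq mult.commute)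
    qed
    moreover have "- (real (Suc n) * c) \<le> 0" using c by simp
    ultimately show ?thesis using s0 s1 by simp
  qed
  show "(\<lambda>n. \<integral>t. \<kappa> n t * G t \<partial>Xi T) \<longlonglongrightarrow> G c"
  proof (rule LIMSEQ_I)
    fix e :: real assume "0 < e"
    have "c \<in> {0..T}" using c by simp
    then obtain d where d: "0 < d" "\<And>t. t \<in> {0..T} \<Longrightarrow> dist t c < d \<Longrightarrow> dist (G t) (G c) < e / 2"
      using G \<open>0 < e\<close> unfolding continuous_on_iff by (metis half_gt_zero)
    obtain n0 where n0: "1 / real (Suc n0) < min d (T - c)"
      using reals_Archimedean[of "min d (T - c)"] d(1) c by (auto simp: inverse_eq_divide)
    have "norm ((\<integral>t. \<kappa> n t * G t \<partial>Xi T) - G c) < e" if "n0 \<le> n" for n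
    proof -
      have "1 / real (Suc n) \<le> 1 / real (Suc n0)" using that by (intro divide_left_mono) auto
      then have n: "1 / real (Suc n) < d" "1 / real (Suc n) < T - c" using n0 by auto
      then have mass_n: "(\<integral>t. \<kappa> n t \<partial>Xi T) = 1" by (intro mass) simp
      have near: "norm (\<kappa> n t * G t - \<kappa> n t * G c) \<le> \<kappa> n t * (e / 2)" for t
      proof (cases "t \<in> {c<..<c + 1 / real (Suc n)}")
        case True
        then have "dist (G t) (G c) < e / 2" using n c by (intro d(2)) (auto simp: dist_real_def)
        then have "\<bar>G t - G c\<bar> \<le> e / 2" by (simp add: dist_real_def)
        then have "\<kappa> n t * \<bar>G t - G c\<bar> \<le> \<kappa> n t * (e / 2)" by (intro mult_left_mono \<kappa>_nonneg)
        moreover have "norm (\<kappa> n t * G t - \<kappa> n t * G c) = \<kappa> n t * \<bar>G t - G c\<bar>"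
          using \<kappa>_nonneg[of n t] by (simp add: abs_mult flip: right_diff_distrib)
        ultimately show ?thesis by linarith
      qed (simp add: \<kappa>_zero)
      have "(\<integral>t. \<kappa> n t * G t \<partial>Xi T) - G c = (\<integral>t. \<kappa> n t * G t - \<kappa> n t * G c \<partial>Xi T)"
        using int \<kappa>_int by (simp add: mass_n)
      also have "norm \<dots> \<le> (\<integral>t. \<kappa> n t * (e / 2) \<partial>Xi T)"
        using near int \<kappa>_int by (intro Bochner_Integration.integral_norm_bound_integral) auto
      also have "\<dots> = e / 2" using mass_n by simp
      finally show ?thesis using \<open>0 < e\<close> by simp
    qed
    then show "\<exists>n0. \<forall>n\<ge>n0. norm ((\<integral>t. \<kappa> n t * G t \<partial>Xi T) - G c) < e" by blast
  qed
qed

text \<open>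
  Testing with smooth approximations of the indicator of \<open>{a<..b}\<close>, whose derivatives approximate
  the difference of the point masses at \<open>a\<close> and \<open>b\<close>, turns the weak derivative into the fundamental
  theorem of calculus. With \<open>G = 0\<close> the same statement yields the fundamental lemma of the
  calculus of variations.
\<close>

lemma weak_derivative_increment:
  assumes "0 < T" and G: "continuous_on {0..T} G" and g: "integrable (Xi T) g"
    and weak: "\<And>\<phi>. test_function T \<phi> \<Longrightarrow> (\<integral>t. deriv \<phi> t * G t \<partial>Xi T) = - (\<integral>t. \<phi> t * g t \<partial>Xi T)"
    and ab: "0 < a" "a < b" "b < T"
  shows "G b - G a = (\<integral>t. indicator {a<..b} t * g t \<partial>Xi T)"
proof -
  obtain s k where s: "smooth s" and deriv_s: "\<And>x. (s has_real_derivative k x) (at x)"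
    and k: "continuous_on UNIV k" "\<And>x. 0 \<le> k x"
    and s0: "\<And>x. x \<le> 0 \<Longrightarrow> s x = 0" and s1: "\<And>x. 1 \<le> x \<Longrightarrow> s x = 1"
    and k0: "\<And>x. x \<notin> {0<..<1} \<Longrightarrow> k x = 0"
    using smooth_step_exists by metis
  have s_mono: "s x \<le> s y" if "x \<le> y" for x y
    using DERIV_nonneg_imp_nondecreasing[OF that] deriv_s k(2) by blast
  have s_range: "0 \<le> s x" "s x \<le> 1" for x
    using s_mono[of "min x 0" x] s_mono[of x "max x 1"] s0[of "min x 0"] s1[of "max x 1"] by auto
  define \<kappa> where "\<kappa> c n t = real (Suc n) * k (real (Suc n) * t + - (real (Suc n) * c))" for c n t
  define \<sigma> where "\<sigma> c n t = s (real (Suc n) * t + - (real (Suc n) * c))" for c n t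
  have \<sigma>_deriv: "(\<sigma> c n has_real_derivative \<kappa> c n t) (at t)" for c n t
  proof -
    have "((\<lambda>t. real (Suc n) * t + - (real (Suc n) * c)) has_real_derivative real (Suc n)) (at t)"
      by (auto intro!: derivative_eq_intros)
    from DERIV_chain2[OF deriv_s this] show ?thesis by (simp add: \<kappa>_def \<sigma>_def[abs_def] mult.commute)
  qed
  define \<phi> where "\<phi> n t = \<sigma> a n t - \<sigma> b n t" for n t
  have \<phi>_deriv: "(\<phi> n has_real_derivative \<kappa> a n t - \<kappa> b n t) (at t)" for n t
    unfolding \<phi>_def[abs_def] by (intro DERIV_diff \<sigma>_deriv)
  have \<phi>_smooth: "smooth (\<phi> n)" for n
  proof -
    have "smooth (\<sigma> c n)" for c
      unfolding \<sigma>_def[abs_def]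
      using smooth_affine[OF s, of 1 "real (Suc n)" "- (real (Suc n) * c)"] by (simp only: mult_1)
    then show ?thesis unfolding \<phi>_def[abs_def] by (intro smooth_diff)
  qed
  have \<sigma>_low: "\<sigma> c n t = 0" if "t \<le> c" for c n t
    unfolding \<sigma>_def using that mult_left_mono[OF that, of "real (Suc n)"] by (intro s0) simp
  have \<sigma>_high: "\<sigma> c n t = 1" if "c + 1 / real (Suc n) \<le> t" for c n t
  proof -
    have "1 / real (Suc n) \<le> t - c" using that by simp
    then have "1 \<le> real (Suc n) * (t - c)" by (simp add: divide_le_eq mult.commute)
    then show ?thesis unfolding \<sigma>_def by (intro s1) (simp add: algebra_simps)
  qed
  \<comment> \<open>the support is compact in the open interval only once \<open>n\<close> is large\<close>
  have test: "test_function T (\<phi> n)" if n: "b + 1 / real (Suc n) < T" for n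
    unfolding test_function_def
  proof (intro conjI exI)
    show "\<forall>m x. (deriv ^^ m) (\<phi> n) differentiable (at x)" using \<phi>_smooth by (simp add: smooth_def)
    show "0 < a" "b + 1 / real (Suc n) < T" by fact+
    have "\<phi> n t = 0" if "t \<notin> {a..b + 1 / real (Suc n)}" for t
    proof (cases "t < a")
      case True
      then show ?thesis using ab \<sigma>_low by (simp add: \<phi>_def)
    next
      case False
      then have "b + 1 / real (Suc n) \<le> t" using that by simp
      moreover from this have "a + 1 / real (Suc n) \<le> t" using ab by simp
      ultimately show ?thesis using \<sigma>_high by (simp add: \<phi>_def)
    qed
    then show "\<forall>t. t \<notin> {a..b + 1 / real (Suc n)} \<longrightarrow> \<phi> n t = 0" by blast
  qed
  have eventually_step: "eventually (\<lambda>n. c + 1 / real (Suc n) < t) sequentially" if "c < t" for c t :: real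
  proof -
    have "(\<lambda>n. c + 1 / real (Suc n)) \<longlonglongrightarrow> c + 0"
      using LIMSEQ_inverse_real_of_nat by (intro tendsto_intros) (simp add: inverse_eq_divide)
    then show ?thesis using that by (intro order_tendstoD) auto
  qed
  have \<sigma>_lim: "(\<lambda>n. \<sigma> c n t) \<longlonglongrightarrow> (if c < t then 1 else 0)" for c t
  proof (cases "c < t")
    case True
    have "eventually (\<lambda>n. \<sigma> c n t = 1) sequentially"
      using eventually_step[OF True] by eventually_elim (simp add: \<sigma>_high)
    then show ?thesis using True by (simp add: tendsto_eventually)
  qed (simp add: \<sigma>_low)
  have \<phi>_lim: "(\<lambda>n. \<phi> n t) \<longlonglongrightarrow> indicator {a<..b} t" for t
    using tendsto_diff[OF \<sigma>_lim[of a t] \<sigma>_lim[of b t]] ab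
    unfolding \<phi>_def by (auto simp: indicator_def split: if_splits)
  have \<phi>_cont: "continuous_on A (\<phi> n)" for A n
    using DERIV_isCont[OF \<phi>_deriv] continuous_at_imp_continuous_on by blast
  have \<phi>_meas: "\<phi> n \<in> borel_measurable (Xi T)" for n
    using \<phi>_cont by (intro borel_measurable_integrable continuous_integrable_Xi)
  have [measurable]: "g \<in> borel_measurable (Xi T)" using g by (rule borel_measurable_integrable)
  note [measurable] = \<phi>_meas
  have rhs: "(\<lambda>n. \<integral>t. \<phi> n t * g t \<partial>Xi T) \<longlonglongrightarrow> (\<integral>t. indicator {a<..b} t * g t \<partial>Xi T)"
  proof (rule integral_dominated_convergence)
    show "integrable (Xi T) (\<lambda>t. norm (g t))" using g by (rule integrable_norm)
    show "AE t in Xi T. (\<lambda>n. \<phi> n t * g t) \<longlonglongrightarrow> indicator {a<..b} t * g t"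
      by (intro AE_I2 tendsto_mult \<phi>_lim tendsto_const)
    have "\<bar>\<phi> n t\<bar> \<le> 1" for n t
      using s_range unfolding \<phi>_def \<sigma>_def by (smt (verit))
    then show "AE t in Xi T. norm (\<phi> n t * g t) \<le> norm (g t)" for n
      by (intro AE_I2) (simp add: abs_mult mult_left_le_one_le)
    show "(\<lambda>t. \<phi> n t * g t) \<in> borel_measurable (Xi T)" for n by measurable
    have "{a<..b} \<inter> space (Xi T) \<in> sets (Xi T)"
      using ab by (auto simp: sets_restrict_space_iff)
    then have [measurable]: "(indicator {a<..b} :: real \<Rightarrow> real) \<in> borel_measurable (Xi T)"
      by (simp add: borel_measurable_indicator_iff)
    show "(\<lambda>t. indicator {a<..b} t * g t) \<in> borel_measurable (Xi T)" by measurable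
  qed
  have lhs: "(\<lambda>n. \<integral>t. deriv (\<phi> n) t * G t \<partial>Xi T) \<longlonglongrightarrow> G a - G b"
  proof -
    have a: "a < T" and b: "0 < b" using ab by auto
    note kernel_a = approximate_identity_limit[OF \<open>0 < T\<close> deriv_s k s0 s1 k0 G \<open>0 < a\<close> a, folded \<kappa>_def]
    note kernel_b = approximate_identity_limit[OF \<open>0 < T\<close> deriv_s k s0 s1 k0 G b \<open>b < T\<close>, folded \<kappa>_def]
    have "(\<integral>t. deriv (\<phi> n) t * G t \<partial>Xi T) = (\<integral>t. \<kappa> a n t * G t \<partial>Xi T) - (\<integral>t. \<kappa> b n t * G t \<partial>Xi T)" for n
      using kernel_a(1) kernel_b(1) by (simp add: DERIV_imp_deriv[OF \<phi>_deriv] left_diff_distrib)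
    then show ?thesis using tendsto_diff[OF kernel_a(2) kernel_b(2)] by simp
  qed
  have "(\<lambda>n. \<integral>t. deriv (\<phi> n) t * G t \<partial>Xi T) \<longlonglongrightarrow> - (\<integral>t. indicator {a<..b} t * g t \<partial>Xi T)"
  proof (rule Lim_transform_eventually)
    show "(\<lambda>n. - (\<integral>t. \<phi> n t * g t \<partial>Xi T)) \<longlonglongrightarrow> - (\<integral>t. indicator {a<..b} t * g t \<partial>Xi T)"
      by (intro tendsto_minus rhs)
    show "eventually (\<lambda>n. - (\<integral>t. \<phi> n t * g t \<partial>Xi T) = (\<integral>t. deriv (\<phi> n) t * G t \<partial>Xi T)) sequentially"
      using eventually_step[OF \<open>b < T\<close>] by eventually_elim (simp add: weak test)
  qed
  from LIMSEQ_unique[OF lhs this] show ?thesis by simp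
qed

text \<open>
  The sets over which the integral of \<open>g\<close> vanishes include the half-lines, which generate the Borel
  sets and are stable under intersection, so they include all Borel sets by Dynkin's lemma and all
  Lebesgue sets because these differ from Borel sets by null sets.
\<close>

lemma interval_integrals_zero_imp_AE_zero:
  fixes g :: "real \<Rightarrow> real"
  assumes g: "integrable (Xi T) g"
    and zero: "\<And>a b. 0 < a \<Longrightarrow> a < b \<Longrightarrow> b < T \<Longrightarrow> (\<integral>t. indicator {a<..b} t * g t \<partial>Xi T) = 0"
  shows "AE t in Xi T. g t = 0"
proof (rule Xi.density_zero[OF g])
  have [measurable]: "g \<in> borel_measurable (Xi T)" using g by (rule borel_measurable_integrable)
  have sets_Xi: "A \<inter> {0<..<T} \<in> sets (Xi T)" if "A \<in> sets borel" for A
  proof -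
    have "A \<in> sets lebesgue" using that by simp
    then show ?thesis by (simp add: sets_restrict_space_iff sets.Int)
  qed
  have ind_meas: "(indicator A :: real \<Rightarrow> real) \<in> borel_measurable (Xi T)" if "A \<in> sets borel" for A
    using sets_Xi[OF that] by (simp add: borel_measurable_indicator_iff)
  have ind_int: "integrable (Xi T) (\<lambda>t. indicator A t * g t)" if "A \<in> sets borel" for A
  proof (rule Bochner_Integration.integrable_bound[OF g])
    show "(\<lambda>t. indicator A t * g t) \<in> borel_measurable (Xi T)"
      using ind_meas[OF that] by measurable
  qed (auto simp: indicator_def)
  have atMost: "(\<integral>t. indicator {..c} t * g t \<partial>Xi T) = 0" for c
  proof (rule LIMSEQ_unique)
    \<comment> \<open>the half-line meets the open interval in a limit of intervals away from the end points\<close>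
    define I where "I n = {1 / real (Suc n)<..min c (T - 1 / real (Suc n))}" for n
    show "(\<lambda>n. \<integral>t. indicator (I n) t * g t \<partial>Xi T) \<longlonglongrightarrow> (\<integral>t. indicator {..c} t * g t \<partial>Xi T)"
    proof (rule integral_dominated_convergence)
      show "integrable (Xi T) (\<lambda>t. norm (g t))" using g by (rule integrable_norm)
      show "AE t in Xi T. norm (indicator (I n) t * g t) \<le> norm (g t)" for n
        by (auto simp: indicator_def)
      show "(\<lambda>t. indicator (I n) t * g t) \<in> borel_measurable (Xi T)" for n
        by (intro borel_measurable_integrable ind_int) (simp add: I_def)
      show "(\<lambda>t. indicator {..c} t * g t) \<in> borel_measurable (Xi T)"
        by (intro borel_measurable_integrable ind_int) simp
      show "AE t in Xi T. (\<lambda>n. indicator (I n) t * g t) \<longlonglongrightarrow> indicator {..c} t * g t"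
      proof (rule AE_I2)
        fix t assume "t \<in> space (Xi T)"
        then have "0 < t" "t < T" by auto
        have "(\<lambda>n. 1 / real (Suc n)) \<longlonglongrightarrow> 0"
          using LIMSEQ_inverse_real_of_nat by (simp add: inverse_eq_divide)
        then have "eventually (\<lambda>n. 1 / real (Suc n) < min t (T - t)) sequentially"
          using \<open>0 < t\<close> \<open>t < T\<close> by (intro order_tendstoD(2)) auto
        then have "eventually (\<lambda>n. indicator (I n) t * g t = indicator {..c} t * g t) sequentially"
          by eventually_elim (auto simp: I_def indicator_def)
        then show "(\<lambda>n. indicator (I n) t * g t) \<longlonglongrightarrow> indicator {..c} t * g t"
          by (rule tendsto_eventually)
      qed
    qed
    have "(\<integral>t. indicator (I n) t * g t \<partial>Xi T) = 0" for n
    proof (cases "1 / real (Suc n) < min c (T - 1 / real (Suc n))")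
      case True
      have "0 < 1 / real (Suc n)" by simp
      then have "min c (T - 1 / real (Suc n)) < T" by linarith
      then show ?thesis unfolding I_def using True by (intro zero) auto
    next
      case False
      then have "I n = {}" unfolding I_def by (intro greaterThanAtMost_empty) linarith
      then show ?thesis by simp
    qed
    then show "(\<lambda>n. \<integral>t. indicator (I n) t * g t \<partial>Xi T) \<longlonglongrightarrow> 0" by simp
  qed
  have total: "(\<integral>t. g t \<partial>Xi T) = 0"
  proof -
    have "(\<integral>t. g t \<partial>Xi T) = (\<integral>t. indicator {..T} t * g t \<partial>Xi T)"
      by (intro Bochner_Integration.integral_cong) auto
    then show ?thesis using atMost by simp
  qed
  have borel: "(\<integral>t. indicator A t * g t \<partial>Xi T) = 0" if "A \<in> sets borel" for A
  proof -
    have "Int_stable (range (\<lambda>a::real. {..a}))"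
      by (auto simp: Int_stable_def)
    moreover have "range (\<lambda>a::real. {..a}) \<subseteq> Pow UNIV" by simp
    moreover have "A \<in> sigma_sets UNIV (range (\<lambda>a::real. {..a}))"
      using that by (simp add: borel_eq_atMost)
    ultimately show ?thesis
    proof (induction rule: sigma_sets_induct_disjoint)
      case (basic A)
      then show ?case using atMost by auto
    next
      case (compl A)
      then have A: "A \<in> sets borel" by (simp add: borel_eq_atMost)
      have "(\<integral>t. indicator (UNIV - A) t * g t \<partial>Xi T) = (\<integral>t. g t - indicator A t * g t \<partial>Xi T)"
        by (intro Bochner_Integration.integral_cong) (auto simp: indicator_def)
      then show ?case using compl total g ind_int[OF A] by simp
    next
      case (union A)
      then have A: "A i \<in> sets borel" for i by (auto simp: borel_eq_atMost)
      have eq: "(LINT t:(S \<inter> {0<..<T})|Xi T. g t) = (\<integral>t. indicator S t * g t \<partial>Xi T)" for S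
        unfolding set_lebesgue_integral_def
        by (intro Bochner_Integration.integral_cong) (auto simp: indicator_def)
      have "(LINT t:(\<Union>i. A i \<inter> {0<..<T})|Xi T. g t) = (\<Sum>i. LINT t:(A i \<inter> {0<..<T})|Xi T. g t)"
      proof (rule lebesgue_integral_countable_add)
        show "A i \<inter> {0<..<T} \<in> sets (Xi T)" for i using A sets_Xi by blast
        show "A i \<inter> {0<..<T} \<inter> (A j \<inter> {0<..<T}) = {}" if "i \<noteq> j" for i j
          using union(1) that by (auto simp: disjoint_family_on_def)
        have "(\<Union>i. A i \<inter> {0<..<T}) \<in> sets (Xi T)" using A sets_Xi by blast
        then show "set_integrable (Xi T) (\<Union>i. A i \<inter> {0<..<T}) g"
          unfolding set_integrable_def using g by (rule integrable_mult_indicator)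
      qed
      moreover have "(\<Union>i. A i \<inter> {0<..<T}) = (\<Union>i. A i) \<inter> {0<..<T}" by blast
      ultimately show ?case using union(3) by (simp add: eq)
    qed (auto simp: total)
  qed
  fix A assume "A \<in> sets (Xi T)"
  then have "A \<in> sets lebesgue" by (auto simp: sets_restrict_space_iff)
  then obtain S Z Z' where A: "A = S \<union> Z" "Z \<subseteq> Z'" "Z' \<in> null_sets lborel" "S \<in> sets lborel"
    by (rule sets_completionE)
  have "AE t in lebesgue. t \<notin> Z'" using A(3) by (intro AE_not_in null_sets_completionI)
  then have "AE t in Xi T. t \<notin> Z'" by (auto simp: AE_restrict_space_iff elim: eventually_mono)
  then have "AE t in Xi T. indicator A t *\<^sub>R g t = indicator S t * g t"
    by eventually_elim (use A(1,2) in \<open>auto simp: indicator_def\<close>)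
  then have "(LINT t:A|Xi T. g t) = (\<integral>t. indicator S t * g t \<partial>Xi T)"
    unfolding set_lebesgue_integral_def using \<open>A \<in> sets (Xi T)\<close> ind_int[of S] A(4)
    by (intro integral_cong_AE borel_measurable_integrable integrable_mult_indicator[OF _ g]) auto
  then show "(LINT t:A|Xi T. g t) = 0" using borel A(4) by simp
qed

section \<open>The time derivative and the trace\<close>

lemma L2_const: "(\<lambda>t. c) \<in> L2 T"
  by (simp add: L2_def strongly_measurable_const)

lemma L2_continuous:
  fixes \<psi> :: "real \<Rightarrow> real"
  assumes "continuous_on {0..T} \<psi>" shows "\<psi> \<in> L2 T"
proof -
  have "integrable (Xi T) (\<lambda>t. (norm (\<psi> t))\<^sup>2)"
    by (intro continuous_integrable_Xi continuous_intros assms)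
  moreover have "strongly_measurable (Xi T) \<psi>"
    by (intro strongly_measurable_borel borel_measurable_integrable continuous_integrable_Xi assms)
  ultimately show ?thesis by (simp add: L2_def)
qed

lemma test_function_continuous:
  assumes "test_function T \<phi>" shows "continuous_on A \<phi>" and "continuous_on A (deriv \<phi>)"
proof -
  have diff: "((deriv ^^ n) \<phi>) differentiable (at x)" for n x
    using assms unfolding test_function_def by blast
  show "continuous_on A \<phi>"
    using diff[of 0] by (auto intro!: continuous_at_imp_continuous_on differentiable_imp_continuous_within)
  show "continuous_on A (deriv \<phi>)"
    using diff[of 1] by (auto intro!: continuous_at_imp_continuous_on differentiable_imp_continuous_within)
qed

text \<open>
  Both integrals in the definition of the weak derivative are bounded by the \<open>L\<^sub>2\<close> norm, for a fixed
  test function and a fixed vector: this makes the definition linear and stable under limits.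
\<close>

lemma weighted_pairing:
  fixes \<beta> :: "'b::real_normed_vector \<Rightarrow> real"
  assumes \<psi>: "continuous_on {0..T} \<psi>" and w: "w \<in> L2 T"
    and \<beta>: "bounded_linear \<beta>" "\<And>y. \<bar>\<beta> y\<bar> \<le> norm y * K"
  shows "integrable (Xi T) (\<lambda>t. \<psi> t * \<beta> (w t))"
    and "\<bar>\<integral>t. \<psi> t * \<beta> (w t) \<partial>Xi T\<bar> \<le> norm_L2 T w * norm_L2 T (\<lambda>t. \<psi> t * K)"
proof -
  have p: "(\<lambda>t. \<psi> t * K) \<in> L2 T" by (intro L2_continuous continuous_intros \<psi>)
  have "(\<lambda>t. \<beta> (w t)) \<in> borel_measurable (Xi T)"
    by (rule Xi.strongly_measurable_imp_borel[OF strongly_measurable_compose[OF L2_measurable[OF w]]])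
      (rule bounded_linear.tendsto[OF \<beta>(1)])
  moreover have "\<psi> \<in> borel_measurable (Xi T)"
    by (intro borel_measurable_integrable continuous_integrable_Xi \<psi>)
  ultimately have meas: "(\<lambda>t. \<psi> t * \<beta> (w t)) \<in> borel_measurable (Xi T)" by measurable
  have bound: "\<bar>\<psi> t * \<beta> (w t)\<bar> \<le> norm (w t) * norm (\<psi> t * K)" for t
  proof -
    have "\<bar>\<psi> t\<bar> * \<bar>\<beta> (w t)\<bar> \<le> \<bar>\<psi> t\<bar> * (norm (w t) * \<bar>K\<bar>)"
      using order_trans[OF \<beta>(2) mult_left_mono[OF abs_ge_self norm_ge_zero]] by (intro mult_left_mono) auto
    then show ?thesis by (simp add: abs_mult mult_ac)
  qed
  show "integrable (Xi T) (\<lambda>t. \<psi> t * \<beta> (w t))"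
    by (rule L2_dominated_pairing(1)[OF w p meas bound])
  show "\<bar>\<integral>t. \<psi> t * \<beta> (w t) \<partial>Xi T\<bar> \<le> norm_L2 T w * norm_L2 T (\<lambda>t. \<psi> t * K)"
    by (rule L2_dominated_pairing(2)[OF w p meas bound])
qed

lemma inner_embedding_functional:
  fixes j :: "'v::real_normed_vector \<Rightarrow>\<^sub>L 'h::real_inner"
  shows "bounded_linear (\<lambda>y. j y \<bullet> x)" and "\<bar>j y \<bullet> x\<bar> \<le> norm y * (norm j * norm x)"
proof -
  show "bounded_linear (\<lambda>y. j y \<bullet> x)"
    by (rule bounded_linear_compose[OF bounded_linear_inner_left blinfun.bounded_linear_right])
  have "\<bar>j y \<bullet> x\<bar> \<le> norm (j y) * norm x" by (rule Cauchy_Schwarz_ineq2)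
  also have "\<dots> \<le> (norm j * norm y) * norm x" by (intro mult_right_mono norm_blinfun) simp
  finally show "\<bar>j y \<bullet> x\<bar> \<le> norm y * (norm j * norm x)" by (simp add: mult_ac)
qed

lemma evaluation_functional:
  fixes f :: "'v::real_normed_vector \<Rightarrow>\<^sub>L real"
  shows "bounded_linear (\<lambda>f. blinfun_apply f v)" and "\<bar>f v\<bar> \<le> norm f * norm v"
  using norm_blinfun[of f v] by (simp_all add: blinfun.bounded_linear_left)

lemmas weighted_inner_bound = weighted_pairing[OF _ _ inner_embedding_functional]
lemmas weighted_functional_bound = weighted_pairing[OF _ _ evaluation_functional]

lemma has_weak_derivative_add:
  assumes L2: "w \<in> L2 T" "w' \<in> L2 T" "g \<in> L2 T" "g' \<in> L2 T"
    and weak: "has_weak_derivative T j w g" "has_weak_derivative T j w' g'"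
  shows "has_weak_derivative T j (w + w') (g + g')"
  unfolding has_weak_derivative_def
proof (intro allI impI)
  fix \<phi> v assume \<phi>: "test_function T \<phi>"
  note cont = test_function_continuous[OF \<phi>]
  note int = weighted_inner_bound(1)[OF cont(2) L2(1), where j = j] weighted_inner_bound(1)[OF cont(2) L2(2), where j = j]
    weighted_functional_bound(1)[OF cont(1) L2(3)] weighted_functional_bound(1)[OF cont(1) L2(4)]
  show "(\<integral>t. deriv \<phi> t * (j ((w + w') t) \<bullet> j v) \<partial>Xi T) = - (\<integral>t. \<phi> t * (g + g') t v \<partial>Xi T)"
    using weak \<phi> int unfolding has_weak_derivative_def
    by (simp add: blinfun.add_left blinfun.add_right inner_add_left distrib_left)
qed

lemma has_weak_derivative_scaleR:
  assumes "has_weak_derivative T j w g"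
  shows "has_weak_derivative T j (\<lambda>t. c *\<^sub>R w t) (\<lambda>t. c *\<^sub>R g t)"
  using assms unfolding has_weak_derivative_def
  by (simp add: blinfun.scaleR_left blinfun.scaleR_right mult.left_commute[of _ c])

text \<open>
  The exceptional null set depends on \<open>v\<close>, and the space of all \<open>v\<close> need not be separable. It is
  enough to test with countably many vectors, one for each value of the approximating simple
  functions at which that value nearly attains its norm.
\<close>

lemma weakly_zero_imp_AE_zero:
  fixes g :: "real \<Rightarrow> 'v::real_normed_vector \<Rightarrow>\<^sub>L real"
  assumes g: "strongly_measurable (Xi T) g" and zero: "\<And>v. AE t in Xi T. g t v = 0"
  shows "AE t in Xi T. g t = 0"
proof -
  obtain s where s: "\<And>n::nat. simple_function (Xi T) (s n)" "AE t in Xi T. (\<lambda>n. s n t) \<longlonglongrightarrow> g t"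
    using g unfolding strongly_measurable_def by blast
  define D where "D = (\<Union>n. s n ` space (Xi T))"
  have D: "countable D"
    unfolding D_def
    by (rule countable_UN[OF countableI_type]) (rule countable_finite[OF simple_functionD(1)[OF s(1)]])
  \<comment> \<open>the factor 1/2 leaves room, since the operator norm need not be attained\<close>
  have "\<exists>v. norm v \<le> 1 \<and> norm f / 2 \<le> \<bar>f v\<bar>" for f :: "'v \<Rightarrow>\<^sub>L real"
  proof (cases "f = 0")
    case False
    have "\<exists>v. norm f / 2 * norm v < norm (f v)"
    proof (rule ccontr)
      assume "\<not> ?thesis"
      then have "norm f \<le> norm f / 2" by (intro norm_blinfun_bound) (auto simp: not_less)
      then show False using False by simp
    qed
    then obtain v where v: "norm f / 2 * norm v < norm (f v)" by blast
    then have "v \<noteq> 0" by auto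
    have "norm f / 2 \<le> \<bar>f (v /\<^sub>R norm v)\<bar>"
      using v \<open>v \<noteq> 0\<close> by (simp add: blinfun.scaleR_right field_simps abs_mult)
    then show ?thesis using \<open>v \<noteq> 0\<close> by (intro exI[of _ "v /\<^sub>R norm v"]) simp
  qed (auto intro: exI[of _ 0])
  then obtain n where n: "\<And>f :: 'v \<Rightarrow>\<^sub>L real. norm (n f) \<le> 1" "\<And>f. norm f / 2 \<le> \<bar>f (n f)\<bar>"
    by metis
  have "AE t in Xi T. \<forall>f\<in>D. g t (n f) = 0"
    using D zero by (simp add: AE_ball_countable)
  then show ?thesis using s(2) AE_space
  proof eventually_elim
    case (elim t)
    have "norm (s i t) \<le> 2 * norm (s i t - g t)" for i
    proof -
      have "s i t \<in> D" using elim(3) unfolding D_def by blast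
      then have "(s i t - g t) (n (s i t)) = s i t (n (s i t))"
        using elim(1) by (simp add: blinfun.diff_left)
      then have "norm (s i t) / 2 \<le> norm ((s i t - g t) (n (s i t)))" using n(2)[of "s i t"] by simp
      also have "\<dots> \<le> norm (s i t - g t) * norm (n (s i t))" by (rule norm_blinfun)
      also have "\<dots> \<le> norm (s i t - g t) * 1" by (intro mult_left_mono n) simp
      finally show ?thesis by simp
    qed
    moreover have "(\<lambda>i. 2 * norm (s i t - g t)) \<longlonglongrightarrow> 2 * norm (g t - g t)"
      by (intro tendsto_intros elim(2))
    moreover have "(\<lambda>i. norm (s i t)) \<longlonglongrightarrow> norm (g t)" by (intro tendsto_intros elim(2))
    ultimately have "norm (g t) \<le> 2 * norm (g t - g t)" by (intro LIMSEQ_le) blast+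
    then show ?case by simp
  qed
qed

text \<open>
  Together with linearity this makes \<open>weak_derivative\<close>, which is defined by choice, linear almost
  everywhere.
\<close>

lemma weak_derivative_of_null:
  assumes "0 < T" and g: "g \<in> L2 T" and w: "w \<in> L2 T" "AE t in Xi T. w t = 0"
    and weak: "has_weak_derivative T j w g"
  shows "AE t in Xi T. g t = 0"
proof (rule weakly_zero_imp_AE_zero[OF L2_measurable[OF g]])
  fix v
  have int: "integrable (Xi T) (\<lambda>t. g t v)"
    using weighted_functional_bound(1)[OF continuous_on_const[of _ 1] g] by simp
  have "(\<integral>t. deriv \<phi> t * 0 \<partial>Xi T) = - (\<integral>t. \<phi> t * g t v \<partial>Xi T)" if \<phi>: "test_function T \<phi>" for \<phi>
  proof -
    have "(\<integral>t. deriv \<phi> t * (j (w t) \<bullet> j v) \<partial>Xi T) = (\<integral>t. 0 \<partial>Xi T)"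
      using w(2) by (intro integral_cong_AE borel_measurable_integrable
          weighted_inner_bound(1)[OF test_function_continuous(2)[OF \<phi>] w(1)]) auto
    then show ?thesis using weak \<phi> by (simp add: has_weak_derivative_def)
  qed
  from weak_derivative_increment[OF \<open>0 < T\<close> continuous_on_const int this]
  show "AE t in Xi T. g t v = 0" by (intro interval_integrals_zero_imp_AE_zero int) simp
qed

lemma space_X_L2: "w \<in> space_X T j \<Longrightarrow> w \<in> L2 T"
  by (simp add: space_X_def)

lemma weak_derivative_works:
  assumes "w \<in> space_X T j"
  shows "weak_derivative T j w \<in> L2 T" and "has_weak_derivative T j w (weak_derivative T j w)"
proof -
  have "\<exists>g. g \<in> L2 T \<and> has_weak_derivative T j w g" using assms by (auto simp: space_X_def)
  from someI_ex[OF this]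
  show "weak_derivative T j w \<in> L2 T" "has_weak_derivative T j w (weak_derivative T j w)"
    by (simp_all add: weak_derivative_def)
qed

lemma weak_derivative_unique:
  assumes "0 < T" and w: "w \<in> space_X T j" and g: "g \<in> L2 T" "has_weak_derivative T j w g"
  shows "AE t in Xi T. weak_derivative T j w t = g t"
proof -
  have "has_weak_derivative T j (w + (\<lambda>t. (- 1) *\<^sub>R w t)) (weak_derivative T j w + (\<lambda>t. (- 1) *\<^sub>R g t))"
    using w g by (intro has_weak_derivative_add has_weak_derivative_scaleR L2_scaleR weak_derivative_works
        space_X_L2)
  from weak_derivative_of_null[OF \<open>0 < T\<close> L2_add[OF weak_derivative_works(1)[OF w] L2_scaleR[OF g(1)]]
      L2_add[OF space_X_L2[OF w] L2_scaleR[OF space_X_L2[OF w]]] _ this]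
  show ?thesis by simp
qed

lemma weak_derivative_add_AE:
  assumes "0 < T" and w: "w \<in> space_X T j" "w' \<in> space_X T j" "w + w' \<in> space_X T j"
  shows "AE t in Xi T. weak_derivative T j (w + w') t = weak_derivative T j w t + weak_derivative T j w' t"
  using weak_derivative_unique[OF \<open>0 < T\<close> w(3), of "weak_derivative T j w + weak_derivative T j w'"] w(1,2)
  by (simp add: L2_add weak_derivative_works space_X_L2 has_weak_derivative_add)

lemma weak_derivative_scaleR_AE:
  assumes "0 < T" and w: "w \<in> space_X T j" "(\<lambda>t. c *\<^sub>R w t) \<in> space_X T j"
  shows "AE t in Xi T. weak_derivative T j (\<lambda>t. c *\<^sub>R w t) t = c *\<^sub>R weak_derivative T j w t"
  using weak_derivative_unique[OF \<open>0 < T\<close> w(2), of "\<lambda>t. c *\<^sub>R weak_derivative T j w t"] w(1)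
  by (simp add: L2_scaleR weak_derivative_works has_weak_derivative_scaleR)

lemma space_X_I:
  "w \<in> L2 T \<Longrightarrow> g \<in> L2 T \<Longrightarrow> has_weak_derivative T j w g \<Longrightarrow> w \<in> space_X T j"
  by (auto simp: space_X_def)

lemma space_X_add:
  assumes w: "w \<in> space_X T j" and w': "w' \<in> space_X T j" shows "w + w' \<in> space_X T j"
proof -
  note facts = space_X_L2[OF w] space_X_L2[OF w'] weak_derivative_works(1)[OF w] weak_derivative_works(1)[OF w']
  show ?thesis
    by (rule space_X_I[OF L2_add[OF facts(1,2)] L2_add[OF facts(3,4)]
          has_weak_derivative_add[OF facts weak_derivative_works(2)[OF w] weak_derivative_works(2)[OF w']]])
qed

lemma space_X_scaleR:
  assumes w: "w \<in> space_X T j" shows "(\<lambda>t. c *\<^sub>R w t) \<in> space_X T j"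
  by (rule space_X_I[OF L2_scaleR[OF space_X_L2[OF w]] L2_scaleR[OF weak_derivative_works(1)[OF w]]
        has_weak_derivative_scaleR[OF weak_derivative_works(2)[OF w]]])

lemma space_X_diff:
  assumes "w \<in> space_X T j" "w' \<in> space_X T j" shows "w - w' \<in> space_X T j"
  using space_X_add[OF assms(1) space_X_scaleR[OF assms(2), of "- 1"]]
  by (simp add: plus_fun_def fun_diff_def)

lemma weak_derivative_diff_AE:
  assumes "0 < T" and w: "w \<in> space_X T j" "w' \<in> space_X T j"
  shows "AE t in Xi T. weak_derivative T j (w - w') t = weak_derivative T j w t - weak_derivative T j w' t"
proof -
  have "AE t in Xi T. weak_derivative T j w t = weak_derivative T j (w - w') t + weak_derivative T j w' t"
    using weak_derivative_add_AE[OF \<open>0 < T\<close> space_X_diff[OF w] w(2)] w by simp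
  then show ?thesis by eventually_elim simp
qed

lemma norm_L2_weak_derivative_diff:
  assumes "0 < T" and w: "w \<in> space_X T j" "w' \<in> space_X T j"
  shows "norm_L2 T (weak_derivative T j (w - w')) = norm_L2 T (weak_derivative T j w - weak_derivative T j w')"
  using weak_derivative_diff_AE[OF assms] w
  by (intro norm_L2_cong L2_diff weak_derivative_works space_X_diff) simp_all

lemma dt_add_left:
  assumes "0 < T" and w: "w \<in> space_X T j" "w' \<in> space_X T j" and v: "v \<in> L2 T"
  shows "dt T j (w + w') v = dt T j w v + dt T j w' v"
proof -
  have int: "integrable (Xi T) (\<lambda>t. weak_derivative T j w t (v t))" if "w \<in> space_X T j" for w
    by (intro L2_blinfun_pairing weak_derivative_works that v)
  have "dt T j (w + w') v = (\<integral>t. weak_derivative T j w t (v t) + weak_derivative T j w' t (v t) \<partial>Xi T)"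
    unfolding dt_def
  proof (rule integral_cong_AE)
    show "AE t in Xi T. weak_derivative T j (w + w') t (v t) = weak_derivative T j w t (v t) + weak_derivative T j w' t (v t)"
      using weak_derivative_add_AE[OF \<open>0 < T\<close> w space_X_add[OF w]]
      by eventually_elim (simp add: blinfun.add_left)
  qed (intro borel_measurable_integrable Bochner_Integration.integrable_add int w space_X_add)+
  then show ?thesis using int w by (simp add: dt_def)
qed

lemma dt_scaleR_left:
  assumes "0 < T" and w: "w \<in> space_X T j" and v: "v \<in> L2 T"
  shows "dt T j (\<lambda>t. c *\<^sub>R w t) v = c * dt T j w v"
proof -
  have int: "integrable (Xi T) (\<lambda>t. weak_derivative T j w t (v t))" if "w \<in> space_X T j" for w
    by (intro L2_blinfun_pairing weak_derivative_works that v)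
  have "dt T j (\<lambda>t. c *\<^sub>R w t) v = (\<integral>t. c * weak_derivative T j w t (v t) \<partial>Xi T)"
    unfolding dt_def
  proof (rule integral_cong_AE)
    show "AE t in Xi T. weak_derivative T j (\<lambda>t. c *\<^sub>R w t) t (v t) = c * weak_derivative T j w t (v t)"
      using weak_derivative_scaleR_AE[OF \<open>0 < T\<close> w space_X_scaleR[OF w], of c]
      by eventually_elim (simp add: blinfun.scaleR_left)
  qed (intro borel_measurable_integrable integrable_mult_right int w space_X_scaleR)+
  then show ?thesis by (simp add: dt_def)
qed

lemma dt_add_right:
  assumes "w \<in> space_X T j" and "v \<in> L2 T" "v' \<in> L2 T"
  shows "dt T j w (v + v') = dt T j w v + dt T j w v'"
  using L2_blinfun_pairing(1)[OF weak_derivative_works(1)[OF assms(1)]] assms(2,3)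
  by (simp add: dt_def blinfun.add_right)

lemma dt_scaleR_right: "dt T j w (\<lambda>t. c *\<^sub>R v t) = c * dt T j w v"
  by (simp add: dt_def blinfun.scaleR_right)

lemma dt_bound:
  assumes "w \<in> space_X T j" and "v \<in> L2 T"
  shows "\<bar>dt T j w v\<bar> \<le> norm_L2 T (weak_derivative T j w) * norm_L2 T v"
  unfolding dt_def by (intro L2_blinfun_pairing weak_derivative_works assms)

text \<open>
  Carries almost everywhere statements about the continuous representative over to the end point
  \<open>T\<close>, where the trace is taken.
\<close>

lemma continuous_AE_imp_on_closed_interval:
  fixes F :: "real \<Rightarrow> 'b::topological_space"
  assumes "0 < T" and F: "continuous_on {0..T} F" and "closed C" and AE: "AE t in Xi T. F t \<in> C"
    and t: "t \<in> {0..T}"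
  shows "F t \<in> C"
proof -
  define K where "K = {0..T} \<inter> F -` C"
  have K: "closed K"
    unfolding K_def using F \<open>closed C\<close> by (intro continuous_closed_preimage) auto
  have AE': "AE t\<in>{0<..<T} in lebesgue. t \<in> K"
    using AE by (auto simp: AE_restrict_space_iff K_def elim: eventually_mono)
  have "{0<..<T} \<subseteq> K"
    using mem_closed_if_AE_lebesgue_open[OF _ K AE'] by auto
  then have "closure {0<..<T} \<subseteq> K" using K by (rule closure_minimal)
  then show ?thesis using t \<open>0 < T\<close> by (auto simp: K_def closure_greaterThanLessThan)
qed

lemma trace_eqI:
  assumes "0 < T" and tr: "is_trace T j \<gamma>" and w: "w \<in> space_X T j"
    and F: "continuous_on {0..T} F" and eq: "AE t in Xi T. F t = j (w t)"
  shows "\<gamma> T w = F T"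
proof -
  have "\<gamma> T w - F T \<in> {0}"
  proof (rule continuous_AE_imp_on_closed_interval[OF \<open>0 < T\<close>, of "\<lambda>t. \<gamma> t w - F t"])
    show "continuous_on {0..T} (\<lambda>t. \<gamma> t w - F t)"
      using tr w F unfolding is_trace_def by (intro continuous_intros) blast+
    have "AE t in Xi T. \<gamma> t w = j (w t)" using tr w unfolding is_trace_def by blast
    then show "AE t in Xi T. \<gamma> t w - F t \<in> {0}" using eq by eventually_elim simp
  qed (use \<open>0 < T\<close> in auto)
  then show ?thesis by simp
qed

lemma trace_add:
  assumes "0 < T" and tr: "is_trace T j \<gamma>" and w: "w \<in> space_X T j" "w' \<in> space_X T j"
  shows "\<gamma> T (w + w') = \<gamma> T w + \<gamma> T w'"
proof (rule trace_eqI[OF \<open>0 < T\<close> tr space_X_add[OF w]])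
  show "continuous_on {0..T} (\<lambda>t. \<gamma> t w + \<gamma> t w')"
    using tr w unfolding is_trace_def by (intro continuous_intros) blast+
  have "AE t in Xi T. \<gamma> t w = j (w t)" "AE t in Xi T. \<gamma> t w' = j (w' t)"
    using tr w unfolding is_trace_def by blast+
  then show "AE t in Xi T. \<gamma> t w + \<gamma> t w' = j ((w + w') t)"
    by eventually_elim (simp add: blinfun.add_right)
qed

lemma trace_scaleR:
  assumes "0 < T" and tr: "is_trace T j \<gamma>" and w: "w \<in> space_X T j"
  shows "\<gamma> T (\<lambda>t. c *\<^sub>R w t) = c *\<^sub>R \<gamma> T w"
proof (rule trace_eqI[OF \<open>0 < T\<close> tr space_X_scaleR[OF w]])
  show "continuous_on {0..T} (\<lambda>t. c *\<^sub>R \<gamma> t w)"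
    using tr w unfolding is_trace_def by (intro continuous_intros) blast
  have "AE t in Xi T. \<gamma> t w = j (w t)" using tr w unfolding is_trace_def by blast
  then show "AE t in Xi T. c *\<^sub>R \<gamma> t w = j (c *\<^sub>R w t)"
    by eventually_elim (simp add: blinfun.scaleR_right)
qed

lemma trace_diff:
  assumes "0 < T" and "is_trace T j \<gamma>" and "w \<in> space_X T j" "w' \<in> space_X T j"
  shows "\<gamma> T (w - w') = \<gamma> T w - \<gamma> T w'"
  using trace_add[OF assms(1,2) space_X_diff[OF assms(3,4)] assms(4)] by simp

text \<open>
  By the fundamental theorem of calculus, \<open>G t = \<gamma> t w \<bullet> j v\<close> varies by at most the integral \<open>D\<close>
  of the absolute value of its derivative, so its absolute value at any point exceeds the mean by at
  most \<open>D\<close>. The constant depends on \<open>v\<close>; this weak continuity of the trace already identifies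
  limits of traces, because the image of \<open>j\<close> is dense.
\<close>

lemma trace_weak_bound:
  assumes "0 < T" and tr: "is_trace T j \<gamma>"
  obtains K where "\<And>w. w \<in> space_X T j \<Longrightarrow>
     \<bar>\<gamma> T w \<bullet> j v\<bar> \<le> K * (norm_L2 T w + norm_L2 T (weak_derivative T j w))"
proof -
  define P where "P = norm_L2 T (\<lambda>t. norm j * norm (j v))"
  define Q where "Q = norm_L2 T (\<lambda>t::real. norm v)"
  have PQ: "0 \<le> P" "0 \<le> Q" by (simp_all add: P_def Q_def norm_L2_nonneg)
  have "\<bar>\<gamma> T w \<bullet> j v\<bar> \<le> (P / T + Q) * (norm_L2 T w + norm_L2 T (weak_derivative T j w))"
    if w: "w \<in> space_X T j" for w
  proof -
    define g where "g t = weak_derivative T j w t v" for t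
    define G where "G t = \<gamma> t w \<bullet> j v" for t
    have g: "integrable (Xi T) g"
      unfolding g_def using weighted_functional_bound(1)[OF continuous_on_const[of _ 1] weak_derivative_works(1)[OF w]]
      by simp
    have G: "continuous_on {0..T} G"
      using tr w unfolding G_def is_trace_def by (intro continuous_intros) blast
    have \<gamma>_AE: "AE t in Xi T. \<gamma> t w = j (w t)" using tr w unfolding is_trace_def by blast
    have weak: "(\<integral>t. deriv \<phi> t * G t \<partial>Xi T) = - (\<integral>t. \<phi> t * g t \<partial>Xi T)" if \<phi>: "test_function T \<phi>" for \<phi>
    proof -
      have "(\<integral>t. deriv \<phi> t * G t \<partial>Xi T) = (\<integral>t. deriv \<phi> t * (j (w t) \<bullet> j v) \<partial>Xi T)"
      proof (rule integral_cong_AE)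
        show "(\<lambda>t. deriv \<phi> t * G t) \<in> borel_measurable (Xi T)"
          by (intro borel_measurable_integrable continuous_integrable_Xi continuous_on_mult
              test_function_continuous[OF \<phi>] G)
        show "(\<lambda>t. deriv \<phi> t * (j (w t) \<bullet> j v)) \<in> borel_measurable (Xi T)"
          by (intro borel_measurable_integrable weighted_inner_bound test_function_continuous[OF \<phi>] space_X_L2[OF w])
        show "AE t in Xi T. deriv \<phi> t * G t = deriv \<phi> t * (j (w t) \<bullet> j v)"
          using \<gamma>_AE by eventually_elim (simp add: G_def)
      qed
      also have "\<dots> = - (\<integral>t. \<phi> t * g t \<partial>Xi T)"
        using weak_derivative_works(2)[OF w] \<phi> unfolding has_weak_derivative_def g_def by blast
      finally show ?thesis .
    qed
    define D where "D = (\<integral>t. norm (g t) \<partial>Xi T)"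
    have incr: "\<bar>G b - G a\<bar> \<le> D" if ab: "0 < a" "a < b" "b < T" for a b
    proof -
      have increment: "G b - G a = (\<integral>t. indicator {a<..b} t * g t \<partial>Xi T)"
        by (rule weak_derivative_increment[OF \<open>0 < T\<close> G g weak ab])
      have "\<bar>G b - G a\<bar> \<le> (\<integral>t. norm (indicator {a<..b} t * g t) \<partial>Xi T)"
        unfolding increment real_norm_def by (rule integral_abs_bound)
      also have "\<dots> \<le> D"
        unfolding D_def using g by (intro integral_mono') (auto simp: indicator_def)
      finally show ?thesis .
    qed
    have "0 \<le> D" by (simp add: D_def)
    \<comment> \<open>averaging this over \<open>a\<close> bounds the value at \<open>b\<close>\<close>
    have compare: "\<bar>G b\<bar> \<le> \<bar>G a\<bar> + D" if "a \<in> {0<..<T}" "b \<in> {0<..<T}" for a b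
      using incr[of a b] incr[of b a] that \<open>0 \<le> D\<close> by (cases a b rule: linorder_cases) auto
    have int_G: "integrable (Xi T) (\<lambda>t. \<bar>G t\<bar>)"
      by (intro continuous_integrable_Xi continuous_intros G)
    have "T * \<bar>G b\<bar> \<le> (\<integral>t. \<bar>G t\<bar> \<partial>Xi T) + T * D" if b: "b \<in> {0<..<T}" for b
    proof -
      have vol: "measure (Xi T) (space (Xi T)) = T"
        using \<open>0 < T\<close> by (simp add: measure_restrict_space)
      have "(\<integral>t. \<bar>G b\<bar> \<partial>Xi T) \<le> (\<integral>t. \<bar>G t\<bar> + D \<partial>Xi T)"
        using compare b int_G by (intro integral_mono) auto
      then show ?thesis using int_G vol by simp
    qed
    then have average: "\<bar>G b\<bar> \<le> (\<integral>t. \<bar>G t\<bar> \<partial>Xi T) / T + D" if "b \<in> {0<..<T}" for b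
      using that \<open>0 < T\<close> by (simp add: field_simps)
    define M where "M = (\<integral>t. \<bar>G t\<bar> \<partial>Xi T) / T + D"
    have "G T \<in> {- M..M}"
    proof (rule continuous_AE_imp_on_closed_interval[OF \<open>0 < T\<close> G])
      show "AE t in Xi T. G t \<in> {- M..M}"
      proof (rule AE_I2)
        fix t assume "t \<in> space (Xi T)"
        then have "\<bar>G t\<bar> \<le> M" using average by (simp add: M_def)
        then show "G t \<in> {- M..M}" by auto
      qed
    qed (use \<open>0 < T\<close> in auto)
    then have "\<bar>G T\<bar> \<le> (\<integral>t. \<bar>G t\<bar> \<partial>Xi T) / T + D" by (auto simp: M_def)
    moreover have "(\<integral>t. \<bar>G t\<bar> \<partial>Xi T) \<le> P * norm_L2 T w"
    proof -
      have p: "(\<lambda>t. norm j * norm (j v)) \<in> L2 T" by (rule L2_const)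
      have "AE t in Xi T. \<bar>G t\<bar> = \<bar>j (w t) \<bullet> j v\<bar>"
        using \<gamma>_AE by eventually_elim (simp add: G_def)
      moreover have jw: "integrable (Xi T) (\<lambda>t. j (w t) \<bullet> j v)"
        using weighted_inner_bound(1)[OF continuous_on_const[of _ 1] space_X_L2[OF w], where j = j] by simp
      ultimately have "(\<integral>t. \<bar>G t\<bar> \<partial>Xi T) = (\<integral>t. \<bar>j (w t) \<bullet> j v\<bar> \<partial>Xi T)"
        using int_G by (intro integral_cong_AE borel_measurable_integrable) (auto intro: integrable_abs)
      also have "\<dots> \<le> \<bar>\<integral>t. \<bar>j (w t) \<bullet> j v\<bar> \<partial>Xi T\<bar>" by simp
      also have "\<dots> \<le> norm_L2 T w * P"
        unfolding P_def
      proof (rule L2_dominated_pairing(2)[OF space_X_L2[OF w] p])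
        show "(\<lambda>t. \<bar>j (w t) \<bullet> j v\<bar>) \<in> borel_measurable (Xi T)"
          using jw by (intro borel_measurable_integrable integrable_abs)
        show "\<bar>\<bar>j (w t) \<bullet> j v\<bar>\<bar> \<le> norm (w t) * norm (norm j * norm (j v))" for t
        proof -
          have "\<bar>j (w t) \<bullet> j v\<bar> \<le> norm (j (w t)) * norm (j v)" by (rule Cauchy_Schwarz_ineq2)
          also have "\<dots> \<le> (norm j * norm (w t)) * norm (j v)" by (intro mult_right_mono norm_blinfun) simp
          finally show ?thesis by (simp add: mult_ac)
        qed
      qed
      finally show ?thesis by (simp add: mult.commute)
    qed
    moreover have "D \<le> Q * norm_L2 T (weak_derivative T j w)"
    proof -
      have "D \<le> \<bar>\<integral>t. norm (g t) \<partial>Xi T\<bar>" by (simp add: D_def)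
      also have "\<dots> \<le> norm_L2 T (weak_derivative T j w) * norm_L2 T (\<lambda>t::real. norm v)"
      proof (rule L2_dominated_pairing(2)[OF weak_derivative_works(1)[OF w] L2_const])
        show "(\<lambda>t. norm (g t)) \<in> borel_measurable (Xi T)"
          using g by (intro borel_measurable_integrable integrable_norm)
        show "\<bar>norm (g t)\<bar> \<le> norm (weak_derivative T j w t) * norm (norm v)" for t
          unfolding g_def using norm_blinfun[of "weak_derivative T j w t" v] by simp
      qed
      finally show ?thesis by (simp add: Q_def mult.commute)
    qed
    moreover have "(\<integral>t. \<bar>G t\<bar> \<partial>Xi T) / T \<le> (P * norm_L2 T w) / T"
      using calculation(2) \<open>0 < T\<close> by (intro divide_right_mono) auto
    moreover have "0 \<le> P / T * norm_L2 T (weak_derivative T j w)" "0 \<le> Q * norm_L2 T w"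
      using PQ \<open>0 < T\<close> by (auto intro!: mult_nonneg_nonneg divide_nonneg_nonneg simp: norm_L2_nonneg)
    ultimately show ?thesis unfolding G_def by (simp add: algebra_simps)
  qed
  then show ?thesis by (rule that)
qed

lemma dense_range_inner_eq_zero:
  assumes "gelfand_triple j" and "\<And>v. h \<bullet> j v = 0"
  shows "h = 0"
proof -
  have "closed {x. h \<bullet> x = 0}" by (intro closed_Collect_eq continuous_intros)
  moreover have "range (blinfun_apply j) \<subseteq> {x. h \<bullet> x = 0}" using assms(2) by auto
  ultimately have "closure (range (blinfun_apply j)) \<subseteq> {x. h \<bullet> x = 0}" by (intro closure_minimal)
  then have "h \<in> {x. h \<bullet> x = 0}" using assms(1) unfolding gelfand_triple_def by blast
  then show ?thesis by simp
qed

lemma has_weak_derivative_L2_limit: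
  assumes w: "\<And>n. w n \<in> L2 T" "z \<in> L2 T" and g: "\<And>n. g n \<in> L2 T" "h \<in> L2 T"
    and weak: "\<And>n. has_weak_derivative T j (w n) (g n)"
    and w_lim: "(\<lambda>n. norm_L2 T (w n - z)) \<longlonglongrightarrow> 0" and g_lim: "(\<lambda>n. norm_L2 T (g n - h)) \<longlonglongrightarrow> 0"
  shows "has_weak_derivative T j z h"
  unfolding has_weak_derivative_def
proof (intro allI impI)
  fix \<phi> v assume \<phi>: "test_function T \<phi>"
  note cont = test_function_continuous[OF \<phi>]
  define P where "P x = (\<integral>t. deriv \<phi> t * (j (x t) \<bullet> j v) \<partial>Xi T)" for x
  define Q where "Q x = (\<integral>t. \<phi> t * blinfun_apply (x t) v \<partial>Xi T)" for x
  have "(\<lambda>n. P (w n) - P z) \<longlonglongrightarrow> 0"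
  proof (rule Lim_null_comparison[OF always_eventually])
    have "P (w n) - P z = P (w n - z)" for n
      using weighted_inner_bound(1)[OF cont(2) w(1), where j = j] weighted_inner_bound(1)[OF cont(2) w(2), where j = j]
      by (simp add: P_def blinfun.diff_right inner_diff_left right_diff_distrib)
    then show "\<forall>n. norm (P (w n) - P z)
       \<le> norm_L2 T (w n - z) * norm_L2 T (\<lambda>t. deriv \<phi> t * (norm j * norm (j v)))"
      using weighted_inner_bound(2)[OF cont(2) L2_diff[OF w(1) w(2)], where j = j] by (simp add: P_def)
  qed (rule tendsto_mult_left_zero[OF w_lim])
  then have lhs: "(\<lambda>n. P (w n)) \<longlonglongrightarrow> P z" by (rule LIM_zero_cancel)
  have "(\<lambda>n. Q (g n) - Q h) \<longlonglongrightarrow> 0"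
  proof (rule Lim_null_comparison[OF always_eventually])
    have "Q (g n) - Q h = Q (g n - h)" for n
      using weighted_functional_bound(1)[OF cont(1) g(1)] weighted_functional_bound(1)[OF cont(1) g(2)]
      by (simp add: Q_def blinfun.diff_left right_diff_distrib)
    then show "\<forall>n. norm (Q (g n) - Q h) \<le> norm_L2 T (g n - h) * norm_L2 T (\<lambda>t. \<phi> t * norm v)"
      using weighted_functional_bound(2)[OF cont(1) L2_diff[OF g(1) g(2)]] by (simp add: Q_def)
  qed (rule tendsto_mult_left_zero[OF g_lim])
  then have "(\<lambda>n. - Q (g n)) \<longlonglongrightarrow> - Q h" by (intro tendsto_minus) (rule LIM_zero_cancel)
  moreover have "P (w n) = - Q (g n)" for n
    using weak \<phi> unfolding has_weak_derivative_def P_def Q_def by blast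
  ultimately have "P z = - Q h" using lhs by (simp add: LIMSEQ_unique)
  then show "(\<integral>t. deriv \<phi> t * (j (z t) \<bullet> j v) \<partial>Xi T) = - (\<integral>t. \<phi> t * h t v \<partial>Xi T)"
    by (simp add: P_def Q_def)
qed

section \<open>The discretization-dependent norm of X\<close>

lemma dual_space_iff: "F \<in> dual_space N W \<longleftrightarrow> bounded_functional W fun_scale N F"
  by (simp add: dual_space_def bounded_functional_def)

text \<open>
  The supremum is attained at the normalized representer.
\<close>

lemma dual_norm_represented:
  fixes W :: "(real \<Rightarrow> 'b::real_normed_vector) set"
  assumes "semi_inner_space W fun_scale ip N" and r: "r \<in> W" "\<And>v. v \<in> W \<Longrightarrow> ip r v = F v"
  shows "dual_norm N W F = N r"
proof -
  interpret semi_inner_space W fun_scale ip N by fact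
  show ?thesis unfolding dual_norm_def
  proof (rule cSup_eq_maximum)
    show "N r \<in> {\<bar>F v\<bar> |v. v \<in> W \<and> N v \<le> 1}"
    proof (cases "N r = 0")
      case True
      have "\<bar>F 0\<bar> = N r" using Cauchy_Schwarz[OF r(1) zero_mem] r(2)[OF zero_mem] True by simp
      then show ?thesis using zero_mem N_zero by (intro CollectI exI[of _ 0]) simp
    next
      case False
      define v where "v = (\<lambda>t. (1 / N r) *\<^sub>R r t)"
      have v: "v \<in> W" unfolding v_def by (rule sc_mem[OF r(1)])
      have "F v = (1 / N r) * (N r)\<^sup>2"
        using r(2)[OF v] ip_sc_right[OF r(1) r(1), of "1 / N r"] N_square[OF r(1)] by (simp add: v_def)
      moreover have "N v = 1"
        using N_sc[OF r(1), of "1 / N r"] False N_nonneg[OF r(1)] by (simp add: v_def)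
      ultimately show ?thesis
        using v N_nonneg[OF r(1)] False by (intro CollectI exI[of _ v]) (simp add: power2_eq_square)
    qed
    fix x assume "x \<in> {\<bar>F v\<bar> |v. v \<in> W \<and> N v \<le> 1}"
    then obtain v where v: "x = \<bar>F v\<bar>" "v \<in> W" "N v \<le> 1" by blast
    have "x \<le> N r * N v" using v Cauchy_Schwarz[OF r(1) v(2)] r(2)[OF v(2)] by simp
    also have "\<dots> \<le> N r * 1" using v N_nonneg[OF r(1)] by (intro mult_left_mono)
    finally show "x \<le> N r" by simp
  qed
qed

lemma dual_norm_pairing:
  fixes W :: "(real \<Rightarrow> 'b::real_normed_vector) set"
  assumes sp: "semi_inner_space W fun_scale ip N" and r: "r \<in> W" "\<And>v. v \<in> W \<Longrightarrow> ip r v = F v"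
    and v: "v \<in> W"
  shows "\<bar>F v\<bar> \<le> dual_norm N W F * N v"
  using semi_inner_space.Cauchy_Schwarz[OF sp r(1) v] r(2)[OF v] dual_norm_represented[OF sp r] by simp

lemma riesz_inv_works:
  fixes W :: "(real \<Rightarrow> 'b::real_normed_vector) set"
  assumes "semi_inner_space W fun_scale ip N" and r: "r \<in> W" "\<And>v. v \<in> W \<Longrightarrow> ip r v = F v"
  shows "riesz_inv N W F \<in> W" and "v \<in> W \<Longrightarrow> ip (riesz_inv N W F) v = F v"
proof -
  interpret semi_inner_space W fun_scale ip N by fact
  have riesz: "riesz N z v = ip z v" if "z \<in> W" "v \<in> W" for z v
    using polarization[OF that] by (simp add: riesz_def)
  have "\<exists>r. r \<in> W \<and> (\<forall>v\<in>W. riesz N r v = F v)" using r riesz by (intro exI[of _ r]) simp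
  from someI_ex[OF this, folded riesz_inv_def]
  show "riesz_inv N W F \<in> W" "v \<in> W \<Longrightarrow> ip (riesz_inv N W F) v = F v" using riesz by auto
qed

lemma closed_subspace_complete:
  assumes "seminorm_complete N S" and W: "closed_linear_subspace N S W"
  shows "seminorm_complete N W"
  unfolding seminorm_complete_def
proof (intro allI impI)
  fix x assume x: "\<forall>n::nat. x n \<in> W" and C: "\<forall>e>0. \<exists>K. \<forall>m\<ge>K. \<forall>n\<ge>K. N (x m - x n) < e"
  have "x n \<in> S" for n using x W unfolding closed_linear_subspace_def by blast
  then obtain l where l: "l \<in> S" "(\<lambda>n. N (x n - l)) \<longlonglongrightarrow> 0"
    using seminorm_completeD[OF assms(1), of x] C by blast
  then have "l \<in> W" using W x unfolding closed_linear_subspace_def by blast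
  with l show "\<exists>l\<in>W. (\<lambda>n. N (x n - l)) \<longlonglongrightarrow> 0" by blast
qed

lemma semi_inner_space_L2_UNIV: "semi_inner_space (L2 T) fun_scale (ip_L2 T) (norm_L2 T)"
  by (rule semi_inner_space_L2) (auto intro: L2_add L2_zero L2_scaleR)

lemma semi_inner_space_closed_subspace:
  "closed_linear_subspace (norm_L2 T) (L2 T) W \<Longrightarrow> semi_inner_space W fun_scale (ip_L2 T) (norm_L2 T)"
  unfolding closed_linear_subspace_def by (intro semi_inner_space_L2) blast+

lemma norm_Riesz_representer:
  fixes r :: "'v::real_inner"
  assumes "\<And>v. r \<bullet> v = blinfun_apply f v" shows "norm r = norm f"
proof (rule antisym)
  have "norm r * norm r \<le> norm f * norm r"
    using norm_blinfun[of f r] assms[of r] by (simp flip: power2_norm_eq_inner add: power2_eq_square)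
  then show "norm r \<le> norm f" by (cases "norm r = 0") (auto simp: mult_le_cancel_right)
  show "norm f \<le> norm r"
    using Cauchy_Schwarz_ineq2[of r] assms by (intro norm_blinfun_bound) auto
qed

lemma Riesz_map_exists:
  obtains R :: "('v::{real_inner,banach} \<Rightarrow>\<^sub>L real) \<Rightarrow> 'v" where "\<And>f v. R f \<bullet> v = f v"
proof -
  interpret semi_inner_space "UNIV :: 'v set" scaleR inner norm
    by standard (auto simp: inner_add_left norm_eq_sqrt_inner intro: inner_commute)
  have complete: "seminorm_complete norm (UNIV :: 'v set)"
    unfolding seminorm_complete_def
  proof (intro allI impI)
    fix x :: "nat \<Rightarrow> 'v" assume "\<forall>e>0. \<exists>K. \<forall>m\<ge>K. \<forall>n\<ge>K. norm (x m - x n) < e"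
    then have "Cauchy x" by (intro CauchyI) blast
    then obtain l where "x \<longlonglongrightarrow> l" using Cauchy_convergent convergent_def by blast
    then show "\<exists>l\<in>UNIV. (\<lambda>n. norm (x n - l)) \<longlonglongrightarrow> 0"
      using LIM_zero tendsto_norm_zero by blast
  qed
  have "\<exists>r. \<forall>v. r \<bullet> v = f v" for f :: "'v \<Rightarrow>\<^sub>L real"
  proof -
    have "\<forall>v\<in>UNIV. \<bar>f v\<bar> \<le> norm f * norm v" using norm_blinfun[of f] by simp
    then have "bounded_functional UNIV scaleR norm (blinfun_apply f)"
      unfolding bounded_functional_def by (auto simp: blinfun.add_right blinfun.scaleR_right)
    from Riesz_complete[OF complete this] show ?thesis by (metis UNIV_I)
  qed
  then show ?thesis using that by metis
qed

text \<open>
  The Riesz map of \<open>V\<close> is an isometry, so applying it pointwise preserves strong measurability and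
  the norm. This shows that the norm of an element of \<open>L\<^sub>2(\<Xi>; V')\<close> is its norm as a functional on
  \<open>L\<^sub>2(\<Xi>; V)\<close>.
\<close>

lemma L2_functional_attains_norm:
  fixes g :: "real \<Rightarrow> 'v::{real_inner,banach} \<Rightarrow>\<^sub>L real"
  assumes g: "g \<in> L2 T"
  obtains v where "v \<in> L2 T" and "norm_L2 T v = norm_L2 T g" and "(\<integral>t. g t (v t) \<partial>Xi T) = (norm_L2 T g)\<^sup>2"
proof -
  obtain R :: "('v \<Rightarrow>\<^sub>L real) \<Rightarrow> 'v" where R: "\<And>f v. R f \<bullet> v = f v" using Riesz_map_exists by blast
  have R_norm: "norm (R f) = norm f" for f by (rule norm_Riesz_representer) (rule R)
  have R_isometry: "norm (R f - R h) = norm (f - h)" for f h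
    by (rule norm_Riesz_representer) (simp add: inner_diff_left R blinfun.diff_left)
  define v where "v t = R (g t)" for t
  have "strongly_measurable (Xi T) v"
    unfolding v_def
  proof (rule strongly_measurable_compose[OF L2_measurable[OF g]])
    fix X :: "nat \<Rightarrow> 'v \<Rightarrow>\<^sub>L real" and x assume "X \<longlonglongrightarrow> x"
    then have "(\<lambda>n. norm (R (X n) - R x)) \<longlonglongrightarrow> 0"
      unfolding R_isometry using LIM_zero tendsto_norm_zero by blast
    then show "(\<lambda>n. R (X n)) \<longlonglongrightarrow> R x" by (simp add: LIM_zero_iff tendsto_norm_zero_iff)
  qed
  then have "v \<in> L2 T" using L2_integrable_square[OF g] by (simp add: L2_def v_def R_norm)
  moreover have "norm_L2 T v = norm_L2 T g" by (simp add: norm_L2_def v_def R_norm)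
  moreover have "g t (v t) = (norm (g t))\<^sup>2" for t
    using R[of "g t" "v t"] by (simp add: v_def power2_norm_eq_inner flip: R_norm)
  then have "(\<integral>t. g t (v t) \<partial>Xi T) = (norm_L2 T g)\<^sup>2" by (simp add: norm_L2_square)
  ultimately show ?thesis by (rule that)
qed

locale discretization =
  fixes T :: real and j :: "'v::{real_inner,banach} \<Rightarrow>\<^sub>L 'h::{real_inner,banach}"
    and \<gamma> :: "real \<Rightarrow> (real \<Rightarrow> 'v) \<Rightarrow> 'h" and Xd Yd :: "(real \<Rightarrow> 'v) set"
  assumes T_pos: "0 < T" and triple: "gelfand_triple j" and trace: "is_trace T j \<gamma>"
    and Xd: "closed_linear_subspace (norm_X T j) (space_X T j) Xd"
    and Yd: "closed_linear_subspace (norm_L2 T) (L2 T) Yd"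
begin

abbreviation N_Y :: "(real \<Rightarrow> 'v) \<Rightarrow> real" where "N_Y \<equiv> norm_L2 T"
abbreviation N_X :: "(real \<Rightarrow> 'v) \<Rightarrow> real" where "N_X \<equiv> norm_Xd T j \<gamma> Yd"

lemma Yd_L2: "v \<in> Yd \<Longrightarrow> v \<in> L2 T"
  using Yd unfolding closed_linear_subspace_def by blast

lemma Xd_space_X: "z \<in> Xd \<Longrightarrow> z \<in> space_X T j"
  using Xd unfolding closed_linear_subspace_def by blast

lemmas Xd_L2 = space_X_L2[OF Xd_space_X]

sublocale Y: semi_inner_space Yd fun_scale "ip_L2 T" N_Y
  by (rule semi_inner_space_closed_subspace[OF Yd])

lemma Yd_complete: "seminorm_complete N_Y Yd"
  by (rule closed_subspace_complete[OF L2_complete Yd])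

lemma dt_bounded_functional:
  assumes "z \<in> space_X T j" shows "bounded_functional Yd fun_scale N_Y (dt T j z)"
  unfolding bounded_functional_def
proof (intro conjI ballI allI)
  show "\<exists>C. \<forall>v\<in>Yd. \<bar>dt T j z v\<bar> \<le> C * N_Y v"
    using dt_bound[OF assms Yd_L2] by (intro exI[of _ "norm_L2 T (weak_derivative T j z)"]) blast
qed (simp_all add: dt_add_right[OF assms] dt_scaleR_right Yd_L2)

text \<open>
  The Riesz representer in \<open>Y\<^sup>\<delta>\<close> of the time derivative. The choice is linear only up to null
  elements, which is harmless because only its products with \<open>Y\<^sup>\<delta>\<close> are used.
\<close>

definition riesz_dt :: "(real \<Rightarrow> 'v) \<Rightarrow> real \<Rightarrow> 'v" where
  "riesz_dt z = (SOME r. r \<in> Yd \<and> (\<forall>v\<in>Yd. ip_L2 T r v = dt T j z v))"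

lemma
  assumes "z \<in> space_X T j"
  shows riesz_dt_mem: "riesz_dt z \<in> Yd" and ip_riesz_dt: "v \<in> Yd \<Longrightarrow> ip_L2 T (riesz_dt z) v = dt T j z v"
proof -
  have "\<exists>r. r \<in> Yd \<and> (\<forall>v\<in>Yd. ip_L2 T r v = dt T j z v)"
    using Y.Riesz_complete[OF Yd_complete dt_bounded_functional[OF assms]] by metis
  from someI_ex[OF this, folded riesz_dt_def]
  show "riesz_dt z \<in> Yd" "v \<in> Yd \<Longrightarrow> ip_L2 T (riesz_dt z) v = dt T j z v" by auto
qed

lemma dual_norm_dt: "z \<in> space_X T j \<Longrightarrow> dual_norm N_Y Yd (dt T j z) = N_Y (riesz_dt z)"
  by (rule dual_norm_represented[OF Y.semi_inner_space_axioms]) (auto simp: riesz_dt_mem ip_riesz_dt)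

text \<open>
  The inner product behind \<open>norm_Xd\<close>: the middle term is the inner product of the dual space of
  \<open>Y\<^sup>\<delta>\<close> applied to the two time derivatives.
\<close>

definition ip_X :: "(real \<Rightarrow> 'v) \<Rightarrow> (real \<Rightarrow> 'v) \<Rightarrow> real" where
  "ip_X z z' = ip_L2 T z z' + dt T j z (riesz_dt z') + \<gamma> T z \<bullet> \<gamma> T z'"

lemma N_X_square:
  assumes "z \<in> space_X T j"
  shows "(N_X z)\<^sup>2 = (N_Y z)\<^sup>2 + (N_Y (riesz_dt z))\<^sup>2 + (norm (\<gamma> T z))\<^sup>2"
  by (simp add: norm_Xd_def dual_norm_dt[OF assms])

lemma N_X_nonneg: "0 \<le> N_X z"
  by (simp add: norm_Xd_def)

lemma N_X_bounds:
  assumes "z \<in> space_X T j"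
  shows "N_Y z \<le> N_X z" and "N_Y (riesz_dt z) \<le> N_X z" and "norm (\<gamma> T z) \<le> N_X z"
  by (rule power2_le_imp_le; simp add: N_X_square[OF assms] N_X_nonneg)+

lemma semi_inner_space_space_X:
  assumes "W \<subseteq> space_X T j" and W: "0 \<in> W" "\<And>x y. x \<in> W \<Longrightarrow> y \<in> W \<Longrightarrow> x + y \<in> W"
    "\<And>c x. x \<in> W \<Longrightarrow> (\<lambda>t. c *\<^sub>R x t) \<in> W"
  shows "semi_inner_space W fun_scale ip_X N_X"
proof
  interpret L: semi_inner_space "L2 T" fun_scale "ip_L2 T" N_Y by (rule semi_inner_space_L2_UNIV)
  have WX: "z \<in> space_X T j" if "z \<in> W" for z using assms(1) that by blast
  note WL = space_X_L2[OF WX]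
  note riesz_dtL = Yd_L2[OF riesz_dt_mem[OF WX]]
  fix x y z :: "real \<Rightarrow> 'v" and c :: real
  {
    assume xy: "x \<in> W" "y \<in> W"
    have "dt T j x (riesz_dt y) = dt T j y (riesz_dt x)"
      using ip_riesz_dt[OF WX[OF xy(1)] riesz_dt_mem[OF WX[OF xy(2)]]] ip_riesz_dt[OF WX[OF xy(2)] riesz_dt_mem[OF WX[OF xy(1)]]]
        L.ip_commute[OF riesz_dtL[OF xy(1)] riesz_dtL[OF xy(2)]] by simp
    then show "ip_X x y = ip_X y x"
      using L.ip_commute[OF WL[OF xy(1)] WL[OF xy(2)]] by (simp add: ip_X_def inner_commute)
    show "ip_X (\<lambda>t. c *\<^sub>R x t) y = c * ip_X x y"
      using L.ip_sc_left[OF WL[OF xy(1)] WL[OF xy(2)], of c] dt_scaleR_left[OF T_pos WX[OF xy(1)] riesz_dtL[OF xy(2)], of c]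
        trace_scaleR[OF T_pos trace WX[OF xy(1)], of c]
      by (simp add: ip_X_def algebra_simps)
    assume z: "z \<in> W"
    show "ip_X (x + y) z = ip_X x z + ip_X y z"
      using L.ip_add_left[OF WL[OF xy(1)] WL[OF xy(2)] WL[OF z]]
        dt_add_left[OF T_pos WX[OF xy(1)] WX[OF xy(2)] riesz_dtL[OF z]]
        trace_add[OF T_pos trace WX[OF xy(1)] WX[OF xy(2)]]
      by (simp add: ip_X_def inner_add_left)
  }
  assume x: "x \<in> W"
  have "ip_X x x = (N_Y x)\<^sup>2 + (N_Y (riesz_dt x))\<^sup>2 + (norm (\<gamma> T x))\<^sup>2"
    using ip_riesz_dt[OF WX[OF x] riesz_dt_mem[OF WX[OF x]]]
    by (simp add: ip_X_def L.N_square WL[OF x] riesz_dtL[OF x] power2_norm_eq_inner)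
  then show "0 \<le> ip_X x x" "N_X x = sqrt (ip_X x x)"
    using N_X_square[OF WX[OF x]] N_X_nonneg[of x] by (simp_all add: real_sqrt_unique)
  show "(\<lambda>t. (- 1) *\<^sub>R x t) = - x" by (simp add: fun_eq_iff)
qed (use W in auto)

sublocale X: semi_inner_space Xd fun_scale ip_X N_X
  using Xd unfolding closed_linear_subspace_def by (intro semi_inner_space_space_X) blast+

lemma trace_eq_zero:
  assumes z: "z \<in> space_X T j" and "N_Y z = 0" and "norm_L2 T (weak_derivative T j z) = 0"
  shows "\<gamma> T z = 0"
proof (rule dense_range_inner_eq_zero[OF triple])
  fix v
  obtain K where "\<And>w. w \<in> space_X T j \<Longrightarrow>
     \<bar>\<gamma> T w \<bullet> j v\<bar> \<le> K * (norm_L2 T w + norm_L2 T (weak_derivative T j w))"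
    using trace_weak_bound[OF T_pos trace] by blast
  from this[OF z] show "\<gamma> T z \<bullet> j v = 0" using assms by simp
qed

lemma N_riesz_dt_le:
  assumes z: "z \<in> space_X T j" shows "N_Y (riesz_dt z) \<le> norm_L2 T (weak_derivative T j z)"
  using dt_bound[OF z Yd_L2] ip_riesz_dt[OF z]
  by (intro Y.N_le_of_represents[OF riesz_dt_mem[OF z]]) (auto simp: norm_L2_nonneg)

text \<open>
  Hence a space that is finite dimensional for the norm of \<open>X\<close> is finite dimensional for the
  discretization-dependent norm, with the same spanning set.
\<close>

lemma N_X_null:
  assumes z: "z \<in> space_X T j" and "norm_X T j z = 0"
  shows "N_X z = 0"
proof -
  have "(norm_X T j z)\<^sup>2 = (N_Y z)\<^sup>2 + (norm_L2 T (weak_derivative T j z))\<^sup>2" by (simp add: norm_X_def)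
  then have zero: "N_Y z = 0" "norm_L2 T (weak_derivative T j z) = 0"
    using assms(2) by (auto simp: add_nonneg_eq_0_iff)
  have "N_Y (riesz_dt z) = 0"
    using N_riesz_dt_le[OF z] zero(2) norm_L2_nonneg[of T "riesz_dt z"] by simp
  then have "(N_X z)\<^sup>2 = 0" using zero trace_eq_zero[OF z zero] by (simp add: N_X_square[OF z])
  then show ?thesis by simp
qed

lemma Riesz_Xd_finite_dimensional:
  assumes "finite_dimensional (norm_X T j) Xd" and F: "bounded_functional Xd fun_scale N_X F"
  obtains r where "r \<in> Xd" and "\<And>v. v \<in> Xd \<Longrightarrow> ip_X r v = F v"
proof -
  obtain B where B: "finite B" "B \<subseteq> Xd"
    and span: "\<And>w. w \<in> Xd \<Longrightarrow> \<exists>c. norm_X T j (w - (\<Sum>b\<in>B. (\<lambda>t. c b *\<^sub>R b t))) = 0"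
    using assms(1) unfolding finite_dimensional_def by blast
  have "\<exists>c. N_X (w - (\<Sum>b\<in>B. (\<lambda>t. c b *\<^sub>R b t))) = 0" if w: "w \<in> Xd" for w
  proof -
    obtain c where c: "norm_X T j (w - (\<Sum>b\<in>B. (\<lambda>t. c b *\<^sub>R b t))) = 0" using span[OF w] by blast
    have "w - (\<Sum>b\<in>B. (\<lambda>t. c b *\<^sub>R b t)) \<in> Xd" by (intro X.diff_mem w X.sum_sc_mem B)
    from N_X_null[OF Xd_space_X[OF this] c] show ?thesis by blast
  qed
  from X.Riesz_finite_dimensional[OF B this F] show ?thesis using that by blast
qed

text \<open>
  Over the full space \<open>Y\<close> the dual norm of the time derivative is its \<open>L\<^sub>2\<close> norm. Over a subspace
  it can be smaller, and \<open>X\<close> need not be complete for the resulting norm.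
\<close>

lemma N_weak_derivative_le:
  assumes "Yd = L2 T" and z: "z \<in> space_X T j"
  shows "norm_L2 T (weak_derivative T j z) \<le> N_X z"
proof -
  define g where "g = weak_derivative T j z"
  have "g \<in> L2 T" unfolding g_def by (rule weak_derivative_works[OF z])
  then obtain v where v: "v \<in> L2 T" "norm_L2 T v = norm_L2 T g" "(\<integral>t. g t (v t) \<partial>Xi T) = (norm_L2 T g)\<^sup>2"
    by (rule L2_functional_attains_norm)
  have "norm_L2 T g * norm_L2 T g = dt T j z v" using v(3) by (simp add: dt_def g_def power2_eq_square)
  also have "\<dots> \<le> N_Y (riesz_dt z) * N_Y v"
    using Y.Cauchy_Schwarz[OF riesz_dt_mem[OF z], of v] ip_riesz_dt[OF z, of v] v(1) assms(1) by simp
  finally have "norm_L2 T g \<le> N_Y (riesz_dt z)"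
    using v(2) norm_L2_nonneg[of T "riesz_dt z"] norm_L2_nonneg[of T g]
    by (cases "norm_L2 T g = 0") (auto simp: mult_le_cancel_right)
  also have "\<dots> \<le> N_X z" by (rule N_X_bounds[OF z])
  finally show ?thesis by (simp add: g_def)
qed

text \<open>
  A Cauchy sequence converges together with its time derivatives and its traces at \<open>T\<close>, each in
  its own complete space. The weak derivative is a closed operator, so the limit lies in \<open>X\<close>, and
  the weak bound on the trace identifies the limit of the traces.
\<close>

lemma space_X_complete:
  assumes full: "Yd = L2 T"
  shows "seminorm_complete N_X (space_X T j)"
  unfolding seminorm_complete_def
proof (intro allI impI)
  fix z :: "nat \<Rightarrow> real \<Rightarrow> 'v"
  assume "\<forall>n. z n \<in> space_X T j" and Cauchy: "\<forall>e>0. \<exists>K. \<forall>m\<ge>K. \<forall>n\<ge>K. N_X (z m - z n) < e"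
  then have z: "z n \<in> space_X T j" for n by blast
  define g where "g n = weak_derivative T j (z n)" for n
  have gL: "g n \<in> L2 T" for n unfolding g_def by (rule weak_derivative_works[OF z])
  have transfer: "\<exists>K. \<forall>m\<ge>K. \<forall>n\<ge>K. q m n < e" if "0 < e" "\<And>m n. q m n \<le> N_X (z m - z n)"
    for q :: "nat \<Rightarrow> nat \<Rightarrow> real" and e
    using Cauchy that by (meson le_less_trans)
  have g_diff: "norm_L2 T (g m - g n) \<le> N_X (z m - z n)" for m n
    using N_weak_derivative_le[OF full space_X_diff[OF z z]] norm_L2_weak_derivative_diff[OF T_pos z z]
    by (simp add: g_def)
  have z_diff: "norm_L2 T (z m - z n) \<le> N_X (z m - z n)" for m n
    by (rule N_X_bounds[OF space_X_diff[OF z z]])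
  have \<gamma>_diff: "norm (\<gamma> T (z m) - \<gamma> T (z n)) \<le> N_X (z m - z n)" for m n
    using N_X_bounds(3)[OF space_X_diff[OF z z]] by (simp add: trace_diff[OF T_pos trace z z])
  obtain l where l: "l \<in> L2 T" and l_lim: "(\<lambda>n. norm_L2 T (z n - l)) \<longlonglongrightarrow> 0"
    using seminorm_completeD[OF L2_complete, of z T] space_X_L2[OF z] transfer[OF _ z_diff] by blast
  obtain h where h: "h \<in> L2 T" and h_lim: "(\<lambda>n. norm_L2 T (g n - h)) \<longlonglongrightarrow> 0"
    using seminorm_completeD[OF L2_complete, of g T] gL transfer[OF _ g_diff] by blast
  have weak: "has_weak_derivative T j (z n) (g n)" for n
    unfolding g_def by (rule weak_derivative_works[OF z])
  have l_weak: "has_weak_derivative T j l h"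
    by (rule has_weak_derivative_L2_limit[OF space_X_L2[OF z] l gL h weak l_lim h_lim])
  have lX: "l \<in> space_X T j" by (rule space_X_I[OF l h l_weak])
  have "norm_L2 T (weak_derivative T j (z n - l)) = norm_L2 T (g n - h)" for n
  proof -
    have "AE t in Xi T. weak_derivative T j (z n - l) t = (g n - h) t"
      using weak_derivative_diff_AE[OF T_pos z[of n] lX] weak_derivative_unique[OF T_pos lX h l_weak]
      by eventually_elim (simp add: g_def)
    then show ?thesis
      by (rule norm_L2_cong[OF weak_derivative_works(1)[OF space_X_diff[OF z lX]] L2_diff[OF gL h]])
  qed
  then have wd_lim: "(\<lambda>n. norm_L2 T (weak_derivative T j (z n - l))) \<longlonglongrightarrow> 0"
    using h_lim by simp
  have "Cauchy (\<lambda>n. \<gamma> T (z n))" using transfer[OF _ \<gamma>_diff] by (intro CauchyI) blast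
  then obtain c where c: "(\<lambda>n. \<gamma> T (z n)) \<longlonglongrightarrow> c" using Cauchy_convergent convergent_def by blast
  have "c - \<gamma> T l = 0"
  proof (rule dense_range_inner_eq_zero[OF triple])
    fix v
    obtain K where K: "\<And>w. w \<in> space_X T j \<Longrightarrow>
       \<bar>\<gamma> T w \<bullet> j v\<bar> \<le> K * (norm_L2 T w + norm_L2 T (weak_derivative T j w))"
      using trace_weak_bound[OF T_pos trace] by blast
    have "(\<lambda>n. \<gamma> T (z n - l) \<bullet> j v) \<longlonglongrightarrow> 0"
    proof (rule Lim_null_comparison[OF always_eventually])
      show "\<forall>n. norm (\<gamma> T (z n - l) \<bullet> j v) \<le> K * (norm_L2 T (z n - l) + norm_L2 T (weak_derivative T j (z n - l)))"
        using K[OF space_X_diff[OF z lX]] by simp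
      show "(\<lambda>n. K * (norm_L2 T (z n - l) + norm_L2 T (weak_derivative T j (z n - l)))) \<longlonglongrightarrow> 0"
        using tendsto_mult[OF tendsto_const[of K] tendsto_add[OF l_lim wd_lim]] by simp
    qed
    moreover have "(\<lambda>n. \<gamma> T (z n - l) \<bullet> j v) \<longlonglongrightarrow> (c - \<gamma> T l) \<bullet> j v"
      unfolding trace_diff[OF T_pos trace z lX] by (intro tendsto_intros c)
    ultimately show "(c - \<gamma> T l) \<bullet> j v = 0" by (rule LIMSEQ_unique[symmetric])
  qed
  then have \<gamma>_lim: "(\<lambda>n. norm (\<gamma> T (z n - l))) \<longlonglongrightarrow> 0"
    unfolding trace_diff[OF T_pos trace z lX] using LIM_zero[OF c] by (simp add: tendsto_norm_zero)
  define b where "b n = sqrt ((norm_L2 T (z n - l))\<^sup>2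
      + (norm_L2 T (weak_derivative T j (z n - l)))\<^sup>2 + (norm (\<gamma> T (z n - l)))\<^sup>2)" for n
  have "(\<lambda>n. N_X (z n - l)) \<longlonglongrightarrow> 0"
  proof (rule Lim_null_comparison[OF always_eventually])
    have "(N_X (z n - l))\<^sup>2 \<le> (norm_L2 T (z n - l))\<^sup>2
        + (norm_L2 T (weak_derivative T j (z n - l)))\<^sup>2 + (norm (\<gamma> T (z n - l)))\<^sup>2" for n
      unfolding N_X_square[OF space_X_diff[OF z lX]]
      by (intro add_mono power_mono N_riesz_dt_le space_X_diff z lX norm_L2_nonneg order_refl)
    then show "\<forall>n. norm (N_X (z n - l)) \<le> b n"
      unfolding b_def using N_X_nonneg by (simp add: real_le_rsqrt)
    have "b \<longlonglongrightarrow> sqrt (0\<^sup>2 + 0\<^sup>2 + 0\<^sup>2)"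
      unfolding b_def by (intro tendsto_intros l_lim wd_lim \<gamma>_lim)
    then show "b \<longlonglongrightarrow> 0" by simp
  qed
  with lX show "\<exists>l\<in>space_X T j. (\<lambda>n. N_X (z n - l)) \<longlonglongrightarrow> 0" by blast
qed

end

section \<open>The Uzawa iteration as relaxation for the Schur complement\<close>

lemma Cauchy_Schwarz_3:
  fixes a b c x y z :: real
  shows "a * x + b * y + c * z \<le> sqrt (a\<^sup>2 + b\<^sup>2 + c\<^sup>2) * sqrt (x\<^sup>2 + y\<^sup>2 + z\<^sup>2)"
proof -
  have "(a * x + b * y + c * z)\<^sup>2 + ((a * y - b * x)\<^sup>2 + (a * z - c * x)\<^sup>2 + (b * z - c * y)\<^sup>2)
      = (a\<^sup>2 + b\<^sup>2 + c\<^sup>2) * (x\<^sup>2 + y\<^sup>2 + z\<^sup>2)"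
    by (simp add: power2_eq_square algebra_simps)
  then have "(a * x + b * y + c * z)\<^sup>2 \<le> (a\<^sup>2 + b\<^sup>2 + c\<^sup>2) * (x\<^sup>2 + y\<^sup>2 + z\<^sup>2)"
    by (smt (verit) zero_le_power2)
  then have "a * x + b * y + c * z \<le> sqrt ((a\<^sup>2 + b\<^sup>2 + c\<^sup>2) * (x\<^sup>2 + y\<^sup>2 + z\<^sup>2))"
    by (rule real_le_rsqrt)
  then show ?thesis by (simp add: real_sqrt_mult)
qed

text \<open>
  In the application \<open>a\<close> and \<open>b\<close> are the errors of the two components and \<open>c\<close> is the error of the
  inner iteration with respect to the exact solution for the current outer iterate. The constant
  \<open>C\<close> is chosen such that \<open>(\<sigma>' - \<sigma>) / \<zeta> + 1 / m = \<sigma>' * C\<close>, and the smallness of \<open>q\<close> bounds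
  \<open>c k\<close> by \<open>(\<sigma>' - \<sigma>) / \<zeta>\<close> times the current bound; with this the two bounds reproduce
  themselves with the factor \<open>\<sigma>'\<close>.
\<close>

lemma two_level_linear_convergence:
  fixes a b c :: "nat \<Rightarrow> real"
  assumes pos: "0 < m" "0 < \<zeta>" "0 \<le> q" "0 \<le> \<sigma>" "\<sigma> < \<sigma>'"
    and inner: "\<And>k. c k \<le> q * (a k + b k / m)"
    and a_step: "\<And>k. a (Suc k) \<le> c k + b k / m"
    and nonneg: "\<And>k. 0 \<le> b k"
    and b_step: "\<And>k. b (Suc k) \<le> \<sigma> * b k + \<zeta> * c k"
    and C_def: "C = (1 / \<sigma>') * ((\<sigma>' - \<sigma>) / \<zeta> + 1 / m)"
    and q_small: "q * (C + 1 / m) \<le> (\<sigma>' - \<sigma>) / \<zeta>"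
    and D_def: "D = max ((1 / C) * a 0) (b 0)"
  shows "(1 / C) * a k \<le> \<sigma>' ^ k * D \<and> b k \<le> \<sigma>' ^ k * D"
proof -
  have \<sigma>': "0 < \<sigma>'" using pos by linarith
  have "0 < (\<sigma>' - \<sigma>) / \<zeta>" "0 < 1 / m" using pos by auto
  then have C: "0 < C" using \<sigma>' unfolding C_def by (intro mult_pos_pos add_pos_pos) auto
  have C_mult: "\<sigma>' * C = (\<sigma>' - \<sigma>) / \<zeta> + 1 / m" using \<sigma>' by (simp add: C_def)
  have "a k \<le> C * (\<sigma>' ^ k * D) \<and> b k \<le> \<sigma>' ^ k * D"
  proof (induction k)
    case 0
    have "(1 / C) * a 0 \<le> D" "b 0 \<le> D" by (auto simp: D_def)
    then show ?case using C by (simp add: field_simps)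
  next
    case (Suc k)
    define E where "E = \<sigma>' ^ k * D"
    have IH: "a k \<le> C * E" "b k \<le> E" using Suc by (auto simp: E_def)
    have b_m: "b k / m \<le> E / m" using IH pos by (intro divide_right_mono) auto
    have "0 \<le> E" using IH(2) nonneg[of k] by linarith
    have "a k + b k / m \<le> (C + 1 / m) * E" using IH(1) b_m by (simp add: algebra_simps)
    then have "c k \<le> q * ((C + 1 / m) * E)"
      using inner[of k] pos(3) mult_left_mono order_trans by blast
    also have "\<dots> = (q * (C + 1 / m)) * E" by simp
    also have "\<dots> \<le> ((\<sigma>' - \<sigma>) / \<zeta>) * E" using q_small \<open>0 \<le> E\<close> by (rule mult_right_mono)
    finally have c: "c k \<le> ((\<sigma>' - \<sigma>) / \<zeta>) * E" .
    have "a (Suc k) \<le> ((\<sigma>' - \<sigma>) / \<zeta>) * E + E / m" using a_step[of k] c b_m by linarith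
    also have "\<dots> = C * (\<sigma>' * E)" using arg_cong[OF C_mult, of "\<lambda>x. x * E"] by (simp add: algebra_simps)
    finally have 1: "a (Suc k) \<le> C * (\<sigma>' ^ Suc k * D)" by (simp add: E_def)
    have "b (Suc k) \<le> \<sigma> * E + \<zeta> * (((\<sigma>' - \<sigma>) / \<zeta>) * E)"
      using b_step[of k] mult_left_mono[OF IH(2) pos(4)] mult_left_mono[OF c, of \<zeta>] pos(2) by linarith
    also have "\<zeta> * (((\<sigma>' - \<sigma>) / \<zeta>) * E) = (\<sigma>' - \<sigma>) * E" using pos(2) by simp
    also have "\<sigma> * E + (\<sigma>' - \<sigma>) * E = \<sigma>' * E" by (simp add: algebra_simps)
    finally have "b (Suc k) \<le> \<sigma>' ^ Suc k * D" by (simp add: E_def)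
    with 1 show ?case by simp
  qed
  then show ?thesis using C by (simp add: field_simps)
qed

locale uzawa = discretization T j \<gamma> Xd Yd
  for T :: real and j :: "'v::{real_inner,banach} \<Rightarrow>\<^sub>L 'h::{real_inner,banach}"
    and \<gamma> :: "real \<Rightarrow> (real \<Rightarrow> 'v) \<Rightarrow> 'h" and Xd Yd :: "(real \<Rightarrow> 'v) set" +
  fixes A :: "real \<Rightarrow> 'v \<Rightarrow> 'v \<Rightarrow>\<^sub>L real" and L_A m_A :: real and f g :: "(real \<Rightarrow> 'v) \<Rightarrow> real"
  assumes A_wd: "A_well_defined T A" and L_A: "0 < L_A" and A_lip: "A_lipschitz T A L_A"
    and m_A: "0 < m_A" and A_mono: "A_strongly_monotone T A m_A"
    and Yd_nontrivial: "nontrivial (norm_L2 T) Yd"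
    and Xd_cases: "finite_dimensional (norm_X T j) Xd \<or> (Xd = space_X T j \<and> Yd = L2 T)"
    and f: "f \<in> dual_space (norm_L2 T) Yd" and g: "g \<in> dual_space (norm_Xd T j \<gamma> Yd) Xd"
begin

lemma Riesz_Xd:
  assumes "bounded_functional Xd fun_scale N_X F"
  obtains r where "r \<in> Xd" and "\<And>v. v \<in> Xd \<Longrightarrow> ip_X r v = F v"
  using Xd_cases
proof
  assume "finite_dimensional (norm_X T j) Xd"
  then show ?thesis using Riesz_Xd_finite_dimensional[OF _ assms] that by blast
next
  assume "Xd = space_X T j \<and> Yd = L2 T"
  then have "seminorm_complete N_X Xd" using space_X_complete by simp
  then show ?thesis using X.Riesz_complete[OF _ assms] that by blast
qed

lemma A_functional: "w \<in> L2 T \<Longrightarrow> bounded_functional (L2 T) fun_scale N_Y (A_op T A w)"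
  using A_wd unfolding A_well_defined_def dual_space_iff by blast

lemma A_functional_Yd:
  assumes "w \<in> L2 T" shows "bounded_functional Yd fun_scale N_Y (A_op T A w)"
  using A_functional[OF assms] Yd_L2 unfolding bounded_functional_def by blast

lemma A_functional_Xd:
  assumes "w \<in> L2 T" shows "bounded_functional Xd fun_scale N_X (A_op T A w)"
proof -
  note bf = A_functional[OF assms, unfolded bounded_functional_def]
  then obtain C where C: "\<And>v. v \<in> L2 T \<Longrightarrow> \<bar>A_op T A w v\<bar> \<le> C * N_Y v" by blast
  have "\<bar>A_op T A w v\<bar> \<le> \<bar>C\<bar> * N_X v" if v: "v \<in> Xd" for v
  proof -
    have "\<bar>A_op T A w v\<bar> \<le> C * N_Y v" by (rule C[OF Xd_L2[OF v]])
    also have "\<dots> \<le> \<bar>C\<bar> * N_Y v" by (intro mult_right_mono norm_L2_nonneg) simp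
    also have "\<dots> \<le> \<bar>C\<bar> * N_X v" by (intro mult_left_mono N_X_bounds Xd_space_X[OF v]) simp
    finally show ?thesis .
  qed
  then show ?thesis using bf Xd_L2 unfolding bounded_functional_def by blast
qed

lemma trace_functional: "bounded_functional Xd fun_scale N_X (\<lambda>z. h \<bullet> \<gamma> T z)"
  unfolding bounded_functional_def
proof (intro conjI ballI allI)
  have "\<bar>h \<bullet> \<gamma> T v\<bar> \<le> norm h * N_X v" if "v \<in> Xd" for v
    using Cauchy_Schwarz_ineq2[of h "\<gamma> T v"] mult_left_mono[OF N_X_bounds(3)[OF Xd_space_X[OF that]] norm_ge_zero[of h]]
    by linarith
  then show "\<exists>C. \<forall>v\<in>Xd. \<bar>h \<bullet> \<gamma> T v\<bar> \<le> C * N_X v" by blast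
qed (simp_all add: trace_add[OF T_pos trace] trace_scaleR[OF T_pos trace] Xd_space_X inner_add_right)

lemma dt_riesz_dt_bound:
  assumes "z \<in> space_X T j" "v \<in> Yd" shows "\<bar>dt T j z v\<bar> \<le> N_Y (riesz_dt z) * N_Y v"
  using Y.Cauchy_Schwarz[OF riesz_dt_mem[OF assms(1)] assms(2)] ip_riesz_dt[OF assms] by simp

lemma dt_N_X_bound:
  assumes "z \<in> Xd" "v \<in> Yd" shows "\<bar>dt T j z v\<bar> \<le> N_Y v * N_X z"
proof -
  have "N_Y (riesz_dt z) * N_Y v \<le> N_X z * N_Y v"
    by (intro mult_right_mono N_X_bounds Xd_space_X assms norm_L2_nonneg)
  then show ?thesis using dt_riesz_dt_bound[OF Xd_space_X[OF assms(1)] assms(2)] by (simp add: mult.commute)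
qed

lemma dt_functional_Xd:
  assumes "v \<in> Yd" shows "bounded_functional Xd fun_scale N_X (\<lambda>z. dt T j z v)"
  unfolding bounded_functional_def
proof (intro conjI ballI allI)
  show "\<exists>C. \<forall>z\<in>Xd. \<bar>dt T j z v\<bar> \<le> C * N_X z" using dt_N_X_bound[OF _ assms] by blast
qed (simp_all add: dt_add_left[OF T_pos] dt_scaleR_left[OF T_pos] Xd_space_X Yd_L2[OF assms])

lemma A_lipschitz_pairing:
  assumes w: "w \<in> L2 T" "w' \<in> L2 T" and v: "v \<in> L2 T"
  shows "\<bar>A_op T A w v - A_op T A w' v\<bar> \<le> L_A * N_Y (w - w') * N_Y v"
proof -
  interpret L: semi_inner_space "L2 T :: (real \<Rightarrow> 'v) set" fun_scale "ip_L2 T" N_Y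
    by (rule semi_inner_space_L2_UNIV)
  have "bounded_functional (L2 T) fun_scale N_Y (A_op T A w - A_op T A w')"
    using L.bounded_functional_diff[OF A_functional[OF w(1)] A_functional[OF w(2)]]
    by (simp add: fun_diff_def)
  then obtain r where r: "r \<in> L2 T" "\<And>v. v \<in> L2 T \<Longrightarrow> ip_L2 T r v = (A_op T A w - A_op T A w') v"
    using L.Riesz_complete[OF L2_complete] by blast
  have "\<bar>(A_op T A w - A_op T A w') v\<bar> \<le> dual_norm N_Y (L2 T) (A_op T A w - A_op T A w') * N_Y v"
    by (rule dual_norm_pairing[OF L.semi_inner_space_axioms r v])
  also have "\<dots> \<le> L_A * N_Y (w - w') * N_Y v"
    using A_lip w unfolding A_lipschitz_def by (intro mult_right_mono norm_L2_nonneg) blast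
  finally show ?thesis by simp
qed

lemma A_monotone_pairing:
  assumes "w \<in> L2 T" "w' \<in> L2 T"
  shows "m_A * (N_Y (w - w'))\<^sup>2 \<le> A_op T A w (w - w') - A_op T A w' (w - w')"
  using A_mono assms unfolding A_strongly_monotone_def by simp

text \<open>
  A nonzero element of \<open>Y\<^sup>\<delta>\<close> compares the two constants; the inequality makes \<open>\<sigma>_A\<close> the root of
  a nonnegative number.
\<close>

lemma m_A_le_L_A: "m_A \<le> L_A"
proof -
  obtain w where w: "w \<in> Yd" "N_Y w \<noteq> 0" using Yd_nontrivial unfolding nontrivial_def by blast
  then have pos: "0 < (N_Y w)\<^sup>2" by simp
  have wL: "w \<in> L2 T" by (rule Yd_L2[OF w(1)])
  have "m_A * (N_Y w)\<^sup>2 \<le> L_A * (N_Y w)\<^sup>2"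
    using A_monotone_pairing[OF wL L2_zero] A_lipschitz_pairing[OF wL L2_zero wL]
    by (simp add: power2_eq_square)
  then show ?thesis using pos by (simp add: mult_le_cancel_right)
qed

definition \<sigma>_A :: real where "\<sigma>_A = sqrt (1 - m_A\<^sup>2 / L_A\<^sup>2)"
definition \<zeta>_A :: real where "\<zeta>_A = m_A / L_A\<^sup>2"

lemma \<sigma>_A: "0 \<le> \<sigma>_A" "\<sigma>_A < 1" "\<sigma>_A\<^sup>2 = 1 - m_A\<^sup>2 / L_A\<^sup>2"
proof -
  have "m_A\<^sup>2 \<le> L_A\<^sup>2" using m_A_le_L_A m_A by (intro power_mono) auto
  then have "m_A\<^sup>2 / L_A\<^sup>2 \<le> 1" using L_A by simp
  then show "0 \<le> \<sigma>_A" "\<sigma>_A\<^sup>2 = 1 - m_A\<^sup>2 / L_A\<^sup>2" by (simp_all add: \<sigma>_A_def)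
  show "\<sigma>_A < 1" using m_A L_A by (simp add: \<sigma>_A_def)
qed

text \<open>
  Here \<open>r\<close> lifts the difference of two values of \<open>A\<close>. Applied to two iterates this makes the inner
  step a contraction, and applied to an iterate and an exact solution it is the error estimate.
\<close>

lemma relaxed_A_contraction:
  assumes \<theta>: "\<theta> \<in> Yd" "\<theta>' \<in> Yd" and r: "r \<in> Yd"
    and rep: "\<And>v. v \<in> Yd \<Longrightarrow> ip_L2 T r v = A_op T A \<theta> v - A_op T A \<theta>' v"
  shows "N_Y (\<theta> - \<theta>' - fun_scale \<zeta>_A r) \<le> \<sigma>_A * N_Y (\<theta> - \<theta>')"
proof (rule power2_le_imp_le)
  have e: "\<theta> - \<theta>' \<in> Yd" by (intro Y.diff_mem \<theta>)
  have "N_Y r \<le> L_A * N_Y (\<theta> - \<theta>')"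
    using A_lipschitz_pairing[OF Yd_L2[OF \<theta>(1)] Yd_L2[OF \<theta>(2)] Yd_L2] rep L_A
    by (intro Y.N_le_of_represents[OF r] mult_nonneg_nonneg norm_L2_nonneg) auto
  moreover have "m_A * (N_Y (\<theta> - \<theta>'))\<^sup>2 \<le> ip_L2 T r (\<theta> - \<theta>')"
    using A_monotone_pairing[OF Yd_L2[OF \<theta>(1)] Yd_L2[OF \<theta>(2)]] rep[OF e] by simp
  ultimately have "(N_Y (\<theta> - \<theta>' - fun_scale (m_A / L_A\<^sup>2) r))\<^sup>2 \<le> (1 - m_A\<^sup>2 / L_A\<^sup>2) * (N_Y (\<theta> - \<theta>'))\<^sup>2"
    using m_A by (intro Y.relaxation_step[OF e r L_A]) auto
  then show "(N_Y (\<theta> - \<theta>' - fun_scale \<zeta>_A r))\<^sup>2 \<le> (\<sigma>_A * N_Y (\<theta> - \<theta>'))\<^sup>2"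
    by (simp add: power_mult_distrib \<sigma>_A \<zeta>_A_def)
qed (simp add: \<sigma>_A norm_L2_nonneg)

definition solves_inner :: "(real \<Rightarrow> 'v) \<Rightarrow> (real \<Rightarrow> 'v) \<Rightarrow> bool" where
  "solves_inner u \<theta> \<longleftrightarrow> \<theta> \<in> Yd \<and> (\<forall>v\<in>Yd. A_op T A \<theta> v + dt T j u v = f v)"

definition residual :: "(real \<Rightarrow> 'v) \<Rightarrow> (real \<Rightarrow> 'v) \<Rightarrow> real \<Rightarrow> 'v" where
  "residual u \<theta> = riesz_inv N_Y Yd (\<lambda>v. A_op T A \<theta> v - (f v - dt T j u v))"

lemma
  assumes u: "u \<in> Xd" and \<theta>: "\<theta> \<in> Yd"
  shows residual_mem: "residual u \<theta> \<in> Yd"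
    and ip_residual: "v \<in> Yd \<Longrightarrow> ip_L2 T (residual u \<theta>) v = A_op T A \<theta> v - (f v - dt T j u v)"
proof -
  define F where "F v = A_op T A \<theta> v - (f v - dt T j u v)" for v
  have "bounded_functional Yd fun_scale N_Y F"
    unfolding F_def using f
    by (intro Y.bounded_functional_diff A_functional_Yd Yd_L2 \<theta> dt_bounded_functional Xd_space_X u)
      (simp add: dual_space_iff)
  then obtain r where r: "r \<in> Yd" "\<And>v. v \<in> Yd \<Longrightarrow> ip_L2 T r v = F v"
    using Y.Riesz_complete[OF Yd_complete] by blast
  note works = riesz_inv_works[where W = Yd and ip = "ip_L2 T" and N = N_Y and F = F and r = r,
      OF Y.semi_inner_space_axioms r]
  have "residual u \<theta> = riesz_inv N_Y Yd F" by (simp add: residual_def F_def[abs_def])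
  then show "residual u \<theta> \<in> Yd"
    and "v \<in> Yd \<Longrightarrow> ip_L2 T (residual u \<theta>) v = A_op T A \<theta> v - (f v - dt T j u v)"
    using works by (simp_all add: F_def)
qed

lemma inner_step_eq: "inner_step T j A Yd f \<zeta> u \<theta> = \<theta> - fun_scale \<zeta> (residual u \<theta>)"
  by (simp add: inner_step_def residual_def Let_def fun_diff_def)

lemma inner_step_mem:
  "u \<in> Xd \<Longrightarrow> \<theta> \<in> Yd \<Longrightarrow> inner_step T j A Yd f \<zeta> u \<theta> \<in> Yd"
  unfolding inner_step_eq by (intro Y.diff_mem Y.sc_mem residual_mem)

text \<open>
  Zarantonello's argument: a fixed point of the inner step has a residual of norm zero, so its
  residual functional vanishes on \<open>Y\<^sup>\<delta>\<close>.
\<close>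

lemma solves_inner_exists:
  assumes u: "u \<in> Xd" obtains \<theta> where "solves_inner u \<theta>"
proof -
  define \<Phi> where "\<Phi> = inner_step T j A Yd f \<zeta>_A u"
  have "N_Y (\<Phi> x - \<Phi> y) \<le> \<sigma>_A * N_Y (x - y)" if xy: "x \<in> Yd" "y \<in> Yd" for x y
  proof -
    have "\<Phi> x - \<Phi> y = x - y - fun_scale \<zeta>_A (residual u x - residual u y)"
      by (simp add: \<Phi>_def inner_step_eq fun_eq_iff algebra_simps)
    moreover have "N_Y (x - y - fun_scale \<zeta>_A (residual u x - residual u y)) \<le> \<sigma>_A * N_Y (x - y)"
      by (rule relaxed_A_contraction[OF xy Y.diff_mem[OF residual_mem[OF u xy(1)] residual_mem[OF u xy(2)]]])
        (simp add: Y.ip_diff_left residual_mem ip_residual u xy)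
    ultimately show ?thesis by simp
  qed
  then obtain \<theta> where \<theta>: "\<theta> \<in> Yd" and fixed: "N_Y (\<Phi> \<theta> - \<theta>) = 0"
    using Y.contraction_fixed_point[OF Yd_complete _ \<sigma>_A(1,2)] inner_step_mem[OF u]
    unfolding \<Phi>_def by metis
  have "\<Phi> \<theta> - \<theta> = fun_scale (- \<zeta>_A) (residual u \<theta>)"
    by (simp add: \<Phi>_def inner_step_eq fun_eq_iff)
  then have "\<bar>\<zeta>_A\<bar> * N_Y (residual u \<theta>) = 0"
    using fixed by (simp only: norm_L2_scaleR abs_minus_cancel)
  then have "N_Y (residual u \<theta>) = 0" using m_A L_A by (simp add: \<zeta>_A_def)
  then have "ip_L2 T (residual u \<theta>) v = 0" if "v \<in> Yd" for v
    using Y.Cauchy_Schwarz[OF residual_mem[OF u \<theta>] that] by simp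
  then have "solves_inner u \<theta>"
    using ip_residual[OF u \<theta>] \<theta> by (simp add: solves_inner_def)
  then show ?thesis by (rule that)
qed

lemma inner_iteration_error:
  assumes u: "u \<in> Xd" and sol: "solves_inner u \<theta>s" and \<theta>: "\<theta> \<in> Yd"
  shows "(inner_step T j A Yd f \<zeta>_A u ^^ n) \<theta> \<in> Yd \<and>
    N_Y ((inner_step T j A Yd f \<zeta>_A u ^^ n) \<theta> - \<theta>s) \<le> \<sigma>_A ^ n * N_Y (\<theta> - \<theta>s)"
proof (induction n)
  case 0
  then show ?case using \<theta> by simp
next
  case (Suc n)
  define x where "x = (inner_step T j A Yd f \<zeta>_A u ^^ n) \<theta>"
  have x: "x \<in> Yd" and IH: "N_Y (x - \<theta>s) \<le> \<sigma>_A ^ n * N_Y (\<theta> - \<theta>s)"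
    using Suc unfolding x_def by blast+
  have \<theta>s: "\<theta>s \<in> Yd" using sol by (simp add: solves_inner_def)
  have "N_Y (x - \<theta>s - fun_scale \<zeta>_A (residual u x)) \<le> \<sigma>_A * N_Y (x - \<theta>s)"
  proof (rule relaxed_A_contraction[OF x \<theta>s residual_mem[OF u x]])
    fix v assume v: "v \<in> Yd"
    have "A_op T A \<theta>s v + dt T j u v = f v" using sol v by (simp add: solves_inner_def)
    then show "ip_L2 T (residual u x) v = A_op T A x v - A_op T A \<theta>s v"
      using ip_residual[OF u x v] by simp
  qed
  moreover have "inner_step T j A Yd f \<zeta>_A u x - \<theta>s = x - \<theta>s - fun_scale \<zeta>_A (residual u x)"
    by (simp add: inner_step_eq fun_eq_iff)
  ultimately have "N_Y (inner_step T j A Yd f \<zeta>_A u x - \<theta>s) \<le> \<sigma>_A * N_Y (x - \<theta>s)" by (simp only:)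
  also have "\<dots> \<le> \<sigma>_A * (\<sigma>_A ^ n * N_Y (\<theta> - \<theta>s))" using IH \<sigma>_A(1) by (rule mult_left_mono)
  also have "\<dots> = \<sigma>_A ^ Suc n * N_Y (\<theta> - \<theta>s)" by simp
  finally show ?case
    unfolding funpow.simps o_apply x_def[symmetric] using inner_step_mem[OF u x] by blast
qed

lemma solves_inner_difference:
  assumes u: "u \<in> Xd" "u' \<in> Xd" and sol: "solves_inner u \<theta>" "solves_inner u' \<theta>'" and v: "v \<in> Yd"
  shows "dt T j (u - u') v = - (A_op T A \<theta> v - A_op T A \<theta>' v)"
proof -
  have "dt T j ((u - u') + u') v = dt T j (u - u') v + dt T j u' v"
    by (intro dt_add_left T_pos Xd_space_X X.diff_mem u Yd_L2 v)
  moreover have "A_op T A \<theta> v + dt T j u v = f v" "A_op T A \<theta>' v + dt T j u' v = f v"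
    using sol v by (simp_all add: solves_inner_def)
  ultimately show ?thesis by simp
qed

text \<open>
  Both bounds compare \<open>\<theta> - \<theta>'\<close> with the dual norm of the time derivative of \<open>u - u'\<close>: the first
  by strong monotonicity, the second by Lipschitz continuity of \<open>A\<close>.
\<close>

lemma solves_inner_stability:
  assumes u: "u \<in> Xd" "u' \<in> Xd" and sol: "solves_inner u \<theta>" "solves_inner u' \<theta>'"
  shows "N_Y (\<theta> - \<theta>') \<le> N_Y (riesz_dt (u - u')) / m_A" and "N_Y (riesz_dt (u - u')) \<le> L_A * N_Y (\<theta> - \<theta>')"
proof -
  have \<theta>: "\<theta> \<in> Yd" "\<theta>' \<in> Yd" using sol by (simp_all add: solves_inner_def)
  have e: "\<theta> - \<theta>' \<in> Yd" by (intro Y.diff_mem \<theta>)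
  have du: "u - u' \<in> space_X T j" by (intro Xd_space_X X.diff_mem u)
  have "m_A * (N_Y (\<theta> - \<theta>'))\<^sup>2 \<le> - dt T j (u - u') (\<theta> - \<theta>')"
    using A_monotone_pairing[OF Yd_L2[OF \<theta>(1)] Yd_L2[OF \<theta>(2)]] solves_inner_difference[OF u sol e] by simp
  also have "\<dots> \<le> N_Y (riesz_dt (u - u')) * N_Y (\<theta> - \<theta>')" using dt_riesz_dt_bound[OF du e] by simp
  finally have "(m_A * N_Y (\<theta> - \<theta>')) * N_Y (\<theta> - \<theta>') \<le> N_Y (riesz_dt (u - u')) * N_Y (\<theta> - \<theta>')"
    by (simp add: power2_eq_square)
  then have "m_A * N_Y (\<theta> - \<theta>') \<le> N_Y (riesz_dt (u - u'))"
    using norm_L2_nonneg[of T "\<theta> - \<theta>'"] norm_L2_nonneg[of T "riesz_dt (u - u')"]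
    by (cases "N_Y (\<theta> - \<theta>') = 0") (auto simp: mult_le_cancel_right)
  then show "N_Y (\<theta> - \<theta>') \<le> N_Y (riesz_dt (u - u')) / m_A" using m_A by (simp add: field_simps)
  show "N_Y (riesz_dt (u - u')) \<le> L_A * N_Y (\<theta> - \<theta>')"
  proof (rule Y.N_le_of_represents[OF riesz_dt_mem[OF du]])
    show "0 \<le> L_A * N_Y (\<theta> - \<theta>')" using L_A by (intro mult_nonneg_nonneg norm_L2_nonneg) simp
    show "\<bar>ip_L2 T (riesz_dt (u - u')) v\<bar> \<le> L_A * N_Y (\<theta> - \<theta>') * N_Y v" if v: "v \<in> Yd" for v
      using A_lipschitz_pairing[OF Yd_L2[OF \<theta>(1)] Yd_L2[OF \<theta>(2)] Yd_L2[OF v]]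
        solves_inner_difference[OF u sol v] ip_riesz_dt[OF du v] by simp
  qed
qed

definition L_S :: real where "L_S = max 1 (max L_A (1 / m_A))"
definition m_S :: real where "m_S = min 1 (min m_A (m_A / L_A\<^sup>2))"
definition \<zeta>_S :: real where "\<zeta>_S = m_S / L_S\<^sup>2"
definition \<sigma>_S :: real where "\<sigma>_S = sqrt (1 - m_S\<^sup>2 / L_S\<^sup>2)"

lemma S_constants: "1 \<le> L_S" "L_A \<le> L_S" "1 / m_A \<le> L_S" "m_S \<le> 1" "m_S \<le> m_A" "m_S \<le> m_A / L_A\<^sup>2" "0 < m_S"
  using m_A L_A by (auto simp: L_S_def m_S_def)

lemma \<sigma>_S: "0 \<le> \<sigma>_S" "\<sigma>_S\<^sup>2 = 1 - m_S\<^sup>2 / L_S\<^sup>2"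
proof -
  have "m_S\<^sup>2 \<le> L_S\<^sup>2" using S_constants by (intro power_mono) auto
  then have "m_S\<^sup>2 / L_S\<^sup>2 \<le> 1" using S_constants by (simp add: divide_le_eq)
  then show "0 \<le> \<sigma>_S" "\<sigma>_S\<^sup>2 = 1 - m_S\<^sup>2 / L_S\<^sup>2" by (simp_all add: \<sigma>_S_def)
qed

text \<open>
  Eliminating the first component leaves the Schur complement, an operator on \<open>X\<^sup>\<delta>\<close> whose
  increment from \<open>u'\<close> to \<open>u\<close> is the right-hand side of the assumption on \<open>r\<close>. Its three terms
  match the three terms of the norm of \<open>X\<^sup>\<delta>\<close>. By \<open>solves_inner_stability\<close> the last one behaves like
  the squared dual norm of the time derivative, with constant \<open>1 / m_A\<close> from above and
  \<open>m_A / L_A\<^sup>2\<close> from below; this is the origin of the constants \<open>L_S\<close> and \<open>m_S\<close>.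
\<close>

lemma relaxed_Schur_contraction:
  assumes u: "u \<in> Xd" "u' \<in> Xd" and sol: "solves_inner u \<theta>" "solves_inner u' \<theta>'" and r: "r \<in> Xd"
    and rep: "\<And>z. z \<in> Xd \<Longrightarrow> ip_X r z = (A_op T A u z - A_op T A u' z) + \<gamma> T (u - u') \<bullet> \<gamma> T z - dt T j z (\<theta> - \<theta>')"
  shows "N_X (u - u' - fun_scale \<zeta>_S r) \<le> \<sigma>_S * N_X (u - u')"
proof (rule power2_le_imp_le)
  define e where "e = u - u'"
  define v where "v = \<theta> - \<theta>'"
  have e: "e \<in> Xd" unfolding e_def by (intro X.diff_mem u)
  have eX: "e \<in> space_X T j" by (rule Xd_space_X[OF e])
  have \<theta>: "\<theta> \<in> Yd" "\<theta>' \<in> Yd" using sol by (simp_all add: solves_inner_def)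
  have v: "v \<in> Yd" unfolding v_def by (intro Y.diff_mem \<theta>)
  have nonneg: "0 \<le> N_Y w" for w by (rule norm_L2_nonneg)
  have "N_X r \<le> L_S * N_X e"
  proof (rule X.N_le_of_represents[OF r])
    show "0 \<le> L_S * N_X e" using S_constants N_X_nonneg by simp
    fix z assume z: "z \<in> Xd"
    have zX: "z \<in> space_X T j" by (rule Xd_space_X[OF z])
    have "\<bar>A_op T A u z - A_op T A u' z\<bar> \<le> L_A * (N_Y e * N_Y z)"
      using A_lipschitz_pairing[OF Xd_L2[OF u(1)] Xd_L2[OF u(2)] Xd_L2[OF z]] by (simp add: e_def mult_ac)
    also have "\<dots> \<le> L_S * (N_Y e * N_Y z)"
      using S_constants nonneg by (intro mult_right_mono) auto
    finally have 1: "\<bar>A_op T A u z - A_op T A u' z\<bar> \<le> L_S * (N_Y e * N_Y z)" .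
    have "\<bar>\<gamma> T e \<bullet> \<gamma> T z\<bar> \<le> 1 * (norm (\<gamma> T e) * norm (\<gamma> T z))" using Cauchy_Schwarz_ineq2 by simp
    also have "\<dots> \<le> L_S * (norm (\<gamma> T e) * norm (\<gamma> T z))"
      using S_constants by (intro mult_right_mono) auto
    finally have 2: "\<bar>\<gamma> T e \<bullet> \<gamma> T z\<bar> \<le> L_S * (norm (\<gamma> T e) * norm (\<gamma> T z))" .
    have "\<bar>dt T j z v\<bar> \<le> N_Y (riesz_dt z) * N_Y v" by (rule dt_riesz_dt_bound[OF zX v])
    also have "\<dots> \<le> N_Y (riesz_dt z) * (N_Y (riesz_dt e) / m_A)"
      using solves_inner_stability(1)[OF u sol] nonneg by (intro mult_left_mono) (auto simp: e_def v_def)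
    also have "\<dots> = (1 / m_A) * (N_Y (riesz_dt e) * N_Y (riesz_dt z))" by simp
    also have "\<dots> \<le> L_S * (N_Y (riesz_dt e) * N_Y (riesz_dt z))"
      using S_constants nonneg by (intro mult_right_mono) auto
    finally have 3: "\<bar>dt T j z v\<bar> \<le> L_S * (N_Y (riesz_dt e) * N_Y (riesz_dt z))" .
    have "\<bar>ip_X r z\<bar> \<le> L_S * (N_Y e * N_Y z + N_Y (riesz_dt e) * N_Y (riesz_dt z) + norm (\<gamma> T e) * norm (\<gamma> T z))"
      using 1 2 3 rep[OF z] unfolding distrib_left by (simp add: e_def v_def)
    also have "\<dots> \<le> L_S * (N_X e * N_X z)"
    proof (rule mult_left_mono)
      have "N_X e = sqrt ((N_Y e)\<^sup>2 + (N_Y (riesz_dt e))\<^sup>2 + (norm (\<gamma> T e))\<^sup>2)"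
        "N_X z = sqrt ((N_Y z)\<^sup>2 + (N_Y (riesz_dt z))\<^sup>2 + (norm (\<gamma> T z))\<^sup>2)"
        by (simp_all add: norm_Xd_def dual_norm_dt eX zX)
      then show "N_Y e * N_Y z + N_Y (riesz_dt e) * N_Y (riesz_dt z) + norm (\<gamma> T e) * norm (\<gamma> T z) \<le> N_X e * N_X z"
        using Cauchy_Schwarz_3 by simp
    qed (use S_constants in simp)
    finally show "\<bar>ip_X r z\<bar> \<le> L_S * N_X e * N_X z" by (simp add: mult.assoc)
  qed
  moreover have "m_S * (N_X e)\<^sup>2 \<le> ip_X r e"
  proof -
    have "m_S * (N_Y e)\<^sup>2 \<le> m_A * (N_Y e)\<^sup>2" using S_constants by (intro mult_right_mono) auto
    also have "\<dots> \<le> A_op T A u e - A_op T A u' e"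
      unfolding e_def by (rule A_monotone_pairing[OF Xd_L2[OF u(1)] Xd_L2[OF u(2)]])
    finally have 1: "m_S * (N_Y e)\<^sup>2 \<le> A_op T A u e - A_op T A u' e" .
    have 2: "m_S * (norm (\<gamma> T e))\<^sup>2 \<le> \<gamma> T e \<bullet> \<gamma> T e"
      using S_constants mult_right_mono[of m_S 1 "(norm (\<gamma> T e))\<^sup>2"] by (simp add: power2_norm_eq_inner)
    have "(N_Y (riesz_dt e))\<^sup>2 \<le> (L_A * N_Y v)\<^sup>2"
      using solves_inner_stability(2)[OF u sol] nonneg by (intro power_mono) (auto simp: e_def v_def)
    then have "m_S * (N_Y (riesz_dt e))\<^sup>2 \<le> (m_A / L_A\<^sup>2) * (L_A * N_Y v)\<^sup>2"
      using S_constants m_A L_A by (intro mult_mono) auto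
    also have "\<dots> = m_A * (N_Y v)\<^sup>2" using L_A by (simp add: power_mult_distrib)
    also have "\<dots> \<le> - dt T j e v"
      using A_monotone_pairing[OF Yd_L2[OF \<theta>(1)] Yd_L2[OF \<theta>(2)]] solves_inner_difference[OF u sol v]
      by (simp add: e_def v_def)
    finally have 3: "m_S * (N_Y (riesz_dt e))\<^sup>2 \<le> - dt T j e v" .
    have "m_S * (N_X e)\<^sup>2 = m_S * (N_Y e)\<^sup>2 + m_S * (N_Y (riesz_dt e))\<^sup>2 + m_S * (norm (\<gamma> T e))\<^sup>2"
      by (simp add: N_X_square[OF eX] distrib_left)
    then show ?thesis using 1 2 3 rep[OF e] by (simp add: e_def v_def)
  qed
  moreover have "0 < L_S" using S_constants by simp
  ultimately have "(N_X (e - fun_scale (m_S / L_S\<^sup>2) r))\<^sup>2 \<le> (1 - m_S\<^sup>2 / L_S\<^sup>2) * (N_X e)\<^sup>2"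
    using S_constants by (intro X.relaxation_step[OF e r]) auto
  then show "(N_X (u - u' - fun_scale \<zeta>_S r))\<^sup>2 \<le> (\<sigma>_S * N_X (u - u'))\<^sup>2"
    by (simp add: power_mult_distrib \<sigma>_S \<zeta>_S_def e_def)
qed (simp add: \<sigma>_S N_X_nonneg)

text \<open>
  The outer step with an inexact \<open>\<theta>\<close> is a relaxation step for the Schur complement, plus a
  perturbation linear in \<open>\<theta> - \<theta>u\<close>. The latter enters with factor 1, because the norm of \<open>X\<^sup>\<delta>\<close>
  contains the dual norm of the time derivative.
\<close>

lemma outer_step_error:
  assumes sol: "is_solution T j A \<gamma> Yd Xd f g \<theta>d ud"
    and u: "u \<in> Xd" and \<theta>u: "solves_inner u \<theta>u" and \<theta>: "\<theta> \<in> Yd"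
  shows "outer_step T j A \<gamma> Yd Xd g \<zeta>_S \<theta> u \<in> Xd"
    and "N_X (outer_step T j A \<gamma> Yd Xd g \<zeta>_S \<theta> u - ud) \<le> \<sigma>_S * N_X (u - ud) + \<zeta>_S * N_Y (\<theta> - \<theta>u)"
proof -
  have ud: "ud \<in> Xd" and \<theta>d: "solves_inner ud \<theta>d"
    and g_eq: "\<And>z. z \<in> Xd \<Longrightarrow> g z = dt T j z \<theta>d - (A_op T A ud z + \<gamma> T ud \<bullet> \<gamma> T z)"
    using sol by (auto simp: is_solution_def N_op_def solves_inner_def)
  have mem: "\<theta>u \<in> Yd" "\<theta>d \<in> Yd" using \<theta>u \<theta>d by (simp_all add: solves_inner_def)
  define F where "F z = A_op T A u z + \<gamma> T u \<bullet> \<gamma> T z + g z - dt T j z \<theta>" for z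
  have "bounded_functional Xd fun_scale N_X F"
    unfolding F_def using g
    by (intro X.bounded_functional_diff X.bounded_functional_add A_functional_Xd Xd_L2 u trace_functional
        dt_functional_Xd \<theta>) (simp add: dual_space_iff)
  then obtain r' where r': "r' \<in> Xd" "\<And>z. z \<in> Xd \<Longrightarrow> ip_X r' z = F z" using Riesz_Xd by metis
  note works = riesz_inv_works[where W = Xd and ip = ip_X and N = N_X and F = F and r = r',
      OF X.semi_inner_space_axioms r']
  define r where "r = riesz_inv N_X Xd F"
  have r: "r \<in> Xd" unfolding r_def by (rule works(1))
  have ip_r: "ip_X r z = F z" if "z \<in> Xd" for z 
    unfolding r_def by (rule works(2)[OF _ that])
  have step: "outer_step T j A \<gamma> Yd Xd g \<zeta>_S \<theta> u = u - fun_scale \<zeta>_S r"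
    by (simp add: outer_step_def r_def F_def[abs_def] Let_def fun_diff_def)
  then show "outer_step T j A \<gamma> Yd Xd g \<zeta>_S \<theta> u \<in> Xd" by (simp add: X.mem u r)
  \<comment> \<open>the increment of the Schur complement from \<open>ud\<close>, at which it vanishes, to \<open>u\<close>\<close>
  define D where "D z = (A_op T A u z - A_op T A ud z) + \<gamma> T (u - ud) \<bullet> \<gamma> T z - dt T j z (\<theta>u - \<theta>d)" for z
  have "bounded_functional Xd fun_scale N_X D"
    unfolding D_def
    by (intro X.bounded_functional_diff X.bounded_functional_add A_functional_Xd Xd_L2 u ud trace_functional
        dt_functional_Xd Y.diff_mem mem)
  then obtain s where s: "s \<in> Xd" and ip_s: "\<And>z. z \<in> Xd \<Longrightarrow> ip_X s z = D z" by (metis Riesz_Xd)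
  have main: "N_X (u - ud - fun_scale \<zeta>_S s) \<le> \<sigma>_S * N_X (u - ud)"
    by (rule relaxed_Schur_contraction[OF u ud \<theta>u \<theta>d s]) (simp add: ip_s D_def)
  have "N_X (r - s) \<le> N_Y (\<theta>u - \<theta>)"
  proof (rule X.N_le_of_represents)
    show "r - s \<in> Xd" by (intro X.diff_mem r s)
    fix z assume z: "z \<in> Xd"
    have dt_diff: "dt T j z (x - y) = dt T j z x - dt T j z y" if "x \<in> Yd" "y \<in> Yd" for x y
      using Y.functional_diff[OF dt_bounded_functional[OF Xd_space_X[OF z]] that] .
    have "ip_X (r - s) z = dt T j z (\<theta>u - \<theta>)"
      using mem \<theta> z by (simp add: X.ip_diff_left r s ip_r ip_s F_def D_def g_eq dt_diff
          trace_diff[OF T_pos trace Xd_space_X[OF u] Xd_space_X[OF ud]] inner_diff_left)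
    then show "\<bar>ip_X (r - s) z\<bar> \<le> N_Y (\<theta>u - \<theta>) * N_X z"
      using dt_N_X_bound[OF z Y.diff_mem[OF mem(1) \<theta>]] by simp
  qed (rule norm_L2_nonneg)
  then have perturbation: "N_X (fun_scale \<zeta>_S (s - r)) \<le> \<zeta>_S * N_Y (\<theta> - \<theta>u)"
  proof -
    have "0 \<le> \<zeta>_S" using S_constants by (simp add: \<zeta>_S_def)
    moreover have "N_X (s - r) \<le> N_Y (\<theta> - \<theta>u)"
      using \<open>N_X (r - s) \<le> N_Y (\<theta>u - \<theta>)\<close>
      unfolding X.N_minus_commute[OF s r] norm_L2_minus_commute[of T \<theta>] .
    ultimately show ?thesis
      unfolding X.N_sc[OF X.diff_mem[OF s r]] by (simp add: mult_left_mono)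
  qed
  have split: "outer_step T j A \<gamma> Yd Xd g \<zeta>_S \<theta> u - ud = (u - ud - fun_scale \<zeta>_S s) + fun_scale \<zeta>_S (s - r)"
    unfolding step by (simp add: fun_eq_iff algebra_simps)
  have "N_X ((u - ud - fun_scale \<zeta>_S s) + fun_scale \<zeta>_S (s - r))
      \<le> N_X (u - ud - fun_scale \<zeta>_S s) + N_X (fun_scale \<zeta>_S (s - r))"
    by (rule X.N_triangle[OF X.diff_mem[OF X.diff_mem[OF u ud] X.sc_mem[OF s]] X.sc_mem[OF X.diff_mem[OF s r]]])
  then show "N_X (outer_step T j A \<gamma> Yd Xd g \<zeta>_S \<theta> u - ud) \<le> \<sigma>_S * N_X (u - ud) + \<zeta>_S * N_Y (\<theta> - \<theta>u)"
    unfolding split using main perturbation by linarith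
qed

end

text \<open>
  It remains to feed the error estimates of both iterations into the recursion, comparing the
  inner iterates with the exact inner solutions \<open>\<theta>u k\<close> that belong to the outer iterates.
\<close>

theorem theorem7p2:
  fixes j :: "'v::{real_inner,banach} \<Rightarrow>\<^sub>L 'h::{real_inner,banach}"
    and T L_A m_A L_S m_S \<zeta>S \<sigma>S \<zeta>A \<sigma>A \<sigma>hat C3 C4 :: real
    and A :: "real \<Rightarrow> 'v \<Rightarrow> 'v \<Rightarrow>\<^sub>L real"
    and \<gamma> :: "real \<Rightarrow> (real \<Rightarrow> 'v) \<Rightarrow> 'h"
    and Xd Yd :: "(real \<Rightarrow> 'v) set"
    and f g :: "(real \<Rightarrow> 'v) \<Rightarrow> real"
    and \<theta>d ud :: "real \<Rightarrow> 'v"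
    and \<theta> u :: "nat \<Rightarrow> real \<Rightarrow> 'v"
    and L :: nat
  assumes "gelfand_triple j" and "0 < T" and "is_trace T j \<gamma>"
    and "A_well_defined T A"
    and "0 < L_A" and "A_lipschitz T A L_A"
    and "0 < m_A" and "A_strongly_monotone T A m_A"
    and "closed_linear_subspace (norm_X T j) (space_X T j) Xd" and "nontrivial (norm_X T j) Xd"
    and "closed_linear_subspace (norm_L2 T) (L2 T) Yd" and "nontrivial (norm_L2 T) Yd"
    and "(finite_dimensional (norm_X T j) Xd \<and> finite_dimensional (norm_L2 T) Yd) \<or>
         (Xd = space_X T j \<and> Yd = L2 T)"
    and "f \<in> dual_space (norm_L2 T) Yd" and "g \<in> dual_space (norm_Xd T j \<gamma> Yd) Xd"
    and "is_solution T j A \<gamma> Yd Xd f g \<theta>d ud"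
    and "L_S = max 1 (max L_A (1 / m_A))" and "m_S = min 1 (min m_A (m_A / L_A\<^sup>2))"
    and "\<zeta>S = m_S / L_S\<^sup>2" and "\<sigma>S = sqrt (1 - m_S\<^sup>2 / L_S\<^sup>2)"
    and "\<zeta>A = m_A / L_A\<^sup>2" and "\<sigma>A = sqrt (1 - m_A\<^sup>2 / L_A\<^sup>2)"
    and "\<theta> 0 \<in> Yd" and "u 0 \<in> Xd"
    and "\<And>k. (\<theta> k, u k) = inexact_uzawa T j A \<gamma> Yd Xd f g \<zeta>A \<zeta>S L (\<theta> 0, u 0) k"
    and "\<sigma>S < \<sigma>hat" and "\<sigma>hat < 1"
    and "C3 = (1 / \<sigma>hat) * ((\<sigma>hat - \<sigma>S) / \<zeta>S + 1 / m_A)"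
    and "\<sigma>A ^ L * (C3 + 1 / m_A) \<le> (\<sigma>hat - \<sigma>S) / \<zeta>S"
    and "C4 = max ((1 / C3) * norm_L2 T (\<theta>d - \<theta> 0)) (norm_Xd T j \<gamma> Yd (ud - u 0))"
  shows "\<forall>k. (1 / C3) * norm_L2 T (\<theta>d - \<theta> k) \<le> \<sigma>hat ^ k * C4 \<and>
             norm_Xd T j \<gamma> Yd (ud - u k) \<le> \<sigma>hat ^ k * C4"
proof
  fix k
  have Xd_cases: "finite_dimensional (norm_X T j) Xd \<or> (Xd = space_X T j \<and> Yd = L2 T)"
    using assms(13) by blast
  interpret U: uzawa T j \<gamma> Xd Yd A L_A m_A f g
    by unfold_locales (fact assms Xd_cases)+
  have const_eqs: "\<zeta>S = U.\<zeta>_S" "\<sigma>S = U.\<sigma>_S" "\<zeta>A = U.\<zeta>_A" "\<sigma>A = U.\<sigma>_A"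
    by (simp_all add: assms U.\<zeta>_S_def U.\<sigma>_S_def U.m_S_def U.L_S_def U.\<zeta>_A_def U.\<sigma>_A_def)
  have sol: "is_solution T j A \<gamma> Yd Xd f g \<theta>d ud" by (fact assms)
  have ud: "ud \<in> Xd" and \<theta>d: "U.solves_inner ud \<theta>d"
    using sol by (auto simp: is_solution_def N_op_def U.solves_inner_def)
  have \<theta>_step: "\<theta> (Suc k) = (inner_step T j A Yd f U.\<zeta>_A (u k) ^^ L) (\<theta> k)"
    and u_step: "u (Suc k) = outer_step T j A \<gamma> Yd Xd g U.\<zeta>_S (\<theta> (Suc k)) (u k)" for k
  proof -
    have "(\<theta> (Suc k), u (Suc k)) =
       (let (\<theta>, u) = (\<theta> k, u k); \<theta>' = (inner_step T j A Yd f \<zeta>A u ^^ L) \<theta>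
        in (\<theta>', outer_step T j A \<gamma> Yd Xd g \<zeta>S \<theta>' u))"
      unfolding assms(25)[of k] assms(25)[of "Suc k"] by simp
    then show "\<theta> (Suc k) = (inner_step T j A Yd f U.\<zeta>_A (u k) ^^ L) (\<theta> k)"
      "u (Suc k) = outer_step T j A \<gamma> Yd Xd g U.\<zeta>_S (\<theta> (Suc k)) (u k)"
      by (simp_all add: Let_def const_eqs)
  qed
  have mem: "\<theta> k \<in> Yd \<and> u k \<in> Xd" for k
  proof (induction k)
    case 0
    show ?case using assms by blast
  next
    case (Suc k)
    obtain \<theta>u where \<theta>u: "U.solves_inner (u k) \<theta>u" using U.solves_inner_exists Suc by blast
    have \<theta>_mem: "\<theta> (Suc k) \<in> Yd"
      unfolding \<theta>_step using U.inner_iteration_error[OF _ \<theta>u] Suc by blast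
    have "u (Suc k) \<in> Xd"
      unfolding u_step using U.outer_step_error(1)[OF sol _ \<theta>u \<theta>_mem] Suc by blast
    with \<theta>_mem show ?case by blast
  qed
  have "\<exists>\<theta>'. U.solves_inner (u k) \<theta>'" for k
    using U.solves_inner_exists[of "u k"] mem by blast
  then have "\<exists>\<theta>u. \<forall>k. U.solves_inner (u k) (\<theta>u k)"
    by (intro choice allI)
  then obtain \<theta>u where \<theta>u: "\<And>k. U.solves_inner (u k) (\<theta>u k)" by blast
  have \<theta>u_mem: "\<theta>u k \<in> Yd" and \<theta>d_mem: "\<theta>d \<in> Yd" for k
    using \<theta>u \<theta>d by (simp_all add: U.solves_inner_def)
  have drift: "norm_L2 T (\<theta>u k - \<theta>d) \<le> norm_Xd T j \<gamma> Yd (u k - ud) / m_A" for k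
  proof -
    have uk: "u k \<in> Xd" using mem by blast
    have "norm_L2 T (U.riesz_dt (u k - ud)) / m_A \<le> norm_Xd T j \<gamma> Yd (u k - ud) / m_A"
      using \<open>0 < m_A\<close> by (intro divide_right_mono U.N_X_bounds U.Xd_space_X U.X.diff_mem uk ud) simp
    then show ?thesis using U.solves_inner_stability(1)[OF uk ud \<theta>u \<theta>d] by linarith
  qed
  have "(1 / C3) * norm_L2 T (\<theta> k - \<theta>d) \<le> \<sigma>hat ^ k * C4 \<and> norm_Xd T j \<gamma> Yd (u k - ud) \<le> \<sigma>hat ^ k * C4"
  proof (rule two_level_linear_convergence[where c = "\<lambda>k. norm_L2 T (\<theta> (Suc k) - \<theta>u k)"])
    show "0 < m_A" "0 \<le> \<sigma>A ^ L" "0 < \<zeta>S" "0 \<le> \<sigma>S" "\<sigma>S < \<sigma>hat"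
      using \<open>0 < m_A\<close> \<open>\<sigma>S < \<sigma>hat\<close> U.\<sigma>_A(1) U.\<sigma>_S(1) U.S_constants(1,7)
      unfolding const_eqs by (simp_all add: U.\<zeta>_S_def)
    show "norm_L2 T (\<theta> (Suc k) - \<theta>u k) \<le>
       \<sigma>A ^ L * (norm_L2 T (\<theta> k - \<theta>d) + norm_Xd T j \<gamma> Yd (u k - ud) / m_A)" for k
    proof -
      have "norm_L2 T (\<theta> (Suc k) - \<theta>u k) \<le> \<sigma>A ^ L * norm_L2 T (\<theta> k - \<theta>u k)"
        unfolding \<theta>_step const_eqs using U.inner_iteration_error[OF _ \<theta>u] mem by blast
      also have "\<dots> \<le> \<sigma>A ^ L * (norm_L2 T (\<theta> k - \<theta>d) + norm_Xd T j \<gamma> Yd (u k - ud) / m_A)"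
      proof (rule mult_left_mono)
        have "norm_L2 T (\<theta> k - \<theta>u k) \<le> norm_L2 T (\<theta> k - \<theta>d) + norm_L2 T (\<theta>d - \<theta>u k)"
          using U.Y.N_diff_triangle mem \<theta>u_mem \<theta>d_mem by blast
        then show "norm_L2 T (\<theta> k - \<theta>u k) \<le> norm_L2 T (\<theta> k - \<theta>d) + norm_Xd T j \<gamma> Yd (u k - ud) / m_A"
          using drift[of k] norm_L2_minus_commute[of T \<theta>d "\<theta>u k"] by linarith
      qed (simp add: const_eqs U.\<sigma>_A)
      finally show ?thesis .
    qed
    show "norm_L2 T (\<theta> (Suc k) - \<theta>d) \<le> norm_L2 T (\<theta> (Suc k) - \<theta>u k) + norm_Xd T j \<gamma> Yd (u k - ud) / m_A" for k
    proof -
      have "norm_L2 T (\<theta> (Suc k) - \<theta>d) \<le> norm_L2 T (\<theta> (Suc k) - \<theta>u k) + norm_L2 T (\<theta>u k - \<theta>d)"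
        using U.Y.N_diff_triangle mem \<theta>u_mem \<theta>d_mem by blast
      then show ?thesis using drift[of k] by linarith
    qed
    show "norm_Xd T j \<gamma> Yd (u (Suc k) - ud)
        \<le> \<sigma>S * norm_Xd T j \<gamma> Yd (u k - ud) + \<zeta>S * norm_L2 T (\<theta> (Suc k) - \<theta>u k)" for k
      unfolding u_step const_eqs using U.outer_step_error(2)[OF sol _ \<theta>u] mem by blast
    show "0 \<le> norm_Xd T j \<gamma> Yd (u k - ud)" for k by (rule U.N_X_nonneg)
    show "C3 = (1 / \<sigma>hat) * ((\<sigma>hat - \<sigma>S) / \<zeta>S + 1 / m_A)"
      "\<sigma>A ^ L * (C3 + 1 / m_A) \<le> (\<sigma>hat - \<sigma>S) / \<zeta>S" by (fact assms)+
    have "norm_Xd T j \<gamma> Yd (ud - u 0) = norm_Xd T j \<gamma> Yd (u 0 - ud)"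
      using U.X.N_minus_commute[OF ud] mem by blast
    then show "C4 = max ((1 / C3) * norm_L2 T (\<theta> 0 - \<theta>d)) (norm_Xd T j \<gamma> Yd (u 0 - ud))"
      using assms(30) norm_L2_minus_commute[of T \<theta>d "\<theta> 0"] by simp
  qed
  moreover have "norm_Xd T j \<gamma> Yd (ud - u k) = norm_Xd T j \<gamma> Yd (u k - ud)"
    using U.X.N_minus_commute[OF ud] mem by blast
  ultimately show "(1 / C3) * norm_L2 T (\<theta>d - \<theta> k) \<le> \<sigma>hat ^ k * C4 \<and>
        norm_Xd T j \<gamma> Yd (ud - u k) \<le> \<sigma>hat ^ k * C4"
    using norm_L2_minus_commute[of T \<theta>d "\<theta> k"] by simp
qed

end
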